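(* Let $n\ge1$, $0\le i\le n-1$, and take coefficients in $\mathbb Z$ or an arbitrary field. The set $\{\rho_T:T\in\mathcal T_{n,i}\}$ of fundamental cycles is a basis for $\tilde H_{n-3}((\hat 0,[n]^i))$, and the set $\{\bar c(\Upsilon):\Upsilon\in\mathsf{Liu}^2_{n,i}\}$ is a basis for $\tilde H^{n-3}((\hat 0,[n]^i))$. Here $\mathcal T_{n,i}$ is the set of rooted trees on node set $\{1,\dots,n\}$ with exactly $i$ descents and $\mathsf{Liu}^2_{n,i}$ is the set of Liu–Lyndon trees with leaf label set $\{1,\dots,n\}$ and $i$ red internal nodes.
   Context: Poset. Let $[n]=\{1,\dots,n\}$. A weighted partition of $[n]$ is a set $\{B_1^{v_1},\dots,B_t^{v_t}\}$ where $\{B_1,\dots,B_t\}$ is a partition of $[n]$ and $v_i\in\{0,1,\dots,|B_i|-1\}$. The poset $\Pi_n^w$ is the set of weighted partitions of $[n]$ ordered by: $\{A_1^{w_1},\dots,A_s^{w_s}\}\le\{B_1^{v_1},\dots,B_t^{v_t}\}$ iff $\{A_j\}$ refines $\{B_k\}$ and whenever $B_k=A_{i_1}\cup\cdots\cup A_{i_l}$, then $v_k-(w_{i_1}+\cdots+w_{i_l})\in\{0,\dots,l-1\}$. Its minimum is $\hat 0=\{\{1\}^0,\dots,\{n\}^0\}$ and its maximal elements are $[n]^i:=\{[n]^i\}$, $0\le i\le n-1$. (Co)homology. $\tilde H_r(P)$ is the reduced simplicial homology of the order complex $\Delta(P)$ (faces = chains of $P$). For cohomology, the cochain module $C_r(P)$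 is the free module on chains $\alpha_0<\cdots<\alpha_r$ ($C_{-1}$ is spanned by the empty chain), with $\delta_r(\alpha_0<\cdots<\alpha_r)=\sum_{i=0}^{r+1}(-1)^i\sum_{\alpha\in(\alpha_{i-1},\alpha_i)}(\alpha_0<\cdots<\alpha_{i-1}<\alpha<\alpha_i<\cdots<\alpha_r)$, where $\alpha_{-1},\alpha_{r+1}$ are an adjoined minimum and maximum; $\tilde H^r(P)=\ker\delta_r/\operatorname{im}\delta_{r-1}$. Maximal chains are identified with their classes in top cohomology. For a degenerate interval $(x,x)$, reduced (co)homology is the coefficient ring in degree $-2$ and $0$ otherwise; for $n=1$, $\rho_T$ and $\bar c(\Upsilon)$ are read as the generator in degree $-2$. Cycles $\rho_T$. A descent of a rooted tree on a set of integers is a non-root node whose label is smaller than that of its parent. For a rooted forest $F=\{T_1,\dots,T_k\}$ on node set $[n]$ (a set of rooted trees whose node sets partition $[n]$) let $\alpha(F)=\{A_1^{w_1},\dots,A_k^{w_k}\}$, where $A_j$ is the node set of $T_j$ and $w_j$ its number of descents. For a rooted tree $T$ on $[n]$ with edge set $E(T)$ and $E\subseteq E(T)$, $T_E$ is the subgraph with node set $[n]$ and edge set $E$, a rooted forest (each component rooted at its node closest to the root of $T$). $\Pi_T$ is the induced subposet of $\Pi_n^w$ on $\{\alpha(T_E):E\subseteq E(T)\}$; it is isomorphic to the Boolean algebra on $n-1$ atoms. Its proper part $\overline{\Pi_T}$ ($\Pi_T$ with its minimum and maximum removed) has order complex the barycentric subdivision of the boundary of an $(n-2)$-simplex, and $\rho_T$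 denotes a fundamental cycle of $\Delta(\overline{\Pi_T})$, i.e. a generator of its unique nonvanishing reduced integral simplicial homology group; it is viewed as a cycle of $(\hat 0,[n]^i)$ for $T\in\mathcal T_{n,i}$. Trees. A bicolored binary tree is a complete plane binary tree (every internal node has a left child and a right child) with each internal node colored red or blue. $\mathcal{BT}_{n,i}$ is the set of bicolored binary trees with $n$ leaves, leaves labeled bijectively by $[n]$, with $i$ red internal nodes. $L(x),R(x)$ denote left and right children. Define $v(x)$ recursively: $v(x)$ is the label of $x$ if $x$ is a leaf; $v(x)=\min\{v(L(x)),v(R(x))\}$ if $x$ is a blue internal node; $v(x)=\max\{v(L(x)),v(R(x))\}$ if $x$ is a red internal node. A Liu–Lyndon tree is a labeled bicolored binary tree such that for each internal node $x$: (1) $v(L(x))=v(x)$; (2) if $x$ is blue and $L(x)$ is blue then $v(R(L(x)))>v(R(x))$; (3) if $x$ is red then $L(x)$ is red or is a leaf, and in the former case $v(R(L(x)))<v(R(x))$. $\mathsf{Liu}^2_{n,i}$ is the set of Liu–Lyndon trees in $\mathcal{BT}_{n,i}$. Chains. Put $u(\text{blue})=0$, $u(\text{red})=1$; to $u$-merge two blocks $A^a,B^b$ means to replace them by $(A\cup B)^{a+b+u}$. Postorder lists the internal nodes of the left subtree (recursively), then those of the right subtree, then the root. For $\Upsilon\in\mathcal{BT}_{n,i}$, $c(\Upsilon)$ is the maximal chain of $[\hat 0,[n]^i]$ starting at $\hat 0$ whose rank $k$ element is obtained from its rank $k-1$ element by $u(\mathrm{col}_k)$-merging the blocks whose underlying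 sets are the leaf label sets of the left and right subtrees of the $k$th internal node in postorder, $\mathrm{col}_k$ being its color; $\bar c(\Upsilon)=c(\Upsilon)\setminus\{\hat 0,[n]^i\}$. *)

theory Defs
  imports "HOL-Library.Poly_Mapping" "HOL-Library.Disjoint_Sets"
begin

section \<open>Reduced homology and cohomology of open intervals of a finite poset\<close>

text \<open>
  A poset is given by a carrier \<open>P\<close> and its strict order \<open>lt\<close>. A chain
  \<open>\<alpha>\<^sub>0 < \<dots> < \<alpha>\<^sub>r\<close> is the list \<open>[\<alpha>\<^sub>0, \<dots>, \<alpha>\<^sub>r]\<close>; the empty chain has degree \<open>- 1\<close>.
\<close>

definition open_interval :: "('a \<Rightarrow> 'a \<Rightarrow> bool) \<Rightarrow> 'a set \<Rightarrow> 'a \<Rightarrow> 'a \<Rightarrow> 'a set" where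
  "open_interval lt P x y = {z \<in> P. lt x z \<and> lt z y}"

definition order_chains :: "('a \<Rightarrow> 'a \<Rightarrow> bool) \<Rightarrow> 'a set \<Rightarrow> int \<Rightarrow> 'a list set" where
  "order_chains lt Q r = {xs. sorted_wrt lt xs \<and> set xs \<subseteq> Q \<and> int (length xs) = r + 1}"

text \<open>
  The degenerate interval \<open>(x, x)\<close> has, by convention, a single generator, in degree \<open>- 2\<close>.
  As a list it is \<open>[]\<close>, i.e. the chain consisting of \<open>x\<close> alone with its end points removed.
\<close>

definition interval_chains ::
  "('a \<Rightarrow> 'a \<Rightarrow> bool) \<Rightarrow> 'a set \<Rightarrow> 'a \<Rightarrow> 'a \<Rightarrow> int \<Rightarrow> 'a list set" where
  "interval_chains lt P x y r =
     (if x = y then (if r = - 2 then {[]} else {})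
      else order_chains lt (open_interval lt P x y) r)"

definition chain_module ::
  "('a \<Rightarrow> 'a \<Rightarrow> bool) \<Rightarrow> 'a set \<Rightarrow> 'a \<Rightarrow> 'a \<Rightarrow> int \<Rightarrow> ('a list \<Rightarrow>\<^sub>0 'r::comm_ring_1) set" where
  "chain_module lt P x y r = {f. Poly_Mapping.keys f \<subseteq> interval_chains lt P x y r}"

definition boundary :: "('a list \<Rightarrow>\<^sub>0 'r::comm_ring_1) \<Rightarrow> ('a list \<Rightarrow>\<^sub>0 'r)" where
  "boundary f = (\<Sum>xs \<in> Poly_Mapping.keys f. \<Sum>j < length xs.
     Poly_Mapping.single (take j xs @ drop (Suc j) xs) ((- 1) ^ j * Poly_Mapping.lookup f xs))"

text \<open>
  The elements of \<open>(\<alpha>\<^bsub>j-1\<^esub>, \<alpha>\<^sub>j)\<close>, where \<open>\<alpha>\<^bsub>-1\<^esub>\<close> and \<open>\<alpha>\<^bsub>r+1\<^esub>\<close> are a minimum and a maximum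
  adjoined to \<open>Q\<close>.
\<close>

definition gap :: "('a \<Rightarrow> 'a \<Rightarrow> bool) \<Rightarrow> 'a set \<Rightarrow> 'a list \<Rightarrow> nat \<Rightarrow> 'a set" where
  "gap lt Q xs j =
     {z \<in> Q. (0 < j \<longrightarrow> lt (xs ! (j - 1)) z) \<and> (j < length xs \<longrightarrow> lt z (xs ! j))}"

definition coboundary ::
  "('a \<Rightarrow> 'a \<Rightarrow> bool) \<Rightarrow> 'a set \<Rightarrow> ('a list \<Rightarrow>\<^sub>0 'r::comm_ring_1) \<Rightarrow> ('a list \<Rightarrow>\<^sub>0 'r)" where
  "coboundary lt Q f = (\<Sum>xs \<in> Poly_Mapping.keys f. \<Sum>j \<le> length xs. \<Sum>z \<in> gap lt Q xs j.
     Poly_Mapping.single (take j xs @ z # drop j xs) ((- 1) ^ j * Poly_Mapping.lookup f xs))"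

definition cycles ::
  "('a \<Rightarrow> 'a \<Rightarrow> bool) \<Rightarrow> 'a set \<Rightarrow> 'a \<Rightarrow> 'a \<Rightarrow> int \<Rightarrow> ('a list \<Rightarrow>\<^sub>0 'r::comm_ring_1) set" where
  "cycles lt P x y r = {f \<in> chain_module lt P x y r. boundary f = 0}"

definition boundaries ::
  "('a \<Rightarrow> 'a \<Rightarrow> bool) \<Rightarrow> 'a set \<Rightarrow> 'a \<Rightarrow> 'a \<Rightarrow> int \<Rightarrow> ('a list \<Rightarrow>\<^sub>0 'r::comm_ring_1) set" where
  "boundaries lt P x y r = boundary ` chain_module lt P x y (r + 1)"

definition cocycles ::
  "('a \<Rightarrow> 'a \<Rightarrow> bool) \<Rightarrow> 'a set \<Rightarrow> 'a \<Rightarrow> 'a \<Rightarrow> int \<Rightarrow> ('a list \<Rightarrow>\<^sub>0 'r::comm_ring_1) set" where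
  "cocycles lt P x y r =
     {f \<in> chain_module lt P x y r. coboundary lt (open_interval lt P x y) f = 0}"

definition coboundaries ::
  "('a \<Rightarrow> 'a \<Rightarrow> bool) \<Rightarrow> 'a set \<Rightarrow> 'a \<Rightarrow> 'a \<Rightarrow> int \<Rightarrow> ('a list \<Rightarrow>\<^sub>0 'r::comm_ring_1) set" where
  "coboundaries lt P x y r =
     coboundary lt (open_interval lt P x y) ` chain_module lt P x y (r - 1)"

definition residue_class :: "'m::ab_group_add set \<Rightarrow> 'm \<Rightarrow> 'm set" where
  "residue_class B z = {w. w - z \<in> B}"

definition homology ::
  "('a \<Rightarrow> 'a \<Rightarrow> bool) \<Rightarrow> 'a set \<Rightarrow> 'a \<Rightarrow> 'a \<Rightarrow> int \<Rightarrow> ('a list \<Rightarrow>\<^sub>0 'r::comm_ring_1) set set" where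
  "homology lt P x y r = residue_class (boundaries lt P x y r) ` cycles lt P x y r"

definition cohomology ::
  "('a \<Rightarrow> 'a \<Rightarrow> bool) \<Rightarrow> 'a set \<Rightarrow> 'a \<Rightarrow> 'a \<Rightarrow> int \<Rightarrow> ('a list \<Rightarrow>\<^sub>0 'r::comm_ring_1) set set" where
  "cohomology lt P x y r = residue_class (coboundaries lt P x y r) ` cocycles lt P x y r"

definition scale :: "'r::comm_ring_1 \<Rightarrow> ('c \<Rightarrow>\<^sub>0 'r) \<Rightarrow> ('c \<Rightarrow>\<^sub>0 'r)" where
  "scale c f = Poly_Mapping.map ((*) c) f"

definition lincomb :: "('i \<Rightarrow>\<^sub>0 'r::comm_ring_1) \<Rightarrow> ('i \<Rightarrow> ('c \<Rightarrow>\<^sub>0 'r)) \<Rightarrow> ('c \<Rightarrow>\<^sub>0 'r)" where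
  "lincomb a z = (\<Sum>k \<in> Poly_Mapping.keys a. scale (Poly_Mapping.lookup a k) (z k))"

text \<open>
  \<open>H\<close> is a quotient module modulo \<open>B\<close>, with the operations induced from representatives.
  The predicate says that the classes of \<open>z k\<close>, for \<open>k \<in> I\<close>, form a basis of \<open>H\<close> as an indexed
  family; in particular distinct indices have distinct classes.
\<close>

definition class_basis ::
  "('c \<Rightarrow>\<^sub>0 'r::comm_ring_1) set set \<Rightarrow> ('c \<Rightarrow>\<^sub>0 'r) set \<Rightarrow> 'i set \<Rightarrow> ('i \<Rightarrow> ('c \<Rightarrow>\<^sub>0 'r)) \<Rightarrow> bool" where
  "class_basis H B I z \<longleftrightarrow>
     (\<forall>k \<in> I. residue_class B (z k) \<in> H) \<and>
     (\<forall>h \<in> H. \<exists>!a. Poly_Mapping.keys a \<subseteq> I \<and> h = residue_class B (lincomb a z))"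

definition homology_basis ::
  "('a \<Rightarrow> 'a \<Rightarrow> bool) \<Rightarrow> 'a set \<Rightarrow> 'a \<Rightarrow> 'a \<Rightarrow> int \<Rightarrow> 'i set \<Rightarrow>
    ('i \<Rightarrow> ('a list \<Rightarrow>\<^sub>0 'r::comm_ring_1)) \<Rightarrow> bool" where
  "homology_basis lt P x y r I z \<longleftrightarrow>
     class_basis (homology lt P x y r) (boundaries lt P x y r) I z"

definition cohomology_basis ::
  "('a \<Rightarrow> 'a \<Rightarrow> bool) \<Rightarrow> 'a set \<Rightarrow> 'a \<Rightarrow> 'a \<Rightarrow> int \<Rightarrow> 'i set \<Rightarrow>
    ('i \<Rightarrow> ('a list \<Rightarrow>\<^sub>0 'r::comm_ring_1)) \<Rightarrow> bool" where
  "cohomology_basis lt P x y r I z \<longleftrightarrow>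
     class_basis (cohomology lt P x y r) (coboundaries lt P x y r) I z"


section \<open>The poset of weighted partitions\<close>

text \<open>The pair \<open>(B, v)\<close> is the block \<open>B\<close> with weight \<open>v\<close>.\<close>

type_synonym wpartition = "(nat set \<times> nat) set"

definition wpartitions :: "nat \<Rightarrow> wpartition set" where
  "wpartitions n =
     {X. partition_on {1..n} (fst ` X) \<and> inj_on fst X \<and> (\<forall>(B, v) \<in> X. v < card B)}"

definition wp_le :: "wpartition \<Rightarrow> wpartition \<Rightarrow> bool" where
  "wp_le X Y \<longleftrightarrow>
     (\<forall>(A, w) \<in> X. \<exists>(B, v) \<in> Y. A \<subseteq> B) \<and>
     (\<forall>(B, v) \<in> Y. \<forall>S \<subseteq> X. B = \<Union> (fst ` S) \<longrightarrow>
        int v - (\<Sum>(A, w) \<in> S. int w) \<in> {0..int (card S) - 1})"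

definition wp_less :: "wpartition \<Rightarrow> wpartition \<Rightarrow> bool" where
  "wp_less X Y \<longleftrightarrow> wp_le X Y \<and> X \<noteq> Y"

definition wp_bot :: "nat \<Rightarrow> wpartition" where
  "wp_bot n = (\<lambda>k. ({k}, 0)) ` {1..n}"

definition wp_top :: "nat \<Rightarrow> nat \<Rightarrow> wpartition" where
  "wp_top n i = {({1..n}, i)}"


section \<open>Rooted trees and fundamental cycles\<close>

text \<open>
  A rooted tree, or a rooted forest, on a given node set is represented by its set of edges
  \<open>(parent, child)\<close>. The subforest \<open>T\<^sub>E\<close> of a tree \<open>T\<close> is then the subset \<open>E \<subseteq> T\<close> itself: the node
  of a component closest to the root of \<open>T\<close> is the one without a parent in \<open>E\<close>.
\<close>

definition rooted_tree :: "nat set \<Rightarrow> (nat \<times> nat) set \<Rightarrow> bool" where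
  "rooted_tree V T \<longleftrightarrow> T \<subseteq> V \<times> V \<and>
     (\<exists>r \<in> V. (\<forall>p. (p, r) \<notin> T) \<and> (\<forall>c \<in> V - {r}. \<exists>!p. (p, c) \<in> T) \<and> (\<forall>c \<in> V. (r, c) \<in> T\<^sup>*))"

definition descents :: "(nat \<times> nat) set \<Rightarrow> nat set" where
  "descents F = {c. \<exists>p. (p, c) \<in> F \<and> c < p}"

definition rooted_trees :: "nat \<Rightarrow> nat \<Rightarrow> (nat \<times> nat) set set" where
  "rooted_trees n i = {T. rooted_tree {1..n} T \<and> card (descents T) = i}"

definition components :: "nat \<Rightarrow> (nat \<times> nat) set \<Rightarrow> nat set set" where
  "components n F = {1..n} // {(u, v) \<in> {1..n} \<times> {1..n}. (u, v) \<in> (F \<union> F\<inverse>)\<^sup>*}"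

definition forest_wpartition :: "nat \<Rightarrow> (nat \<times> nat) set \<Rightarrow> wpartition" where
  "forest_wpartition n F = (\<lambda>A. (A, card (A \<inter> descents F))) ` components n F"

definition tree_poset :: "nat \<Rightarrow> (nat \<times> nat) set \<Rightarrow> wpartition set" where
  "tree_poset n T = forest_wpartition n ` Pow T"

text \<open>
  The proper part of \<open>tree_poset n T\<close> is its open interval between \<open>forest_wpartition n {}\<close> and
  \<open>forest_wpartition n T\<close>. For \<open>n = 1\<close> this interval is degenerate.
\<close>

definition fundamental_cycle ::
  "nat \<Rightarrow> (nat \<times> nat) set \<Rightarrow> (wpartition list \<Rightarrow>\<^sub>0 int) \<Rightarrow> bool" where
  "fundamental_cycle n T z \<longleftrightarrow>
     (let P = tree_poset n T; x = forest_wpartition n {}; y = forest_wpartition n T;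
          r = int n - 3
      in z \<in> cycles wp_less P x y r \<and>
         homology wp_less P x y r =
           range (\<lambda>k::int. residue_class (boundaries wp_less P x y r) (scale k z)))"

definition int_coeffs :: "('c \<Rightarrow>\<^sub>0 int) \<Rightarrow> ('c \<Rightarrow>\<^sub>0 'r::comm_ring_1)" where
  "int_coeffs z = Poly_Mapping.map of_int z"


section \<open>Liu--Lyndon trees and their chains\<close>

datatype color = Blue | Red

datatype btree = Leaf nat | Node color btree btree

fun leaves :: "btree \<Rightarrow> nat list" where
  "leaves (Leaf a) = [a]"
| "leaves (Node c l r) = leaves l @ leaves r"

fun red_count :: "btree \<Rightarrow> nat" where
  "red_count (Leaf a) = 0"
| "red_count (Node c l r) = (if c = Red then 1 else 0) + red_count l + red_count r"

definition bicolored_trees :: "nat \<Rightarrow> nat \<Rightarrow> btree set" where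
  "bicolored_trees n i =
     {t. distinct (leaves t) \<and> set (leaves t) = {1..n} \<and> red_count t = i}"

fun valency :: "btree \<Rightarrow> nat" where
  "valency (Leaf a) = a"
| "valency (Node Blue l r) = min (valency l) (valency r)"
| "valency (Node Red l r) = max (valency l) (valency r)"

fun liu_lyndon :: "btree \<Rightarrow> bool" where
  "liu_lyndon (Leaf a) = True"
| "liu_lyndon (Node c l r) \<longleftrightarrow>
     valency l = valency (Node c l r) \<and>
     (c = Blue \<longrightarrow> (\<forall>l1 r1. l = Node Blue l1 r1 \<longrightarrow> valency r1 > valency r)) \<and>
     (c = Red \<longrightarrow> (\<exists>a. l = Leaf a) \<or> (\<exists>l1 r1. l = Node Red l1 r1 \<and> valency r1 < valency r)) \<and>
     liu_lyndon l \<and> liu_lyndon r"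

definition liu_trees :: "nat \<Rightarrow> nat \<Rightarrow> btree set" where
  "liu_trees n i = {t \<in> bicolored_trees n i. liu_lyndon t}"

fun color_weight :: "color \<Rightarrow> nat" where
  "color_weight Blue = 0"
| "color_weight Red = 1"

definition wp_merge :: "nat \<Rightarrow> nat set \<Rightarrow> nat set \<Rightarrow> wpartition \<Rightarrow> wpartition" where
  "wp_merge u A B X =
     {(C, w) \<in> X. C \<noteq> A \<and> C \<noteq> B} \<union> {(A \<union> B, a + b + u) | a b. (A, a) \<in> X \<and> (B, b) \<in> X}"

text \<open>The list of internal nodes in postorder, each with the leaf label sets of its two subtrees.\<close>

fun postorder :: "btree \<Rightarrow> (color \<times> nat set \<times> nat set) list" where
  "postorder (Leaf a) = []"
| "postorder (Node c l r) = postorder l @ postorder r @ [(c, set (leaves l), set (leaves r))]"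

fun merge_chain :: "wpartition \<Rightarrow> (color \<times> nat set \<times> nat set) list \<Rightarrow> wpartition list" where
  "merge_chain X [] = [X]"
| "merge_chain X ((c, A, B) # ms) = X # merge_chain (wp_merge (color_weight c) A B X) ms"

definition tree_chain :: "nat \<Rightarrow> btree \<Rightarrow> wpartition list" where
  "tree_chain n t = merge_chain (wp_bot n) (postorder t)"

definition proper_tree_chain :: "nat \<Rightarrow> nat \<Rightarrow> btree \<Rightarrow> wpartition list" where
  "proper_tree_chain n i t = filter (\<lambda>X. X \<noteq> wp_bot n \<and> X \<noteq> wp_top n i) (tree_chain n t)"

end

theory Submission
  imports Defs "HOL-Combinatorics.Permutations"
begin

text \<open>
  In the top degree there are no boundaries, so homology is the module of cycles, and it pairs with
  cohomology because boundary and coboundary are adjoint. Two facts then give both bases.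

  Spanning. The coboundary of a chain that misses a single rank is, up to sign, the sum of the
  maximal chains refining it. The rank 2 intervals have 2, 3 or 6 inner elements, so the chains of
  trees satisfy, up to signs, antisymmetry, the Jacobi identity for each color and the mixed Jacobi
  identity. Rewriting with these identities reduces every tree to Liu--Lyndon trees. Signs never
  matter: if all terms of an identity but one lie in a submodule, so does the last.

  Unitriangularity. Joining \<open>v(L(x))\<close> to \<open>v(R(x))\<close> for every internal node \<open>x\<close> turns a Liu--Lyndon
  tree \<open>\<Upsilon>\<close> into a rooted tree \<open>T(\<Upsilon>)\<close>, bijectively. The pairing of \<open>\<rho>\<^sub>T\<close> with the chain of \<open>\<Upsilon>\<close>
  is \<open>\<plusminus>1\<close> if the chain lies in \<open>\<Pi>\<^sub>T\<close> and \<open>0\<close> otherwise. The relation ``the chain of \<open>\<Upsilon>\<close> lies in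
  \<open>\<Pi>\<^sub>T\<close>'' has no cycles when \<open>T\<close> is identified with its \<open>\<Upsilon>\<close>: passing from \<open>T(\<Upsilon>)\<close> to such a \<open>T\<close>, the
  sum of the descents minus the sum of the other non-root nodes cannot decrease; if it is constant
  then so is the root, whose degree cannot increase; if that is constant too, the
  components of the tree without its root are the same sets and one argues by induction in each of them.
\<close>

section \<open>Rewriting to Liu--Lyndon trees\<close>

text \<open>Spanning is shown for cochains only. It makes the pairing faithful on cycles: a top
  cycle with coefficient 0 at the chains of all Liu--Lyndon trees pairs to 0 with everything, hence
  is 0. An invertible pairing matrix then gives both bases at once, over any commutative ring, since
  elimination only divides by diagonal entries, whose squares are 1. A diagonal entry is a unit
  because the signed sum over all orderings of the edges of a rooted tree is a cycle with
  coefficient 1 at the chain in question, while \<open>\<rho>\<close> generates all cycles.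
  Reduction to Liu--Lyndon trees has to be kept from looping. Blue roots are settled before red
  ones: the mixed Jacobi identity removes a red node above a blue one at the price of blue-rooted
  terms. Within one color either the valency of the root improves, or the right children are sorted
  modulo trees with fewer of them. That the statistic of descents cannot decrease is proved with a
  surplus: the gain is at least the distance by which the root moves. This surplus pays for the
  changed end of the edge joining two parts; a root that moves into the right part forces a strict
  gain.\<close>

definition jacobi_others :: "color \<Rightarrow> color \<Rightarrow> btree \<Rightarrow> btree \<Rightarrow> btree \<Rightarrow> btree set" where
  "jacobi_others u v A B C =
     {Node v' (Node u' X Y) Z | u' v' X Y Z.
        (u', v') \<in> {(u, v), (v, u)} \<and> (X, Y, Z) \<in> {(A, B, C), (A, C, B), (B, C, A)}}
     - {Node v (Node u A B) C}"

text \<open>\<open>rewr t S\<close> stands for an identity expressing the chain of \<open>t\<close>,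
  up to signs and modulo coboundaries, by the chains of the trees in \<open>S\<close>. For
  \<open>u = v\<close> the six shapes in \<open>jacobi_others\<close> collapse to three, so one rule
  covers the Jacobi identity of each color and the mixed one.\<close>

inductive rewr :: "btree \<Rightarrow> btree set \<Rightarrow> bool" where
  swap: "rewr (Node c l r) {Node c r l}"
| jacobi: "rewr (Node v (Node u A B) C) (jacobi_others u v A B C)"
| left: "rewr t S \<Longrightarrow> rewr (Node c t r) ((\<lambda>s. Node c s r) ` S)"
| right: "rewr t S \<Longrightarrow> rewr (Node c l t) (Node c l ` S)"

text \<open>A derivation is a finite tree of rewritings ending in \<open>B\<close>. Since
  \<open>rewr\<close> itself loops, \<open>swap\<close> being its own inverse, finiteness has to
  come from the inductions that build the derivations.\<close>

inductive generated :: "btree set \<Rightarrow> btree \<Rightarrow> bool" for B where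
  base: "t \<in> B \<Longrightarrow> generated B t"
| rewrite: "rewr t S \<Longrightarrow> (\<And>s. s \<in> S \<Longrightarrow> generated B s) \<Longrightarrow> generated B t"

lemma rewr_invariant:
  assumes "rewr t S" "s \<in> S"
  shows "mset (leaves s) = mset (leaves t) \<and> red_count s = red_count t"
  using assms
  by (induction arbitrary: s) (auto simp: jacobi_others_def)

definition liu_on :: "nat set \<Rightarrow> btree set" where
  "liu_on V = {s. liu_lyndon s \<and> distinct (leaves s) \<and> set (leaves s) = V}"

text \<open>One-hole contexts, encoded as the functions that carry rewritings to rewritings;
  composites such as the remainder of a spine are then contexts at no cost.\<close>

definition rewr_inside :: "(btree \<Rightarrow> btree) \<Rightarrow> bool" where
  "rewr_inside C \<longleftrightarrow> (\<forall>t S. rewr t S \<longrightarrow> rewr (C t) (C ` S))"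

lemma rewr_inside_left: "rewr_inside (\<lambda>s. Node c s r)"
  by (simp add: rewr_inside_def rewr.left)

lemma rewr_inside_right: "rewr_inside (Node c l)"
  by (simp add: rewr_inside_def rewr.right)

lemma rewr_inside_comp:
  "rewr_inside C \<Longrightarrow> rewr_inside D \<Longrightarrow> rewr_inside (\<lambda>s. C (D s))"
  unfolding rewr_inside_def by (metis image_image)

lemma rewr_inside_foldl: "rewr_inside (\<lambda>s. foldl (Node c) s ys)"
proof (induction ys rule: rev_induct)
  case Nil
  show ?case by (simp add: rewr_inside_def)
next
  case (snoc y ys)
  show ?case using rewr_inside_comp[OF rewr_inside_left snoc.IH] by simp
qed

lemma generated_inside:
  assumes "generated B t" "rewr_inside C" "\<And>s. s \<in> B \<Longrightarrow> generated B' (C s)"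
  shows "generated B' (C t)"
  using assms(1)
proof induction
  case (rewrite t S)
  then show ?case
    using assms(2) by (auto simp: rewr_inside_def intro!: generated.rewrite[of "C t" "C ` S"])
qed (use assms in auto)

lemma rewr_inside_swap:
  assumes "rewr_inside C" "generated B (C (Node c r l))"
  shows "generated B (C (Node c l r))"
proof (rule generated.rewrite)
  show "rewr (C (Node c l r)) (C ` {Node c r l})"
    using assms(1) rewr.swap unfolding rewr_inside_def by blast
qed (use assms(2) in auto)

lemma rewr_inside_jacobi:
  assumes "rewr_inside C" "\<And>s. s \<in> jacobi_others u v X Y Z \<Longrightarrow> generated B (C s)"
  shows "generated B (C (Node v (Node u X Y) Z))"
proof (rule generated.rewrite)
  show "rewr (C (Node v (Node u X Y) Z)) (C ` jacobi_others u v X Y Z)"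
    using assms(1) rewr.jacobi unfolding rewr_inside_def by blast
qed (use assms(2) in auto)

lemma rewr_inside_id: "rewr_inside (\<lambda>s. s)"
  by (simp add: rewr_inside_def)

section \<open>Valencies ordered by color\<close>

definition better :: "color \<Rightarrow> nat \<Rightarrow> nat \<Rightarrow> bool" where
  "better c a b = (case c of Blue \<Rightarrow> a < b | Red \<Rightarrow> b < a)"

lemma better_irrefl: "\<not> better c a a"
  by (cases c) (auto simp: better_def)

lemma better_trans: "better c a b \<Longrightarrow> better c b d \<Longrightarrow> better c a d"
  by (cases c) (auto simp: better_def)

lemma better_total: "a \<noteq> b \<Longrightarrow> better c a b \<or> better c b a"
  by (cases c) (auto simp: better_def)

lemma valency_Node:
  "valency (Node c l r) = (if better c (valency r) (valency l) then valency r else valency l)"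
  by (cases c) (auto simp: better_def min_def max_def)

lemma valency_in: "valency t \<in> set (leaves t)"
  by (induction t) (auto simp: valency_Node)

lemma leaves_nonempty: "leaves t \<noteq> []"
  by (induction t) auto

lemma valency_neq: "distinct (leaves l @ leaves r) \<Longrightarrow> valency l \<noteq> valency r"
  using valency_in[of l] valency_in[of r] by auto

text \<open>In terms of \<open>better\<close> the two colors obey the same conditions, with one
  asymmetry: a red node must not have a blue left child, while a blue node may have a red one. This
  is the choice of normal form for the mixed Jacobi identity.\<close>

lemma liu_lyndon_Node:
  assumes "distinct (leaves l @ leaves r)"
  shows "liu_lyndon (Node c l r) \<longleftrightarrow>
    better c (valency l) (valency r) \<and>
    (\<forall>l1 r1. l = Node c l1 r1 \<longrightarrow> better c (valency r) (valency r1)) \<and>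
    (c = Red \<longrightarrow> (\<forall>l1 r1. l \<noteq> Node Blue l1 r1)) \<and> liu_lyndon l \<and> liu_lyndon r"
proof -
  have ne: "valency l \<noteq> valency r" by (rule valency_neq[OF assms])
  show ?thesis
  proof (cases c)
    case Blue
    then show ?thesis using ne by (auto simp: better_def min_def)
  next
    case Red
    have "(\<exists>a. l = Leaf a) \<or> (\<exists>l1 r1. l = Node Red l1 r1) \<longleftrightarrow> (\<forall>l1 r1. l \<noteq> Node Blue l1 r1)"
      by (cases l rule: valency.cases) auto
    then show ?thesis using Red ne by (auto simp: better_def max_def)
  qed
qed

section \<open>Left spines of one color\<close>

abbreviation (input) spine :: "color \<Rightarrow> btree \<Rightarrow> btree list \<Rightarrow> btree" where
  "spine c Z Ds \<equiv> foldl (Node c) Z Ds"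

lemma leaves_spine: "leaves (spine c Z Ds) = leaves Z @ concat (map leaves Ds)"
  by (induction Ds arbitrary: Z) auto

text \<open>Sorting by adjacent exchanges: the tail is arranged first, behind the head, which then
  moves right to its place. The prefix \<open>zs\<close> holds what is already fixed.\<close>

lemma perm_adjacent:
  assumes step: "\<And>xs a b ys. Q (xs @ a # b # ys) \<Longrightarrow> Q (xs @ b # a # ys)"
    and "Q (zs @ xs)" "mset xs = mset ys"
  shows "Q (zs @ ys)"
  using assms(2,3)
proof (induction xs arbitrary: zs ys)
  case Nil
  then show ?case by simp
next
  case (Cons x xs)
  have "x \<in> set ys" using Cons.prems(2) by (metis list.set_intros(1) set_mset_mset)
  then obtain us vs where ys: "ys = us @ x # vs" by (meson split_list)
  then have "mset xs = mset (us @ vs)" using Cons.prems(2) by simp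
  then have 1: "Q ((zs @ [x]) @ us @ vs)" using Cons.IH[of "zs @ [x]"] Cons.prems(1) by simp
  have "Q (zs @ us @ x # vs)"
    using 1
  proof (induction us arbitrary: zs)
    case (Cons u us)
    have "Q (zs @ u # x # us @ vs)" using step[of zs x u "us @ vs"] Cons.prems by simp
    then show ?case using Cons.IH[of "zs @ [u]"] by simp
  qed simp
  then show ?case using ys by simp
qed

text \<open>Conditions (2) and (3) compare neighbouring right children of one color, so sorting the
  right children, best one outermost, secures them along the whole spine. A red spine has to start
  at a leaf because a red node tolerates no blue left child.\<close>

lemma spine_sorted_liu:
  assumes "liu_lyndon Z" "\<forall>D \<in> set Ds. liu_lyndon D" "distinct (leaves (spine c Z Ds))"
    "\<forall>l r. Z \<noteq> Node c l r" "c = Red \<longrightarrow> (\<exists>a. Z = Leaf a)"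
    "\<forall>D \<in> set Ds. better c (valency Z) (valency D)"
    "sorted_wrt (\<lambda>D D'. better c (valency D') (valency D)) Ds"
  shows "liu_lyndon (spine c Z Ds) \<and> valency (spine c Z Ds) = valency Z"
  using assms(2-)
proof (induction Ds rule: rev_induct)
  case Nil
  then show ?case using assms(1) by simp
next
  case (snoc D Ds)
  have IH: "liu_lyndon (spine c Z Ds) \<and> valency (spine c Z Ds) = valency Z"
    using snoc by (auto simp: sorted_wrt_append)
  have d: "distinct (leaves (spine c Z Ds) @ leaves D)" using snoc.prems by simp
  have b: "better c (valency Z) (valency D)" using snoc.prems by simp
  have "\<forall>l1 r1. spine c Z Ds = Node c l1 r1 \<longrightarrow> better c (valency D) (valency r1)"
    using snoc.prems by (cases Ds rule: rev_cases) (auto simp: sorted_wrt_append)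
  moreover have "c = Red \<longrightarrow> (\<forall>l1 r1. spine c Z Ds \<noteq> Node Blue l1 r1)"
    using snoc.prems by (cases Ds rule: rev_cases) auto
  ultimately have "liu_lyndon (spine c Z (Ds @ [D]))"
    using liu_lyndon_Node[OF d, of c] IH b snoc.prems by simp
  moreover have "\<not> better c (valency D) (valency (spine c Z Ds))"
    using IH b better_trans better_irrefl by metis
  ultimately show ?case using IH by (simp add: valency_Node del: valency.simps liu_lyndon.simps)
qed

text \<open>Going down left from a red node never meets a blue one, so a nonempty red spine ends at
  a leaf. A blue spine may end at a leaf or at a red node.\<close>

lemma liu_spine_decomp:
  assumes "liu_lyndon t" "distinct (leaves t)"
  obtains Z Ds where "t = spine c Z Ds" "liu_lyndon Z" "\<forall>D \<in> set Ds. liu_lyndon D"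
    "\<forall>l r. Z \<noteq> Node c l r" "valency Z = valency t" "Ds = [] \<longleftrightarrow> t = Z"
    "c = Red \<longrightarrow> (\<exists>a. Z = Leaf a) \<or> t = Z"
  using assms
proof (induction t arbitrary: thesis)
  case (Leaf a)
  show ?case by (rule Leaf(1)[of "Leaf a" "[]"]) auto
next
  case (Node d l r)
  show ?case
  proof (cases "d = c")
    case False
    show ?thesis by (rule Node.prems(1)[of "Node d l r" "[]"]) (use False Node.prems in auto)
  next
    case True
    have dist: "distinct (leaves l @ leaves r)" using Node.prems by simp
    have L: "better c (valency l) (valency r)" "liu_lyndon l" "liu_lyndon r"
      "c = Red \<longrightarrow> (\<forall>l1 r1. l \<noteq> Node Blue l1 r1)"
      using Node.prems(2) liu_lyndon_Node[OF dist, of d] True by auto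
    obtain Z Ds where Z: "l = spine c Z Ds" "liu_lyndon Z" "\<forall>D \<in> set Ds. liu_lyndon D"
      "\<forall>l r. Z \<noteq> Node c l r" "valency Z = valency l" "Ds = [] \<longleftrightarrow> l = Z"
      "c = Red \<longrightarrow> (\<exists>a. Z = Leaf a) \<or> l = Z"
      using Node.IH(1) L(2) dist by (metis distinct_append)
    have v: "valency (Node d l r) = valency l"
      using L(1) True better_trans better_irrefl by (metis valency_Node)
    have ZL: "c = Red \<longrightarrow> (\<exists>a. Z = Leaf a)"
    proof
      assume "c = Red"
      show "\<exists>a. Z = Leaf a"
      proof (cases Z)
        case (Node d' l' r')
        then have "d' = Blue" using Z(4) \<open>c = Red\<close> by (cases d') auto
        then show ?thesis using Z(7) L(4) Node \<open>c = Red\<close> by auto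
      qed auto
    qed
    have ne: "Node d l r \<noteq> Z" using Z(4) True by auto
    show ?thesis
      by (rule Node.prems(1)[of Z "Ds @ [r]"]) (use True Z v ZL L ne in auto)
  qed
qed


lemma generated_liu_on:
  "liu_lyndon t \<Longrightarrow> distinct (leaves t) \<Longrightarrow> set (leaves t) = V \<Longrightarrow> generated (liu_on V) t"
  by (simp add: generated.base liu_on_def)

section \<open>Reduction to Liu--Lyndon trees by induction on the leaf set\<close>

locale liu_induction =
  fixes V :: "nat set"
  assumes smaller: "\<And>s. distinct (leaves s) \<Longrightarrow> set (leaves s) \<subset> V \<Longrightarrow>
    generated (liu_on (set (leaves s))) s"
begin

definition on_V :: "btree \<Rightarrow> bool" where
  "on_V t \<longleftrightarrow> distinct (leaves t) \<and> set (leaves t) = V"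

abbreviation good :: "btree \<Rightarrow> bool" where
  "good \<equiv> generated (liu_on V)"

text \<open>This is where the induction on \<open>V\<close> enters: a subtree on fewer leaves may be
  assumed Liu--Lyndon, in any context.\<close>

lemma good_replace:
  assumes "rewr_inside C" "distinct (leaves s)" "set (leaves s) \<subset> V"
    "\<And>s'. liu_lyndon s' \<Longrightarrow> distinct (leaves s') \<Longrightarrow> set (leaves s') = set (leaves s) \<Longrightarrow> good (C s')"
  shows "good (C s)"
  by (rule generated_inside[OF smaller[OF assms(2,3)] assms(1)])
    (use assms(4) in \<open>auto simp: liu_on_def\<close>)

lemma good_swap: "good (Node c r l) \<Longrightarrow> good (Node c l r)"
  using rewr_inside_swap[OF rewr_inside_id] .

lemma psubset_leaves:
  assumes "on_V (Node c l r)"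
  shows "distinct (leaves l)" "distinct (leaves r)" "set (leaves l) \<subset> V" "set (leaves r) \<subset> V"
  using assms valency_in[of l] valency_in[of r] by (auto simp: on_V_def)

text \<open>Modulo shorter spines, neighbouring entries of a spine commute: the third term of the
  one-colored Jacobi identity is a spine in which the two entries are joined into one, and this
  entry becomes Liu--Lyndon by the induction on \<open>V\<close>. So the entries may be put in any
  order. An entry that beats \<open>v\<close> is moved to the end, where \<open>H\<close> applies;
  if there is none, sorting yields a Liu--Lyndon tree.\<close>

lemma good_spine:
  assumes H: "\<And>l r. on_V (Node c l r) \<Longrightarrow> liu_lyndon l \<Longrightarrow> liu_lyndon r \<Longrightarrow>
      better c (valency l) v \<or> better c (valency r) v \<Longrightarrow> good (Node c l r)"
    and Z: "liu_lyndon Z" "valency Z = v" "\<forall>l r. Z \<noteq> Node c l r" "c = Red \<longrightarrow> (\<exists>a. Z = Leaf a)"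
  shows "on_V (spine c Z Ds) \<Longrightarrow> \<forall>D \<in> set Ds. liu_lyndon D \<Longrightarrow> Ds \<noteq> [] \<Longrightarrow> good (spine c Z Ds)"
proof (induction "length Ds" arbitrary: Ds rule: less_induct)
  case less
  define Q where "Q Es \<longleftrightarrow> (mset Es = mset Ds \<longrightarrow> good (spine c Z Es))" for Es
  have onE: "on_V (spine c Z Es)" if "mset Es = mset Ds" for Es
  proof -
    have "mset (leaves (spine c Z Es)) = mset (leaves Z) + sum_mset (image_mset (mset \<circ> leaves) (mset Es))" for Es
      by (induction Es rule: rev_induct) auto
    then have "mset (leaves (spine c Z Es)) = mset (leaves (spine c Z Ds))" using that by metis
    then show ?thesis using less.prems(1) unfolding on_V_def
      by (metis mset_eq_imp_distinct_iff set_mset_mset)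
  qed
  have adj: "Q (xs @ b # a # ys)" if Qab: "Q (xs @ a # b # ys)" for xs a b ys
    unfolding Q_def
  proof
    assume ms: "mset (xs @ b # a # ys) = mset Ds"
    define P where "P = spine c Z xs"
    define C where "C = (\<lambda>s. foldl (Node c) s ys)"
    have C: "rewr_inside C" unfolding C_def by (rule rewr_inside_foldl)
    have onb: "on_V (spine c Z (xs @ b # a # ys))" by (rule onE[OF ms])
    have sub: "set Ds = set (xs @ b # a # ys)" using ms by (metis set_mset_mset)
    have 1: "good (C (Node c (Node c P a) b))"
    proof -
      have "mset (xs @ a # b # ys) = mset (xs @ b # a # ys)" 
        unfolding mset_append mset.simps by (metis add_mset_commute)
      then have "good (spine c Z (xs @ a # b # ys))" using Qab ms by (simp only: Q_def)
      then show ?thesis by (simp add: C_def P_def)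
    qed
    have 2: "good (C (Node c P (Node c b a)))"
    proof -
      have "good ((\<lambda>s. C (Node c P s)) (Node c b a))"
      proof (rule good_replace[where C = "\<lambda>s. C (Node c P s)"])
        show "rewr_inside (\<lambda>s. C (Node c P s))"
          by (rule rewr_inside_comp[OF C rewr_inside_right])
        have d: "distinct (leaves Z @ concat (map leaves (xs @ b # a # ys)))"
            "V = set (leaves Z @ concat (map leaves (xs @ b # a # ys)))"
          using onb by (simp_all add: on_V_def leaves_spine)
        show "distinct (leaves (Node c b a))" using d(1) by auto
        \<comment> \<open>The joined entry misses the leaf \<open>valency Z\<close>, so its leaves
          form a proper subset of \<open>V\<close>.\<close>
        have "valency Z \<in> V - set (leaves (Node c b a))" using d valency_in[of Z] by auto
        then show "set (leaves (Node c b a)) \<subset> V" using d(2) by auto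
        fix M assume M: "liu_lyndon M" "distinct (leaves M)" "set (leaves M) = set (leaves (Node c b a))"
        have "good (spine c Z (xs @ M # ys))"
        proof (rule less.hyps)
          show "length (xs @ M # ys) < length Ds" using mset_eq_length[OF ms] by simp
          show "on_V (spine c Z (xs @ M # ys))"
            using onb M by (fastforce simp: on_V_def leaves_spine)
          show "\<forall>D\<in>set (xs @ M # ys). liu_lyndon D" using less.prems(2) sub M by auto
        qed simp
        then show "good (C (Node c P M))" by (simp add: C_def P_def)
      qed
      then show ?thesis .
    qed
    have "good (C (Node c (Node c P b) a))"
    proof (rule rewr_inside_jacobi[OF C])
      fix s assume "s \<in> jacobi_others c c P b a"
      then have "s = Node c (Node c P a) b \<or> s = Node c (Node c b a) P"
        by (auto simp: jacobi_others_def)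
      then show "good (C s)" using 1 rewr_inside_swap[OF C 2] by auto
    qed
    then show "good (spine c Z (xs @ b # a # ys))" by (simp add: C_def P_def)
  qed
  have reorder: "good (spine c Z Ds)" if "mset Es = mset Ds" "good (spine c Z Es)" for Es
    using perm_adjacent[of Q "[]" Es Ds, OF adj] that by (simp add: Q_def)
  show ?case
  proof (cases "\<exists>D \<in> set Ds. better c (valency D) v")
    case True
    then obtain xs D ys where D: "Ds = xs @ D # ys" "better c (valency D) v" by (meson split_list)
    define P where "P = spine c Z (xs @ ys)"
    have on: "on_V (Node c P D)" using onE[of "(xs @ ys) @ [D]"] D by (simp add: P_def)
    have "good ((\<lambda>s. Node c s D) P)"
    proof (rule good_replace[OF rewr_inside_left])
      show "distinct (leaves P)" "set (leaves P) \<subset> V" using psubset_leaves[OF on] by auto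
      fix s assume s: "liu_lyndon s" "distinct (leaves s)" "set (leaves s) = set (leaves P)"
      show "good (Node c s D)"
        by (rule H) (use s on D less.prems in \<open>auto simp: on_V_def\<close>)
    qed
    then show ?thesis using reorder[of "(xs @ ys) @ [D]"] D by (simp add: P_def)
  next
    case False
    \<comment> \<open>The outer right child has to be the better one: the larger for red, the
      smaller for blue.\<close>
    define Es where "Es = (if c = Red then sort_key valency Ds else rev (sort_key valency Ds))"
    have ms: "mset Es = mset Ds" by (simp add: Es_def)
    then have se: "set Es = set Ds" by (metis set_mset_mset)
    have on: "on_V (spine c Z Es)" by (rule onE[OF ms])
    have dl: "distinct (leaves Z @ concat (map leaves Es))" using on by (simp add: on_V_def leaves_spine)
    have "distinct (map valency Es)"
    proof -
      have "distinct (concat (map leaves Es)) \<Longrightarrow> distinct (map valency Es)" for Es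
      proof (induction Es)
        case (Cons E Es)
        have "valency E \<notin> valency ` set Es"
        proof
          assume "valency E \<in> valency ` set Es"
          then obtain F where "F \<in> set Es" "valency E = valency F" by auto
          then have "valency E \<in> set (leaves E) \<inter> (\<Union>x\<in>set Es. set (leaves x))"
            using valency_in[of E] valency_in[of F] by auto
          then show False using Cons.prems by auto
        qed
        then show ?case using Cons by simp
      qed simp
      then show ?thesis using dl by simp
    qed
    moreover have "sorted_wrt (\<lambda>D D'. valency D' \<le> valency D) Es \<or> c = Red"
      using sorted_sort_key[of valency Ds] by (simp add: Es_def sorted_wrt_rev sorted_wrt_map)
    moreover have "sorted_wrt (\<lambda>D D'. valency D \<le> valency D') Es \<or> c \<noteq> Red"
      using sorted_sort_key[of valency Ds] by (simp add: Es_def sorted_wrt_map)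
    ultimately have "sorted_wrt (\<lambda>D D'. better c (valency D') (valency D)) Es"
      by (cases c) (auto simp: better_def sorted_wrt_iff_nth_less distinct_conv_nth order.strict_iff_order)
    moreover have "\<forall>D \<in> set Es. better c v (valency D)"
    proof
      fix D assume D: "D \<in> set Es"
      then have "valency D \<noteq> v" using dl valency_in[of D] valency_in[of Z] Z(2) by fastforce
      then show "better c v (valency D)" using False D se better_total by blast
    qed
    ultimately have "liu_lyndon (spine c Z Es)"
      using spine_sorted_liu[of Z Es c] Z less.prems(2) se on by (auto simp: on_V_def)
    then have "good (spine c Z Es)" using on generated_liu_on by (simp add: on_V_def)
    then show ?thesis by (rule reorder[OF ms])
  qed
qed

lemma good_parts:
  assumes "on_V (Node c l r)"
    "\<And>l' r'. on_V (Node c l' r') \<Longrightarrow> liu_lyndon l' \<Longrightarrow> liu_lyndon r' \<Longrightarrow> good (Node c l' r')"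
  shows "good (Node c l r)"
proof -
  note p = psubset_leaves[OF assms(1)]
  have "good ((\<lambda>s. Node c s r) l)"
  proof (rule good_replace[OF rewr_inside_left p(1,3)])
    fix l' assume l': "liu_lyndon l'" "distinct (leaves l')" "set (leaves l') = set (leaves l)"
    have "good (Node c l' r)"
      by (rule good_replace[OF rewr_inside_right p(2,4)], rule assms(2))
        (use l' assms(1) in \<open>auto simp: on_V_def\<close>)
    then show "good (Node c l' r)" .
  qed
  then show ?thesis .
qed

lemma on_V_swap: "on_V (Node c r l) \<longleftrightarrow> on_V (Node c l r)"
  by (auto simp: on_V_def)

text \<open>Induction on the smaller of the two valencies, which supplies \<open>H\<close> of
  \<open>good_spine\<close>. A blue spine may start at any tree whose root is not blue, so
  one-colored rewriting suffices.\<close>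

lemma good_Blue_liu:
  "on_V (Node Blue l r) \<Longrightarrow> liu_lyndon l \<Longrightarrow> liu_lyndon r \<Longrightarrow> good (Node Blue l r)"
proof (induction "min (valency l) (valency r)" arbitrary: l r rule: less_induct)
  case less
  have main: "good (Node Blue l r)"
    if prems: "on_V (Node Blue l r)" "liu_lyndon l" "liu_lyndon r" "valency l < valency r"
      and IH: "\<And>l' r'. min (valency l') (valency r') < min (valency l) (valency r) \<Longrightarrow>
        on_V (Node Blue l' r') \<Longrightarrow> liu_lyndon l' \<Longrightarrow> liu_lyndon r' \<Longrightarrow> good (Node Blue l' r')" for l r
  proof -
    have "distinct (leaves l)" using prems by (simp add: on_V_def)
    from liu_spine_decomp[OF prems(2) this, of Blue] obtain Z Ds where
      Z: "l = spine Blue Z Ds" "liu_lyndon Z" "\<forall>D \<in> set Ds. liu_lyndon D"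
      "\<forall>l r. Z \<noteq> Node Blue l r" "valency Z = valency l" by metis
    have "good (spine Blue Z (Ds @ [r]))"
      by (rule good_spine[where v = "valency l"])
        (use Z prems IH in \<open>auto simp: better_def min_def\<close>)
    then show ?thesis using Z by simp
  qed
  have "valency l \<noteq> valency r" using less.prems(1) by (intro valency_neq) (simp add: on_V_def)
  then consider "valency l < valency r" | "valency r < valency l" by linarith
  then show ?case
  proof cases
    case 1
    then show ?thesis using main[of l r] less by simp
  next
    case 2
    have "good (Node Blue r l)"
      by (rule main) (use 2 less in \<open>auto simp: on_V_swap min.commute\<close>)
    then show ?thesis by (rule good_swap)
  qed
qed

lemma good_Blue: "on_V (Node Blue l r) \<Longrightarrow> good (Node Blue l r)"
  by (rule good_parts[OF _ good_Blue_liu])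

text \<open>The larger valency grows towards \<open>Max V\<close>. Blue-rooted trees are already
  settled, so of the five other terms of the mixed Jacobi identity only the two red-rooted ones
  require an argument.\<close>

lemma good_Red_liu:
  assumes "on_V (Node Red l r)" "liu_lyndon l" "liu_lyndon r"
  shows "good (Node Red l r)"
  using assms
proof (induction "Max V - max (valency l) (valency r)" arbitrary: l r rule: less_induct)
  case less
  have finV: "finite V" using less.prems(1) by (auto simp: on_V_def)
  have le: "max (valency l') (valency r') \<le> Max V" if "on_V (Node Red l' r')" for l' r'
    using that valency_in[of l'] valency_in[of r'] finV by (auto simp: on_V_def)
  define v where "v = max (valency l) (valency r)"
  have H: "good (Node Red l' r')"
    if "on_V (Node Red l' r')" "liu_lyndon l'" "liu_lyndon r'" "v < max (valency l') (valency r')" for l' r'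
  proof (rule less.hyps[OF _ that(1-3)])
    show "Max V - max (valency l') (valency r') < Max V - max (valency l) (valency r)"
      by (rule diff_less_mono2) (use that(4) le[OF that(1)] in \<open>unfold v_def, linarith+\<close>)
  qed
  \<comment> \<open>Inner induction on the size of the left child, at fixed valency
    \<open>v\<close>: splitting a blue left child leaves its own left subtree \<open>A\<close>,
    which still has valency \<open>v\<close> and is smaller.\<close>
  have main: "good (Node Red l r)"
    if "on_V (Node Red l r)" "liu_lyndon l" "liu_lyndon r" "valency r < valency l" "valency l = v" for l r
    using that
  proof (induction "size l" arbitrary: l r rule: less_induct)
    case less
    have dist: "distinct (leaves l)" using less.prems by (simp add: on_V_def)
    show ?case
    proof (cases "\<exists>A B. l = Node Blue A B")
      case False
      from liu_spine_decomp[OF less.prems(2) dist, of Red] obtain Z Ds where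
        Z: "l = spine Red Z Ds" "liu_lyndon Z" "\<forall>D \<in> set Ds. liu_lyndon D"
        "\<forall>l r. Z \<noteq> Node Red l r" "valency Z = valency l" "(\<exists>a. Z = Leaf a) \<or> l = Z" by metis
      have "\<exists>a. Z = Leaf a"
        using Z(4,6) False by (metis (full_types) btree.exhaust color.exhaust)
      then have "good (spine Red Z (Ds @ [r]))"
        by (intro good_spine[where v = v])
          (use Z less.prems H in \<open>auto simp: better_def\<close>)
      then show ?thesis using Z by simp
    next
      case True
      then obtain A B where l: "l = Node Blue A B" by blast
      have AB: "valency A < valency B" "liu_lyndon A" "liu_lyndon B"
        using less.prems(2) liu_lyndon_Node[of A B Blue] dist by (auto simp: l better_def)
      have vA: "valency A = v" using less.prems(5) AB by (simp add: l)
      have "good (Node Red (Node Blue A B) r)"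
      proof (rule rewr_inside_jacobi[OF rewr_inside_id])
        fix s assume s: "s \<in> jacobi_others Blue Red A B r"
        have on: "on_V (Node Red (Node Blue A B) r)" using less.prems(1) l by simp
        have onBA: "on_V (Node Red (Node Blue B r) A)" "on_V (Node Red (Node Blue A r) B)"
          using on by (auto simp: on_V_def)
        have A: "good (Node Red (Node Blue B r) A)"
        proof -
          have "good ((\<lambda>s. Node Red s A) (Node Blue B r))"
          proof (rule good_replace[OF rewr_inside_left psubset_leaves(1,3)[OF onBA(1)]])
            fix M assume M: "liu_lyndon M" "distinct (leaves M)" "set (leaves M) = set (leaves (Node Blue B r))"
            have onM: "on_V (Node Red M A)" "on_V (Node Red A M)" using M onBA(1) by (auto simp: on_V_def)
            have "valency M \<noteq> valency A" using onM(1) by (intro valency_neq) (simp add: on_V_def)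
            \<comment> \<open>Above \<open>v\<close> the outer induction applies; below
              \<open>v\<close> a swap makes \<open>A\<close> the left child, and the inner induction
              applies.\<close>
            then consider "valency M > v" | "valency M < v" using vA by linarith
            then show "good (Node Red M A)"
            proof cases
              case 1
              show ?thesis by (rule H) (use 1 onM M AB in auto)
            next
              case 2
              have "good (Node Red A M)"
                by (rule less.hyps) (use 2 onM M AB vA l in auto)
              then show ?thesis by (rule good_swap)
            qed
          qed
          then show ?thesis .
        qed
        \<comment> \<open>\<open>B\<close> is the right child of a blue node with valency
          \<open>v\<close>, so its valency exceeds \<open>v\<close>, and the outer induction applies
          whatever \<open>M\<close> is.\<close>
        have B: "good (Node Red (Node Blue A r) B)"
        proof -
          have "good ((\<lambda>s. Node Red s B) (Node Blue A r))"
          proof (rule good_replace[OF rewr_inside_left psubset_leaves(1,3)[OF onBA(2)]])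
            fix M assume M: "liu_lyndon M" "distinct (leaves M)" "set (leaves M) = set (leaves (Node Blue A r))"
            show "good (Node Red M B)"
              by (rule H) (use M onBA(2) AB vA in \<open>auto simp: on_V_def\<close>)
          qed
          then show ?thesis .
        qed
        have C: "good (Node Blue X Y)" if "set (leaves X @ leaves Y) = set (leaves A @ leaves B @ leaves r)"
          "distinct (leaves X @ leaves Y)" for X Y
          by (rule good_Blue) (use that on in \<open>auto simp: on_V_def\<close>)
        have "s \<in> {Node Red (Node Blue A r) B, Node Red (Node Blue B r) A,
            Node Blue (Node Red A B) r, Node Blue (Node Red A r) B, Node Blue (Node Red B r) A}"
          using s by (auto simp: jacobi_others_def)
        moreover have "good (Node Blue (Node Red A B) r)"
          using C[of "Node Red A B" r] on by (auto simp: on_V_def)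
        moreover have "good (Node Blue (Node Red A r) B)"
          using C[of "Node Red A r" B] on by (auto simp: on_V_def)
        moreover have "good (Node Blue (Node Red B r) A)"
          using C[of "Node Red B r" A] on by (auto simp: on_V_def)
        ultimately show "good s" using A B by auto
      qed
      then show ?thesis by (simp add: l)
    qed
  qed
  have "valency l \<noteq> valency r" using less.prems(1) by (intro valency_neq) (simp add: on_V_def)
  then consider "valency r < valency l" | "valency l < valency r" by linarith
  then show ?case
  proof cases
    case 1
    then have "valency l = v" by (simp add: v_def)
    with 1 show ?thesis by (intro main less.prems)
  next
    case 2
    then have "valency r = v" by (simp add: v_def)
    moreover have "on_V (Node Red r l)" using less.prems(1) by (subst on_V_swap)
    ultimately have "good (Node Red r l)" using 2 by (intro main less.prems)
    then show ?thesis by (rule good_swap)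
  qed
qed

lemma good_all: "on_V t \<Longrightarrow> good t"
proof (cases t)
  case (Leaf a)
  then show "on_V t \<Longrightarrow> good t" by (intro generated_liu_on) (auto simp: on_V_def)
next
  case (Node c l r)
  then show "on_V t \<Longrightarrow> good t"
    using good_Blue[of l r] good_parts[OF _ good_Red_liu, of l r] by (cases c) simp_all
qed

end

theorem liu_trees_generate:
  "distinct (leaves t) \<Longrightarrow> generated (liu_on (set (leaves t))) t"
proof (induction "card (set (leaves t))" arbitrary: t rule: less_induct)
  case less
  interpret liu_induction "set (leaves t)"
  proof
    fix s assume "distinct (leaves s)" "set (leaves s) \<subset> set (leaves t)"
    then show "generated (liu_on (set (leaves s))) s"
      by (intro less.hyps psubset_card_mono) auto
  qed
  show ?case by (rule good_all) (use less in \<open>simp add: on_V_def\<close>)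
qed

section \<open>Rooted trees fitting a binary tree\<close>

fun tree_edges :: "btree \<Rightarrow> (nat \<times> nat) set" where
  "tree_edges (Leaf a) = {}"
| "tree_edges (Node c l r) = insert (valency l, valency r) (tree_edges l \<union> tree_edges r)"

text \<open>
  \<open>fits t w F\<close>: \<open>F\<close> is a tree on the leaves of \<open>t\<close>, rooted at \<open>w\<close>, with exactly one edge across
  every internal node of \<open>t\<close>, and this edge is a descent iff the node is red. For such \<open>F\<close> the chain
  of \<open>t\<close> lies in the Boolean algebra of \<open>F\<close>.
\<close>

inductive fits :: "btree \<Rightarrow> nat \<Rightarrow> (nat \<times> nat) set \<Rightarrow> bool" where
  leaf: "fits (Leaf a) a {}"
| keep_left: "fits l w F \<Longrightarrow> fits r u G \<Longrightarrow> p \<in> set (leaves l) \<Longrightarrow> c = Red \<longleftrightarrow> u < p \<Longrightarrow>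
    fits (Node c l r) w (insert (p, u) (F \<union> G))"
| keep_right: "fits l u F \<Longrightarrow> fits r w G \<Longrightarrow> p \<in> set (leaves r) \<Longrightarrow> c = Red \<longleftrightarrow> u < p \<Longrightarrow>
    fits (Node c l r) w (insert (p, u) (F \<union> G))"

lemma fits_subset: "fits t w F \<Longrightarrow> F \<subseteq> set (leaves t) \<times> set (leaves t) \<and> w \<in> set (leaves t) \<and> finite F"
  by (induction rule: fits.induct) auto

lemma rooted_join:
  assumes d: "A \<inter> B = {}" and F: "F \<subseteq> A \<times> A" "w \<in> A" and G: "G \<subseteq> B \<times> B" "u \<in> B" and p: "p \<in> A"
    and rF: "(\<forall>p. (p, w) \<notin> F) \<and> (\<forall>c \<in> A - {w}. \<exists>!p. (p, c) \<in> F) \<and> (\<forall>c \<in> A. (w, c) \<in> F\<^sup>*)"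
    and rG: "(\<forall>p. (p, u) \<notin> G) \<and> (\<forall>c \<in> B - {u}. \<exists>!p. (p, c) \<in> G) \<and> (\<forall>c \<in> B. (u, c) \<in> G\<^sup>*)"
    and H: "H = insert (p, u) (F \<union> G)"
  shows "(\<forall>p. (p, w) \<notin> H) \<and> (\<forall>c \<in> A \<union> B - {w}. \<exists>!p. (p, c) \<in> H) \<and> (\<forall>c \<in> A \<union> B. (w, c) \<in> H\<^sup>*)"
proof (intro conjI ballI)
  have FH: "F\<^sup>* \<subseteq> H\<^sup>*" "G\<^sup>* \<subseteq> H\<^sup>*" by (auto intro!: rtrancl_mono simp: H)
  have "(w, u) \<in> H\<^sup>*"
    using rF p FH unfolding H by (meson insertI1 rtrancl.rtrancl_into_rtrancl subsetD)
  then show "(w, c) \<in> H\<^sup>*" if "c \<in> A \<union> B" for c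
  proof (cases "c \<in> A")
    case True
    then show ?thesis using rF FH by blast
  next
    case False
    then have "(u, c) \<in> H\<^sup>*" using rG FH that by blast
    with \<open>(w, u) \<in> H\<^sup>*\<close> show ?thesis by (rule rtrancl_trans)
  qed
  show "\<forall>p. (p, w) \<notin> H" using rF d F G by (auto simp: H)
  show "\<exists>!p. (p, c) \<in> H" if c: "c \<in> A \<union> B - {w}" for c
  proof -
    consider "c \<in> A - {w}" | "c = u" | "c \<in> B - {u}" using c by blast
    then show ?thesis
    proof cases
      case 1
      then have "(p', c) \<in> H \<longleftrightarrow> (p', c) \<in> F" for p' using d G by (auto simp: H)
      then show ?thesis using rF 1 by auto
    next
      case 2
      then have "(p', c) \<in> H \<longleftrightarrow> p' = p" for p' using d F G rG by (auto simp: H)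
      then show ?thesis by auto
    next
      case 3
      then have "(p', c) \<in> H \<longleftrightarrow> (p', c) \<in> G" for p' using d F G by (auto simp: H)
      then show ?thesis using rG 3 by auto
    qed
  qed
qed

lemma fits_rooted:
  assumes "fits t w F" "distinct (leaves t)"
  shows "(\<forall>p. (p, w) \<notin> F) \<and> (\<forall>c \<in> set (leaves t) - {w}. \<exists>!p. (p, c) \<in> F)
    \<and> (\<forall>c \<in> set (leaves t). (w, c) \<in> F\<^sup>*)"
  using assms
proof (induction rule: fits.induct)
  case (leaf a)
  then show ?case by auto
next
  case (keep_left l w F r u G p c)
  have d: "set (leaves l) \<inter> set (leaves r) = {}" using keep_left by auto
  show ?case unfolding leaves.simps set_append
    by (rule rooted_join[OF d _ _ _ _ _ _ _ refl])
      (use fits_subset[OF keep_left.hyps(1)] fits_subset[OF keep_left.hyps(2)] keep_left in simp_all)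
next
  case (keep_right l u F r w G p c)
  have d: "set (leaves r) \<inter> set (leaves l) = {}" using keep_right by auto
  have eq: "insert (p, u) (F \<union> G) = insert (p, u) (G \<union> F)" by blast
  show ?case unfolding leaves.simps set_append Un_commute[of "set (leaves l)"]
    by (rule rooted_join[OF d _ _ _ _ _ _ _ eq])
      (use fits_subset[OF keep_right.hyps(1)] fits_subset[OF keep_right.hyps(2)] keep_right in simp_all)
qed

lemma fits_rooted_tree:
  "fits t w F \<Longrightarrow> distinct (leaves t) \<Longrightarrow> rooted_tree (set (leaves t)) F"
  unfolding rooted_tree_def using fits_subset[of t w F] fits_rooted[of t w F] by blast

lemma descents_insert:
  "descents (insert (p, u) F) = (if u < p then insert u (descents F) else descents F)"
  by (auto simp: descents_def)

lemma descents_Un: "descents (F \<union> G) = descents F \<union> descents G"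
  by (auto simp: descents_def)

lemma fits_descents:
  "fits t w F \<Longrightarrow> distinct (leaves t) \<Longrightarrow> card (descents F) = red_count t"
proof (induction rule: fits.induct)
  case (leaf a)
  then show ?case by (simp add: descents_def)
next
  case (keep_left l w F r u G p c)
  have d: "set (leaves l) \<inter> set (leaves r) = {}" using keep_left by auto
  have s: "descents F \<subseteq> set (leaves l)" "descents G \<subseteq> set (leaves r)" "u \<notin> descents G" "u \<in> set (leaves r)"
    using fits_subset[OF keep_left.hyps(1)] fits_subset[OF keep_left.hyps(2)]
      fits_rooted[OF keep_left.hyps(2)] keep_left.prems by (auto simp: descents_def)
  have fin: "finite (descents F)" "finite (descents G)" using s finite_subset by blast+
  have "card (descents F \<union> descents G) = card (descents F) + card (descents G)"
    using s d fin by (intro card_Un_disjoint) auto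
  moreover have "u \<notin> descents F \<union> descents G" using s d by auto
  ultimately show ?case using keep_left fin
    by (cases c) (auto simp: descents_insert descents_Un)
next
  case (keep_right l u F r w G p c)
  have d: "set (leaves l) \<inter> set (leaves r) = {}" using keep_right by auto
  have s: "descents F \<subseteq> set (leaves l)" "descents G \<subseteq> set (leaves r)" "u \<notin> descents F" "u \<in> set (leaves l)"
    using fits_subset[OF keep_right.hyps(1)] fits_subset[OF keep_right.hyps(2)]
      fits_rooted[OF keep_right.hyps(1)] keep_right.prems by (auto simp: descents_def)
  have fin: "finite (descents F)" "finite (descents G)" using s finite_subset by blast+
  have "card (descents F \<union> descents G) = card (descents F) + card (descents G)"
    using s d fin by (intro card_Un_disjoint) auto
  moreover have "u \<notin> descents F \<union> descents G" using s d by auto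
  ultimately show ?case using keep_right fin
    by (cases c) (auto simp: descents_insert descents_Un)
qed

lemma liu_Node_valency:
  assumes "liu_lyndon (Node c l r)" "distinct (leaves (Node c l r))"
  shows "valency (Node c l r) = valency l" "c = Red \<longleftrightarrow> valency r < valency l"
    "liu_lyndon l" "liu_lyndon r" "better c (valency l) (valency r)"
proof -
  have d: "distinct (leaves l @ leaves r)" using assms by simp
  show b: "better c (valency l) (valency r)" "liu_lyndon l" "liu_lyndon r"
    using iffD1[OF liu_lyndon_Node[OF d] assms(1)] by blast+
  then show "valency (Node c l r) = valency l" using better_trans better_irrefl
    by (metis valency_Node)
  show "c = Red \<longleftrightarrow> valency r < valency l"
    using b(1) by (cases c) (auto simp: better_def)
qed

lemma fits_tree_edges:
  "liu_lyndon t \<Longrightarrow> distinct (leaves t) \<Longrightarrow> fits t (valency t) (tree_edges t)"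
proof (induction t)
  case (Leaf a)
  show ?case by (simp add: fits.leaf)
next
  case (Node c l r)
  note N = liu_Node_valency[OF Node.prems]
  have "fits (Node c l r) (valency l) (insert (valency l, valency r) (tree_edges l \<union> tree_edges r))"
    by (rule fits.keep_left) (use Node N valency_in in auto)
  then show ?case using N(1) by simp
qed

section \<open>A statistic that cannot decrease under fitting\<close>

definition colored_child_sum :: "(nat \<times> nat) set \<Rightarrow> int" where
  "colored_child_sum F = (\<Sum>(p, c) \<in> F. if c < p then int c else - int c)"

lemma colored_child_sum_join:
  assumes "finite F" "finite G" "F \<subseteq> A \<times> A" "G \<subseteq> B \<times> B" "A \<inter> B = {}" "p \<in> A \<and> u \<in> B \<or> p \<in> B \<and> u \<in> A"
  shows "colored_child_sum (insert (p, u) (F \<union> G)) =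
    colored_child_sum F + colored_child_sum G + (if u < p then int u else - int u)"
proof -
  have "(p, u) \<notin> F \<union> G" "F \<inter> G = {}" using assms by auto
  then show ?thesis using assms(1,2)
    by (simp add: colored_child_sum_def sum.union_disjoint)
qed

lemma colored_child_sum_Node:
  assumes "liu_lyndon (Node c l r)" "distinct (leaves (Node c l r))"
  shows "colored_child_sum (tree_edges (Node c l r)) =
    colored_child_sum (tree_edges l) + colored_child_sum (tree_edges r) +
    (if valency r < valency l then int (valency r) else - int (valency r))"
proof -
  note N = liu_Node_valency[OF assms]
  have "fits l (valency l) (tree_edges l)" "fits r (valency r) (tree_edges r)"
    using N assms(2) by (auto intro: fits_tree_edges)
  then have "finite (tree_edges l)" "tree_edges l \<subseteq> set (leaves l) \<times> set (leaves l)"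
    "finite (tree_edges r)" "tree_edges r \<subseteq> set (leaves r) \<times> set (leaves r)"
    using fits_subset by blast+
  moreover have "set (leaves l) \<inter> set (leaves r) = {}" using assms(2) by simp
  ultimately show ?thesis
    unfolding tree_edges.simps
    using colored_child_sum_join[of "tree_edges l" "tree_edges r"] valency_in by blast
qed

text \<open>The left-hand side is a surplus that carries the induction. If the root stays in the
  left part, the edge across the node ends at \<open>u\<close> instead of \<open>valency r\<close>,
  which costs at most their distance, and that is the surplus of the right part. If the root moves
  to the right part, the edge ends at the root \<open>u\<close> of the left part; the surplus there
  covers the distance from \<open>u\<close> to \<open>valency l\<close>, and since the color tells
  the sign of \<open>valency l - valency r\<close>, a gain of at least their distance remains. The
  triangle inequality through \<open>valency r\<close> finishes this case.\<close>

lemma colored_child_sum_fits: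
  "fits t w F \<Longrightarrow> liu_lyndon t \<Longrightarrow> distinct (leaves t) \<Longrightarrow>
    \<bar>int w - int (valency t)\<bar> \<le> colored_child_sum F - colored_child_sum (tree_edges t)"
proof (induction rule: fits.induct)
  case (leaf a)
  then show ?case by (simp add: colored_child_sum_def)
next
  case (keep_left l w F r u G p c)
  note N = liu_Node_valency[OF keep_left.prems]
  have "colored_child_sum (insert (p, u) (F \<union> G)) =
    colored_child_sum F + colored_child_sum G + (if u < p then int u else - int u)"
    by (rule colored_child_sum_join[where A = "set (leaves l)" and B = "set (leaves r)"])
      (use fits_subset[OF keep_left.hyps(1)] fits_subset[OF keep_left.hyps(2)] keep_left in auto)
  then show ?case
    using keep_left colored_child_sum_Node[OF keep_left.prems] N by (auto split: if_splits)
next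
  case (keep_right l u F r w G p c)
  note N = liu_Node_valency[OF keep_right.prems]
  have "colored_child_sum (insert (p, u) (F \<union> G)) =
    colored_child_sum F + colored_child_sum G + (if u < p then int u else - int u)"
    by (rule colored_child_sum_join[where A = "set (leaves l)" and B = "set (leaves r)"])
      (use fits_subset[OF keep_right.hyps(1)] fits_subset[OF keep_right.hyps(2)] keep_right in auto)
  then show ?case
    using keep_right colored_child_sum_Node[OF keep_right.prems] N by (auto split: if_splits)
qed

text \<open>A root in the right part would gain at least the distance between the two valencies,
  which are distinct. So equality forces the root into the left part and equality there as
  well.\<close>

lemma fits_tight_Node:
  assumes "fits (Node c l r) w F" "liu_lyndon (Node c l r)" "distinct (leaves (Node c l r))"
    "colored_child_sum F = colored_child_sum (tree_edges (Node c l r))"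
  obtains G u H p where "fits l w G" "fits r u H" "p \<in> set (leaves l)" "F = insert (p, u) (G \<union> H)"
    "colored_child_sum G = colored_child_sum (tree_edges l)"
  using assms(1)
proof cases
  case (keep_left F' u G p)
  note N = liu_Node_valency[OF assms(2,3)]
  have "colored_child_sum (insert (p, u) (F' \<union> G)) =
    colored_child_sum F' + colored_child_sum G + (if u < p then int u else - int u)"
    by (rule colored_child_sum_join[where A = "set (leaves l)" and B = "set (leaves r)"])
      (use fits_subset[OF keep_left(2)] fits_subset[OF keep_left(3)] keep_left assms(3) in auto)
  moreover have "\<bar>int w - int (valency l)\<bar> \<le> colored_child_sum F' - colored_child_sum (tree_edges l)"
    "\<bar>int u - int (valency r)\<bar> \<le> colored_child_sum G - colored_child_sum (tree_edges r)"
    using colored_child_sum_fits[OF keep_left(2)] colored_child_sum_fits[OF keep_left(3)] N assms(3) by auto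
  ultimately have "colored_child_sum F' = colored_child_sum (tree_edges l)"
    using assms(4) colored_child_sum_Node[OF assms(2,3)] N keep_left by (auto split: if_splits)
  then show ?thesis using that keep_left by blast
next
  case (keep_right u F' G p)
  note N = liu_Node_valency[OF assms(2,3)]
  have "colored_child_sum (insert (p, u) (F' \<union> G)) =
    colored_child_sum F' + colored_child_sum G + (if u < p then int u else - int u)"
    by (rule colored_child_sum_join[where A = "set (leaves l)" and B = "set (leaves r)"])
      (use fits_subset[OF keep_right(2)] fits_subset[OF keep_right(3)] keep_right assms(3) in auto)
  moreover have "\<bar>int u - int (valency l)\<bar> \<le> colored_child_sum F' - colored_child_sum (tree_edges l)"
    "\<bar>int w - int (valency r)\<bar> \<le> colored_child_sum G - colored_child_sum (tree_edges r)"
    using colored_child_sum_fits[OF keep_right(2)] colored_child_sum_fits[OF keep_right(3)] N assms(3) by auto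
  moreover have "\<bar>int w - int (valency l)\<bar> \<le> 0"
    using colored_child_sum_fits[OF assms(1-3)] assms(4) N by simp
  moreover have "valency l \<noteq> valency r" using assms(3) by (intro valency_neq) simp
  ultimately have False
    using assms(4) colored_child_sum_Node[OF assms(2,3)] N keep_right
    by (cases c) (auto simp: better_def split: if_splits)
  then show ?thesis ..
qed

section \<open>Branches at the root\<close>

fun blocks :: "btree \<Rightarrow> btree list" where
  "blocks (Leaf a) = []"
| "blocks (Node c l r) = r # blocks l"

lemma blocks_sub:
  "b \<in> set (blocks t) \<Longrightarrow> set (leaves b) \<subseteq> set (leaves t) \<and> size b < size t \<and>
    (distinct (leaves t) \<longrightarrow> distinct (leaves b)) \<and> (liu_lyndon t \<longrightarrow> liu_lyndon b)"
  by (induction t) auto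

text \<open>The valency of a Liu--Lyndon tree is its leftmost leaf. So the blocks, the right
  subtrees along the leftmost path, are the branches of \<open>tree_edges t\<close> at its
  root.\<close>

lemma blocks_partition:
  "liu_lyndon t \<Longrightarrow> distinct (leaves t) \<Longrightarrow>
    set (leaves t) = insert (valency t) (\<Union>b \<in> set (blocks t). set (leaves b)) \<and>
    (\<forall>b \<in> set (blocks t). valency t \<notin> set (leaves b)) \<and>
    (\<forall>b \<in> set (blocks t). \<forall>b' \<in> set (blocks t). b \<noteq> b' \<longrightarrow> set (leaves b) \<inter> set (leaves b') = {})"
proof (induction t)
  case (Node c l r)
  note N = liu_Node_valency[OF Node.prems]
  have d: "set (leaves l) \<inter> set (leaves r) = {}" using Node by auto
  have IH: "set (leaves l) = insert (valency l) (\<Union>b \<in> set (blocks l). set (leaves b))"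
    "\<forall>b \<in> set (blocks l). valency l \<notin> set (leaves b)"
    "\<forall>b \<in> set (blocks l). \<forall>b' \<in> set (blocks l). b \<noteq> b' \<longrightarrow> set (leaves b) \<inter> set (leaves b') = {}"
    using Node N by auto
  have sub: "\<forall>b \<in> set (blocks l). set (leaves b) \<subseteq> set (leaves l)" using blocks_sub by blast
  have vl: "valency l \<in> set (leaves l)" by (rule valency_in)
  have v: "valency l \<notin> set (leaves r)" using vl d by blast
  have dj: "\<forall>b \<in> set (blocks l). set (leaves b) \<inter> set (leaves r) = {}" using sub d by blast
  show ?case unfolding N(1)
  proof (intro conjI ballI impI)
    show "set (leaves (Node c l r)) = insert (valency l) (\<Union>b\<in>set (blocks (Node c l r)). set (leaves b))"
      using IH(1) by auto
  next
    fix b assume "b \<in> set (blocks (Node c l r))"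
    then show "valency l \<notin> set (leaves b)" using v IH(2) by auto
  next
    fix b b' assume "b \<in> set (blocks (Node c l r))" "b' \<in> set (blocks (Node c l r))" "b \<noteq> b'"
    then show "set (leaves b) \<inter> set (leaves b') = {}" using dj IH(3) unfolding blocks.simps list.set by blast
  qed
qed auto

text \<open>In the tight case each node of the leftmost path contributes one edge from the left part
  to the root of a block, and the edge raises the degree of \<open>w\<close> only if it starts at
  \<open>w\<close>. So the degree is maximal only if all blocks hang directly from
  \<open>w\<close>.\<close>

lemma fits_tight_blocks:
  "fits t w F \<Longrightarrow> liu_lyndon t \<Longrightarrow> distinct (leaves t) \<Longrightarrow>
    colored_child_sum F = colored_child_sum (tree_edges t) \<Longrightarrow>
    card {c. (w, c) \<in> F} \<le> length (blocks t) \<and>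
    (card {c. (w, c) \<in> F} = length (blocks t) \<longrightarrow>
      (\<forall>b \<in> set (blocks t). \<exists>u. (w, u) \<in> F \<and> fits b u (F \<inter> set (leaves b) \<times> set (leaves b))))"
proof (induction t arbitrary: F)
  case (Leaf a)
  from Leaf(1) show ?case by cases auto
next
  case (Node c l r)
  note N = liu_Node_valency[OF Node.prems(2,3)]
  obtain G u H p where F: "fits l w G" "fits r u H" "p \<in> set (leaves l)" "F = insert (p, u) (G \<union> H)"
    "colored_child_sum G = colored_child_sum (tree_edges l)"
    using fits_tight_Node[OF Node.prems] by blast
  have d: "set (leaves l) \<inter> set (leaves r) = {}" using Node.prems by auto
  have G: "G \<subseteq> set (leaves l) \<times> set (leaves l)" "w \<in> set (leaves l)" "finite G"
    and H: "H \<subseteq> set (leaves r) \<times> set (leaves r)" "u \<in> set (leaves r)"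
    using fits_subset F by blast+
  have IH: "card {c. (w, c) \<in> G} \<le> length (blocks l)"
    "card {c. (w, c) \<in> G} = length (blocks l) \<longrightarrow>
      (\<forall>b \<in> set (blocks l). \<exists>u. (w, u) \<in> G \<and> fits b u (G \<inter> set (leaves b) \<times> set (leaves b)))"
    using Node.IH(1)[OF F(1)] N F Node.prems by auto
  have eq: "{c. (w, c) \<in> F} = (if p = w then insert u {c. (w, c) \<in> G} else {c. (w, c) \<in> G})"
    using G H d F by auto
  have "{c. (w, c) \<in> G} \<subseteq> snd ` G" by force
  then have fin: "finite {c. (w, c) \<in> G}" using G(3) finite_subset by blast
  have un: "u \<notin> {c. (w, c) \<in> G}" using G H d by auto
  have card: "card {c. (w, c) \<in> F} = (if p = w then 1 else 0) + card {c. (w, c) \<in> G}"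
    using eq fin un by simp
  show ?case
  proof (intro conjI impI ballI)
    show "card {c. (w, c) \<in> F} \<le> length (blocks (Node c l r))" using card IH(1) by auto
  next
    fix b assume e: "card {c. (w, c) \<in> F} = length (blocks (Node c l r))" and b: "b \<in> set (blocks (Node c l r))"
    have pw: "p = w" "card {c. (w, c) \<in> G} = length (blocks l)"
      using e card IH(1) by (auto split: if_splits)
    show "\<exists>u. (w, u) \<in> F \<and> fits b u (F \<inter> set (leaves b) \<times> set (leaves b))"
    proof (cases "b = r")
      case True
      have "F \<inter> set (leaves r) \<times> set (leaves r) = H" using F G H d by auto
      then show ?thesis using F pw True by auto
    next
      case False
      then have bl: "b \<in> set (blocks l)" using b by simp
      then have "set (leaves b) \<subseteq> set (leaves l)" using blocks_sub by blast
      then have "F \<inter> set (leaves b) \<times> set (leaves b) = G \<inter> set (leaves b) \<times> set (leaves b)"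
        using F H d by auto
      then show ?thesis using IH(2) pw(2) bl F(4) by auto
    qed
  qed
qed

lemma tree_edges_children:
  "liu_lyndon t \<Longrightarrow> distinct (leaves t) \<Longrightarrow>
    {c. (valency t, c) \<in> tree_edges t} = valency ` set (blocks t) \<and>
    card (valency ` set (blocks t)) = length (blocks t)"
proof (induction t)
  case (Node c l r)
  note N = liu_Node_valency[OF Node.prems]
  have d: "set (leaves l) \<inter> set (leaves r) = {}" using Node by auto
  have s: "tree_edges r \<subseteq> set (leaves r) \<times> set (leaves r)"
    using fits_subset[OF fits_tree_edges] N Node.prems by auto
  have vl: "valency l \<in> set (leaves l)" by (rule valency_in)
  have vr: "valency r \<in> set (leaves r)" by (rule valency_in)
  have "valency ` set (blocks l) \<subseteq> set (leaves l)" using blocks_sub valency_in by blast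
  then have "valency r \<notin> valency ` set (blocks l)" using vr d by blast
  moreover have "{c. (valency l, c) \<in> insert (valency l, valency r) (tree_edges l \<union> tree_edges r)} =
    insert (valency r) {c. (valency l, c) \<in> tree_edges l}" using s vl d by auto
  ultimately show ?case using Node N by simp
qed auto

lemma tree_edges_block_closed:
  "liu_lyndon t \<Longrightarrow> distinct (leaves t) \<Longrightarrow> b \<in> set (blocks t) \<Longrightarrow> (x, y) \<in> tree_edges t \<Longrightarrow>
    x \<in> set (leaves b) \<Longrightarrow> y \<in> set (leaves b)"
proof (induction t)
  case (Node c l r)
  note N = liu_Node_valency[OF Node.prems(1,2)]
  have d: "set (leaves l) \<inter> set (leaves r) = {}" using Node by auto
  have s: "tree_edges r \<subseteq> set (leaves r) \<times> set (leaves r)" "tree_edges l \<subseteq> set (leaves l) \<times> set (leaves l)"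
    using fits_subset[OF fits_tree_edges] N Node.prems by auto
  have nv: "x \<noteq> valency l" using blocks_partition[OF Node.prems(1,2)] N(1) Node.prems by metis
  show ?case
  proof (cases "b = r")
    case True
    then show ?thesis using s d nv Node.prems(4,5) by auto
  next
    case False
    then have b: "b \<in> set (blocks l)" using Node.prems by simp
    then have "x \<in> set (leaves l)" using blocks_sub Node.prems(5) by blast
    then have "(x, y) \<in> tree_edges l" using s d nv Node.prems(4) by auto
    then show ?thesis using Node.IH(1) b N Node.prems by auto
  qed
qed auto


lemma tree_edges_block_restrict:
  "liu_lyndon t \<Longrightarrow> distinct (leaves t) \<Longrightarrow> b \<in> set (blocks t) \<Longrightarrow>
    tree_edges t \<inter> set (leaves b) \<times> set (leaves b) = tree_edges b"
proof (induction t)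
  case (Node c l r)
  note N = liu_Node_valency[OF Node.prems(1,2)]
  have d: "set (leaves l) \<inter> set (leaves r) = {}" using Node by auto
  have s: "tree_edges r \<subseteq> set (leaves r) \<times> set (leaves r)" "tree_edges l \<subseteq> set (leaves l) \<times> set (leaves l)"
    using fits_subset[OF fits_tree_edges] N Node.prems by auto
  have nv: "valency l \<notin> set (leaves b)" using blocks_partition[OF Node.prems(1,2)] N(1) Node.prems by metis
  show ?case
  proof (cases "b = r")
    case True
    then show ?thesis using s d nv by auto
  next
    case False
    then have b: "b \<in> set (blocks l)" using Node.prems by simp
    then have "set (leaves b) \<subseteq> set (leaves l)" using blocks_sub by blast
    then have "tree_edges (Node c l r) \<inter> set (leaves b) \<times> set (leaves b) =
        tree_edges l \<inter> set (leaves b) \<times> set (leaves b)" using s d nv by auto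
    then show ?thesis using Node.IH(1) b N Node.prems by auto
  qed
qed auto

section \<open>Absence of cycles in the incidence relation\<close>

definition liu_rel :: "nat set \<Rightarrow> (btree \<times> btree) set" where
  "liu_rel V = {(t, s). t \<in> liu_on V \<and> s \<in> liu_on V \<and> fits t (valency s) (tree_edges s)}"

text \<open>Lexicographic: the statistic grows, then the degree of the root falls. The root itself
  does not occur since along \<open>liu_rel\<close> a constant statistic already fixes it.\<close>

definition key_le :: "btree \<Rightarrow> btree \<Rightarrow> bool" where
  "key_le t s \<longleftrightarrow> colored_child_sum (tree_edges t) < colored_child_sum (tree_edges s) \<or>
     colored_child_sum (tree_edges t) = colored_child_sum (tree_edges s) \<and>
     length (blocks s) \<le> length (blocks t)"

text \<open>The closure of \<open>liu_rel\<close> is taken on the blocks so that the notion composes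
  along paths.\<close>

definition matched :: "btree \<Rightarrow> btree \<Rightarrow> bool" where
  "matched t s \<longleftrightarrow> valency t = valency s \<and> (\<forall>b \<in> set (blocks t). \<exists>b' \<in> set (blocks s).
     set (leaves b') = set (leaves b) \<and> (b, b') \<in> (liu_rel (set (leaves b)))\<^sup>*)"

lemma liu_rel_key_le: "(t, s) \<in> liu_rel V \<Longrightarrow> key_le t s"
proof -
  assume "(t, s) \<in> liu_rel V"
  then have st: "fits t (valency s) (tree_edges s)" "liu_lyndon t" "liu_lyndon s"
    "distinct (leaves t)" "distinct (leaves s)"
    by (auto simp: liu_rel_def liu_on_def)
  have le: "\<bar>int (valency s) - int (valency t)\<bar> \<le> colored_child_sum (tree_edges s) - colored_child_sum (tree_edges t)"
    by (rule colored_child_sum_fits[OF st(1,2,4)])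
  have ch: "{c. (valency s, c) \<in> tree_edges s} = valency ` set (blocks s)"
      "card (valency ` set (blocks s)) = length (blocks s)"
    using tree_edges_children[OF st(3,5)] by auto
  have "length (blocks s) \<le> length (blocks t)"
    if "colored_child_sum (tree_edges s) = colored_child_sum (tree_edges t)"
    using fits_tight_blocks[OF st(1,2,4) that] ch by simp
  then show "key_le t s" using le by (auto simp: key_le_def)
qed

lemma liu_rel_rtrancl_key_le: "(t, s) \<in> (liu_rel V)\<^sup>* \<Longrightarrow> key_le t s"
  by (induction rule: rtrancl_induct) (auto simp: key_le_def dest!: liu_rel_key_le)

text \<open>All nodes of a block of \<open>t\<close> are descendants of a child of the common root,
  so the block lies in the block of \<open>s\<close> at that child and contains that child. Two
  blocks of \<open>t\<close> inside the same block of \<open>s\<close> would share it; hence each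
  block of \<open>t\<close> fills a block of \<open>s\<close>.\<close>

lemma liu_rel_matched:
  assumes "(t, s) \<in> liu_rel V" "key_le s t"
  shows "matched t s"
proof -
  have st: "fits t (valency s) (tree_edges s)" "liu_lyndon t" "liu_lyndon s"
    "distinct (leaves t)" "distinct (leaves s)" "set (leaves t) = set (leaves s)"
    using assms(1) by (auto simp: liu_rel_def liu_on_def)
  have eq: "colored_child_sum (tree_edges s) = colored_child_sum (tree_edges t)"
      "length (blocks s) = length (blocks t)"
    using assms(2) liu_rel_key_le[OF assms(1)] by (auto simp: key_le_def)
  have v: "valency t = valency s"
    using colored_child_sum_fits[OF st(1,2,4)] eq(1) by simp
  have ch: "{c. (valency s, c) \<in> tree_edges s} = valency ` set (blocks s)"
      "card (valency ` set (blocks s)) = length (blocks s)"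
    using tree_edges_children[OF st(3,5)] by auto
  have fit: "\<exists>u. (valency s, u) \<in> tree_edges s \<and> fits b u (tree_edges s \<inter> set (leaves b) \<times> set (leaves b))"
    if "b \<in> set (blocks t)" for b
    using fits_tight_blocks[OF st(1,2,4) eq(1)] ch eq(2) that by simp
  have ex: "\<exists>b' \<in> set (blocks s). set (leaves b) \<subseteq> set (leaves b') \<and> valency b' \<in> set (leaves b) \<and>
      fits b (valency b') (tree_edges s \<inter> set (leaves b) \<times> set (leaves b))"
    if b: "b \<in> set (blocks t)" for b
  proof -
    from fit[OF b] obtain u where u: "(valency s, u) \<in> tree_edges s"
      "fits b u (tree_edges s \<inter> set (leaves b) \<times> set (leaves b))" by blast
    then obtain b' where b': "b' \<in> set (blocks s)" "u = valency b'" using ch(1) by blast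
    have db: "distinct (leaves b)" using blocks_sub[OF b] st by simp
    have "x \<in> set (leaves b')" if "(u, x) \<in> (tree_edges s)\<^sup>*" for x
      using that
    proof (induction rule: rtrancl_induct)
      case base
      show ?case using b'(2) valency_in by simp
    next
      case (step y z)
      then show ?case using tree_edges_block_closed[OF st(3,5) b'(1)] by blast
    qed
    moreover have "(u, x) \<in> (tree_edges s)\<^sup>*" if "x \<in> set (leaves b)" for x
    proof -
      have "(u, x) \<in> (tree_edges s \<inter> set (leaves b) \<times> set (leaves b))\<^sup>*"
        using fits_rooted[OF u(2) db] that by blast
      then show ?thesis by (rule rev_subsetD[OF _ rtrancl_mono]) auto
    qed
    ultimately have "set (leaves b) \<subseteq> set (leaves b')" by blast
    moreover have "u \<in> set (leaves b)" using fits_subset[OF u(2)] by blast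
    ultimately show ?thesis using b' u(2) by blast
  qed
  note Pt = blocks_partition[OF st(2,4)] and Ps = blocks_partition[OF st(3,5)]
  have "\<exists>b' \<in> set (blocks s). set (leaves b') = set (leaves b) \<and> (b, b') \<in> liu_rel (set (leaves b))"
    if b: "b \<in> set (blocks t)" for b
  proof -
    obtain b' where b': "b' \<in> set (blocks s)" "set (leaves b) \<subseteq> set (leaves b')" "valency b' \<in> set (leaves b)"
        "fits b (valency b') (tree_edges s \<inter> set (leaves b) \<times> set (leaves b))"
      using ex[OF b] by blast
    have "x \<in> set (leaves b)" if x: "x \<in> set (leaves b')" for x
    proof -
      have "x \<in> set (leaves t)" using x blocks_sub[OF b'(1)] st(6) by blast
      moreover have "x \<noteq> valency t" using x Ps b'(1) v by metis
      ultimately obtain c where c: "c \<in> set (blocks t)" "x \<in> set (leaves c)" using Pt by blast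
      obtain c' where c': "c' \<in> set (blocks s)" "set (leaves c) \<subseteq> set (leaves c')" "valency c' \<in> set (leaves c)"
        using ex[OF c(1)] by blast
      have "c' = b'" using Ps c' c(2) b'(1) x by blast
      then have "c = b" using Pt c(1) c'(3) b b'(3) by blast
      then show ?thesis using c by simp
    qed
    then have L: "set (leaves b') = set (leaves b)" using b'(2) by blast
    have "tree_edges s \<inter> set (leaves b) \<times> set (leaves b) = tree_edges b'"
      using tree_edges_block_restrict[OF st(3,5) b'(1)] L by simp
    then have "(b, b') \<in> liu_rel (set (leaves b))"
      using b'(4) L blocks_sub[OF b] blocks_sub[OF b'(1)] st by (simp add: liu_rel_def liu_on_def)
    then show ?thesis using b'(1) L by blast
  qed
  then show ?thesis using v unfolding matched_def by blast
qed

lemma matched_trans: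
  assumes "matched r s" "matched s t"
  shows "matched r t"
  unfolding matched_def
proof (intro conjI ballI)
  show "valency r = valency t" using assms by (simp add: matched_def)
  fix b assume "b \<in> set (blocks r)"
  then obtain b' where b': "b' \<in> set (blocks s)" "set (leaves b') = set (leaves b)"
    "(b, b') \<in> (liu_rel (set (leaves b)))\<^sup>*" using assms(1) by (auto simp: matched_def)
  then obtain b'' where "b'' \<in> set (blocks t)" "set (leaves b'') = set (leaves b)"
    "(b', b'') \<in> (liu_rel (set (leaves b)))\<^sup>*" using assms(2) by (auto simp: matched_def)
  then show "\<exists>b' \<in> set (blocks t). set (leaves b') = set (leaves b) \<and> (b, b') \<in> (liu_rel (set (leaves b)))\<^sup>*"
    using b' by (meson rtrancl_trans)
qed

text \<open>The key can only be constant along a closed path, so every single step is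
  matched.\<close>

lemma liu_rel_rtrancl_matched:
  "(t, s) \<in> (liu_rel V)\<^sup>* \<Longrightarrow> (s, t) \<in> (liu_rel V)\<^sup>* \<Longrightarrow> matched t s"
proof (induction rule: rtrancl_induct)
  case base
  show ?case by (auto simp: matched_def)
next
  case (step s s')
  have "(s, t) \<in> (liu_rel V)\<^sup>*" "(s', s) \<in> (liu_rel V)\<^sup>*"
    using step by (meson converse_rtrancl_into_rtrancl rtrancl_trans)+
  then show ?case
    using step matched_trans liu_rel_matched liu_rel_rtrancl_key_le by metis
qed

text \<open>The order of the branches along the leftmost path, outermost first: non-descents
  increasing, then descents decreasing. Blue nodes precede red ones because a red node has no blue
  left child.\<close>

definition block_order :: "nat \<Rightarrow> btree \<Rightarrow> btree \<Rightarrow> bool" where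
  "block_order r x y \<longleftrightarrow> (r < valency x \<and> r < valency y \<and> valency x < valency y) \<or>
    (r < valency x \<and> valency y < r) \<or> (valency x < r \<and> valency y < r \<and> valency y < valency x)"

lemma block_order_trans: "block_order r x y \<Longrightarrow> block_order r y z \<Longrightarrow> block_order r x z"
  by (auto simp: block_order_def)

lemma sorted_blocks:
  "liu_lyndon t \<Longrightarrow> distinct (leaves t) \<Longrightarrow> sorted_wrt (block_order (valency t)) (blocks t)"
proof (induction t)
  case (Node c l b)
  note N = liu_Node_valency[OF Node.prems]
  have IH: "sorted_wrt (block_order (valency l)) (blocks l)" using Node N by simp
  have "block_order (valency l) b x" if x: "x \<in> set (blocks l)" for x
  proof (cases l)
    case (Leaf a)
    then show ?thesis using x by simp
  next
    case (Node d l1 h)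
    have d: "distinct (leaves l @ leaves b)" "distinct (leaves (Node d l1 h))" using Node.prems Node by auto
    have L: "\<forall>l1 r1. l = Node c l1 r1 \<longrightarrow> better c (valency b) (valency r1)"
        "c = Red \<longrightarrow> (\<forall>l1 r1. l \<noteq> Node Blue l1 r1)"
      using liu_lyndon_Node[OF d(1), of c] Node.prems by auto
    have H: "valency l = valency l1" "better d (valency l1) (valency h)"
      using liu_Node_valency[OF N(3)[unfolded Node] d(2)] Node by (simp_all del: valency.simps)
    have "block_order (valency l) b h"
      using L N(5) H Node by (cases c; cases d) (auto simp: block_order_def better_def)
    moreover have "blocks l = h # blocks l1" using Node by simp
    ultimately show ?thesis using x IH block_order_trans[of "valency l" b h x] by auto
  qed
  then show ?case using IH N(1) by simp
qed simp

lemma sorted_wrt_unique: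
  assumes "\<And>x y. R x y \<Longrightarrow> \<not> R y x"
  shows "sorted_wrt R xs \<Longrightarrow> sorted_wrt R ys \<Longrightarrow> set xs = set ys \<Longrightarrow> xs = ys"
proof (induction xs arbitrary: ys)
  case (Cons x xs)
  then obtain y ys' where ys: "ys = y # ys'" by (cases ys) auto
  have "x = y"
  proof (rule ccontr)
    assume "x \<noteq> y"
    then have "x \<in> set ys'" "y \<in> set xs" using Cons.prems(3) ys by auto
    then show False using Cons.prems ys assms by auto
  qed
  moreover have "x \<notin> set xs" using Cons.prems(1) assms by auto
  moreover have "y \<notin> set ys'" using Cons.prems(2) ys assms by auto
  ultimately have "set xs = set ys'" using Cons.prems(3) ys by auto
  then show ?case using Cons ys \<open>x = y\<close> by auto
qed simp

lemma liu_eq_if_blocks_eq: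
  "liu_lyndon t \<Longrightarrow> distinct (leaves t) \<Longrightarrow> liu_lyndon s \<Longrightarrow> distinct (leaves s) \<Longrightarrow>
    valency t = valency s \<Longrightarrow> blocks t = blocks s \<Longrightarrow> t = s"
proof (induction t arbitrary: s)
  case (Leaf a)
  then show ?case by (cases s) auto
next
  case (Node c l r)
  then obtain d l' where s: "s = Node d l' r" by (cases s) auto
  note N = liu_Node_valency[OF Node.prems(1,2)]
  note M = liu_Node_valency[OF Node.prems(3,4)[unfolded s]]
  have "l = l'"
  proof (rule Node.IH(1)[OF N(3) _ M(3)])
    show "distinct (leaves l)" "distinct (leaves l')" using Node.prems(2,4) s by simp_all
    show "valency l = valency l'" using N(1) M(1) Node.prems(5) s by metis
    show "blocks l = blocks l'" using Node.prems(6) s by simp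
  qed
  moreover have "c = d" using N(2) M(2) \<open>l = l'\<close> by (cases c; cases d) auto
  ultimately show ?case using s by simp
qed

text \<open>Each block is followed around the cycle: \<open>b\<close> leads to \<open>b'\<close> and
  on to a block with the leaf set of \<open>b\<close>, hence to \<open>b\<close> itself. This is a
  cycle on fewer leaves, so \<open>b = b'\<close> by induction. Equal sets of blocks give equal
  trees because the order of the blocks is forced.\<close>

theorem liu_rel_antisym:
  "t \<in> liu_on V \<Longrightarrow> s \<in> liu_on V \<Longrightarrow> (t, s) \<in> (liu_rel V)\<^sup>* \<Longrightarrow> (s, t) \<in> (liu_rel V)\<^sup>* \<Longrightarrow> t = s"
proof (induction "card V" arbitrary: V t s rule: less_induct)
  case less
  have ts: "liu_lyndon t" "distinct (leaves t)" "set (leaves t) = V"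
     "liu_lyndon s" "distinct (leaves s)" "set (leaves s) = V"
    using less.prems by (auto simp: liu_on_def)
  have m: "matched t s" "matched s t" using liu_rel_rtrancl_matched less.prems by blast+
  have sub: "set (blocks t) \<subseteq> set (blocks s)"
    if ts: "liu_lyndon t" "distinct (leaves t)" "set (leaves t) = V"
      "liu_lyndon s" "distinct (leaves s)" "set (leaves s) = V"
      and m: "matched t s" "matched s t" for t s
  proof
    fix b assume b: "b \<in> set (blocks t)"
    then obtain b' where b': "b' \<in> set (blocks s)" "set (leaves b') = set (leaves b)"
      "(b, b') \<in> (liu_rel (set (leaves b)))\<^sup>*" using m(1) by (auto simp: matched_def)
    then obtain c where c: "c \<in> set (blocks t)" "set (leaves c) = set (leaves b)"
      "(b', c) \<in> (liu_rel (set (leaves b)))\<^sup>*" using m(2) by (auto simp: matched_def)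
    have "c = b" using blocks_partition[OF ts(1,2)] b c valency_in[of b] by blast
    have "valency t \<notin> set (leaves b)" "valency t \<in> V" "set (leaves b) \<subseteq> V"
      using blocks_partition[OF ts(1,2)] b ts(3) by blast+
    then have "card (set (leaves b)) < card V"
      using ts(3) by (metis List.finite_set psubset_card_mono psubsetI)
    then have "b = b'"
      using less.hyps[of "set (leaves b)" b b'] b' c \<open>c = b\<close> blocks_sub[OF b] blocks_sub[OF b'(1)] ts
      by (simp add: liu_on_def)
    then show "b \<in> set (blocks s)" using b' by simp
  qed
  have "set (blocks t) = set (blocks s)" using sub[of t s] sub[of s t] ts m by blast
  moreover have v: "valency t = valency s" using m by (simp add: matched_def)
  ultimately have "blocks t = blocks s"
    using sorted_blocks[of t] sorted_blocks[of s] ts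
    by (intro sorted_wrt_unique[of "block_order (valency t)"]) (auto simp: block_order_def)
  then show ?case using liu_eq_if_blocks_eq ts v by blast
qed

lemma tree_edges_root_unique:
  assumes "liu_lyndon t" "distinct (leaves t)" "liu_lyndon s" "distinct (leaves s)"
    "set (leaves t) = set (leaves s)" "tree_edges t = tree_edges s"
  shows "valency t = valency s"
proof (rule ccontr)
  assume ne: "valency t \<noteq> valency s"
  have "\<forall>p. (p, valency t) \<notin> tree_edges t"
    using fits_rooted[OF fits_tree_edges[OF assms(1,2)] assms(2)] by blast
  moreover have "\<exists>p. (p, valency t) \<in> tree_edges s"
    using fits_rooted[OF fits_tree_edges[OF assms(3,4)] assms(4)] valency_in[of t] assms(5) ne by blast
  ultimately show False using assms(6) by simp
qed

text \<open>Two trees with the same edges fit each other's edges, so antisymmetry identifies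
  them.\<close>

lemma tree_edges_inj: "inj_on tree_edges (liu_on V)"
proof
  fix t s assume ts: "t \<in> liu_on V" "s \<in> liu_on V" and e: "tree_edges t = tree_edges s"
  then have v: "valency t = valency s"
    by (intro tree_edges_root_unique) (auto simp: liu_on_def)
  have "fits t (valency t) (tree_edges t)" "fits s (valency s) (tree_edges s)"
    using ts by (auto simp: liu_on_def intro: fits_tree_edges)
  then have "(t, s) \<in> liu_rel V" "(s, t) \<in> liu_rel V" using ts e v by (auto simp: liu_rel_def)
  then show "t = s" using liu_rel_antisym ts by blast
qed


section \<open>Every rooted tree comes from a Liu--Lyndon tree\<close>

lemma rooted_tree_split:
  assumes V: "finite V" and T: "T \<subseteq> V \<times> V" and r: "r \<in> V" "\<forall>p. (p, r) \<notin> T"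
    and par: "\<forall>c \<in> V - {r}. \<exists>!p. (p, c) \<in> T" and reach: "\<forall>c \<in> V. (r, c) \<in> T\<^sup>*"
    and c: "(r, c) \<in> T" and D: "D = {x. (c, x) \<in> T\<^sup>*}"
  shows "D \<subseteq> V" "c \<in> D" "r \<notin> D"
    "T = insert (r, c) (T \<inter> (V - D) \<times> (V - D) \<union> T \<inter> D \<times> D)"
    "rooted_tree D (T \<inter> D \<times> D)" "\<forall>p. (p, c) \<notin> T \<inter> D \<times> D"
    "rooted_tree (V - D) (T \<inter> (V - D) \<times> (V - D))"
proof -
  have cV: "c \<in> V" and cr: "c \<noteq> r" using c T r by auto
  have closed: "(x, y) \<in> T \<Longrightarrow> x \<in> D \<Longrightarrow> y \<in> D" for x y
    using D by (auto intro: rtrancl_into_rtrancl)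
  show DV: "D \<subseteq> V"
  proof
    fix x assume "x \<in> D"
    then have "(c, x) \<in> T\<^sup>*" using D by simp
    then show "x \<in> V" by (induction rule: rtrancl_induct) (use cV T in auto)
  qed
  show cD: "c \<in> D" using D by simp
  show rD: "r \<notin> D"
  proof
    assume "r \<in> D"
    then have "(c, r) \<in> T\<^sup>*" using D by simp
    then show False using cr r(2) by (metis rtranclE)
  qed
  have uniq: "(p, x) \<in> T \<Longrightarrow> (q, x) \<in> T \<Longrightarrow> p = q" for p q x
    using par r(2) T by blast
  have parD: "p \<in> D" if px: "(p, x) \<in> T" "x \<in> D" "x \<noteq> c" for p x
  proof -
    have "(c, x) \<in> T\<^sup>*" using px D by simp
    then obtain q where "(c, q) \<in> T\<^sup>*" "(q, x) \<in> T" using px(3) by (metis rtranclE)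
    then show ?thesis using uniq px(1) D by blast
  qed
  show eq: "T = insert (r, c) (T \<inter> (V - D) \<times> (V - D) \<union> T \<inter> D \<times> D)"
    using T c closed parD uniq by blast
  show noc: "\<forall>p. (p, c) \<notin> T \<inter> D \<times> D" using uniq c rD by blast
  have reachD: "(c, x) \<in> (T \<inter> D \<times> D)\<^sup>*" if "(c, x) \<in> T\<^sup>*" for x
    using that
  proof (induction rule: rtrancl_induct)
    case (step y z)
    then have "y \<in> D" using D by simp
    then show ?case using step closed by (meson IntI SigmaI rtrancl.rtrancl_into_rtrancl)
  qed simp
  have "\<exists>!p. (p, x) \<in> T \<inter> D \<times> D" if x: "x \<in> D - {c}" for x
  proof -
    have "x \<in> V - {r}" using x DV rD by blast
    then obtain p where "(p, x) \<in> T" using par by blast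
    then show ?thesis using x parD uniq by blast
  qed
  moreover have "\<forall>x \<in> D. (c, x) \<in> (T \<inter> D \<times> D)\<^sup>*" using reachD D by blast
  ultimately show "rooted_tree D (T \<inter> D \<times> D)"
    unfolding rooted_tree_def using cD noc by (intro conjI bexI[of _ c]) simp_all
  have reachV: "x \<notin> D \<Longrightarrow> (r, x) \<in> (T \<inter> (V - D) \<times> (V - D))\<^sup>*" if "(r, x) \<in> T\<^sup>*" for x
    using that
  proof (induction rule: rtrancl_induct)
    case (step y z)
    then have "y \<notin> D" using closed by blast
    then have "(y, z) \<in> T \<inter> (V - D) \<times> (V - D)" using step T by blast
    then show ?case using step.IH \<open>y \<notin> D\<close> by (meson rtrancl.rtrancl_into_rtrancl)
  qed simp
  have "\<exists>!p. (p, x) \<in> T \<inter> (V - D) \<times> (V - D)" if x: "x \<in> V - D - {r}" for x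
  proof -
    obtain p where p: "(p, x) \<in> T" using par x by blast
    then have "p \<in> V - D" "x \<in> V - D" using x closed T by blast+
    then show ?thesis using p uniq by blast
  qed
  moreover have "\<forall>x \<in> V - D. (r, x) \<in> (T \<inter> (V - D) \<times> (V - D))\<^sup>*" using reachV reach by blast
  ultimately show "rooted_tree (V - D) (T \<inter> (V - D) \<times> (V - D))"
    unfolding rooted_tree_def using r rD by (intro conjI bexI[of _ r]) simp_all
qed

lemma liu_block_child:
  assumes "liu_lyndon t" "distinct (leaves t)" "b \<in> set (blocks t)"
  shows "(valency t, valency b) \<in> tree_edges t"
  using tree_edges_children[OF assms(1,2)] assms(3) by blast

text \<open>The outermost node has to split off the branch that is first in
  \<open>block_order\<close>: the one at the smallest child above the root or, if all children are
  descents, at the largest child. This branch becomes the right subtree, and the node is red iff the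
  child is a descent.\<close>

theorem rooted_tree_liu:
  "finite V \<Longrightarrow> rooted_tree V T \<Longrightarrow> \<exists>t \<in> liu_on V. tree_edges t = T"
proof (induction "card V" arbitrary: V T rule: less_induct)
  case less
  obtain r where r: "r \<in> V" "\<forall>p. (p, r) \<notin> T" and par: "\<forall>c \<in> V - {r}. \<exists>!p. (p, c) \<in> T"
    and reach: "\<forall>c \<in> V. (r, c) \<in> T\<^sup>*" and T: "T \<subseteq> V \<times> V"
    using less.prems(2) unfolding rooted_tree_def by blast
  show ?case
  proof (cases "\<exists>c. (r, c) \<in> T")
    case False
    have "V = {r}"
    proof -
      have "c = r" if "c \<in> V" for c
        using reach that False by (metis converse_rtranclE)
      then show ?thesis using r by blast
    qed
    then have "T = {}" using T r by auto
    then show ?thesis using \<open>V = {r}\<close> by (intro bexI[of _ "Leaf r"]) (auto simp: liu_on_def)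
  next
    case True
    define better_child where "better_child x y \<longleftrightarrow> (r < x \<and> (r < y \<longrightarrow> x \<le> y)) \<or> (x < r \<and> y < r \<and> y \<le> x)" for x y
    have "\<exists>c. (r, c) \<in> T \<and> (\<forall>y. (r, y) \<in> T \<longrightarrow> better_child c y)"
    proof (cases "\<exists>c > r. (r, c) \<in> T")
      case True
      define c where "c = (LEAST c. r < c \<and> (r, c) \<in> T)"
      have "r < c \<and> (r, c) \<in> T" unfolding c_def by (rule LeastI_ex) (use True in blast)
      moreover have "c \<le> y" if "r < y" "(r, y) \<in> T" for y
        unfolding c_def by (rule Least_le) (use that in blast)
      ultimately show ?thesis by (auto simp: better_child_def)
    next
      case nT: False
      have fin: "finite {c. (r, c) \<in> T}" using T less.prems(1) by (auto intro: finite_subset[of _ V])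
      define c where "c = Max {c. (r, c) \<in> T}"
      have c: "(r, c) \<in> T" using Max_in[OF fin] True by (auto simp: c_def)
      have "y \<le> c" if "(r, y) \<in> T" for y using Max_ge[OF fin] that by (simp add: c_def)
      moreover have "y < r" if "(r, y) \<in> T" for y using nT that r(2) by (metis linorder_neqE_nat)
      ultimately show ?thesis using c by (auto simp: better_child_def)
    qed
    then obtain c where c: "(r, c) \<in> T" and best: "\<And>y. (r, y) \<in> T \<Longrightarrow> better_child c y" by blast
    define D where "D = {x. (c, x) \<in> T\<^sup>*}"
    note S = rooted_tree_split[OF less.prems(1) T r par reach c D_def]
    have "card D < card V" "card (V - D) < card V"
      using S(1-3) r less.prems(1) by (auto intro!: psubset_card_mono)
    then obtain l b where l: "l \<in> liu_on (V - D)" "tree_edges l = T \<inter> (V - D) \<times> (V - D)"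
      and b: "b \<in> liu_on D" "tree_edges b = T \<inter> D \<times> D"
      using less.hyps[of "V - D"] less.hyps[of D] S less.prems(1) finite_subset by (metis finite_Diff)
    have ll: "liu_lyndon l" "distinct (leaves l)" "set (leaves l) = V - D"
      and bb: "liu_lyndon b" "distinct (leaves b)" "set (leaves b) = D"
      using l b by (auto simp: liu_on_def)
    have root: "valency t = x" if "liu_lyndon t" "distinct (leaves t)" "x \<in> set (leaves t)"
      "\<forall>p. (p, x) \<notin> tree_edges t" for t x
    proof (rule ccontr)
      assume "valency t \<noteq> x"
      then have "\<exists>p. (p, x) \<in> tree_edges t"
        using fits_rooted[OF fits_tree_edges[OF that(1,2)] that(2)] that(3) by blast
      then show False using that(4) by blast
    qed
    have vl: "valency l = r" by (rule root) (use ll l r S in auto)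
    have vb: "valency b = c" by (rule root) (use bb b S in auto)
    have dist: "distinct (leaves l @ leaves b)" using ll bb by auto
    have rc: "r \<noteq> c" using S by auto
    define d where "d = (if c < r then Red else Blue)"
    have head: "better_child c (valency h) \<and> valency h \<noteq> c \<and> valency h \<noteq> r" if "l = Node e l1 h" for e l1 h
    proof -
      have "(r, valency h) \<in> T" using liu_block_child[OF ll(1,2)] that vl l(2) by auto
      moreover have "valency h \<noteq> c" using valency_in[of h] that ll(3) S(2) by auto
      ultimately show ?thesis using best r(2) by blast
    qed
    have col: "e = Red \<longleftrightarrow> valency h < r" if "l = Node e l1 h" for e l1 h
      using liu_Node_valency(1,2)[of e l1 h] ll(1,2) that vl by simp
    have "liu_lyndon (Node d l b)"
      unfolding liu_lyndon_Node[OF dist] vl vb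
    proof (intro conjI allI impI)
      show "better d r c" using rc by (auto simp: d_def better_def)
      show "better d c (valency h)" if e: "l = Node d l1 h" for l1 h
        using head[OF e] col[OF e] rc by (auto simp: d_def better_def better_child_def split: if_splits)
      show "l \<noteq> Node Blue l1 h" if "d = Red" for l1 h
      proof
        assume e: "l = Node Blue l1 h"
        show False using head[OF e] col[OF e] that rc by (auto simp: d_def better_child_def split: if_splits)
      qed
    qed (use ll bb in auto)
    moreover have "tree_edges (Node d l b) = T" using S(4) l(2) b(2) vl vb by simp
    ultimately show ?thesis using dist ll bb S(1) by (intro bexI[of _ "Node d l b"]) (auto simp: liu_on_def)
  qed
qed

lemma liu_trees_eq: "liu_trees n i = {t \<in> liu_on {1..n}. red_count t = i}"
  by (auto simp: liu_trees_def liu_on_def bicolored_trees_def)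

theorem bij_betw_tree_edges: "bij_betw tree_edges (liu_trees n i) (rooted_trees n i)"
proof (rule bij_betw_imageI)
  show "inj_on tree_edges (liu_trees n i)"
    using tree_edges_inj by (rule inj_on_subset) (auto simp: liu_trees_eq)
  have D: "card (descents (tree_edges t)) = red_count t \<and> rooted_tree {1..n} (tree_edges t)"
    if "t \<in> liu_on {1..n}" for t
  proof -
    have t: "liu_lyndon t" "distinct (leaves t)" "set (leaves t) = {1..n}"
      using that by (auto simp: liu_on_def)
    show ?thesis using fits_descents[OF fits_tree_edges[OF t(1,2)] t(2)]
      fits_rooted_tree[OF fits_tree_edges[OF t(1,2)] t(2)] t(3) by simp
  qed
  show "tree_edges ` liu_trees n i = rooted_trees n i"
  proof
    show "tree_edges ` liu_trees n i \<subseteq> rooted_trees n i"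
      using D by (auto simp: liu_trees_eq rooted_trees_def)
    show "rooted_trees n i \<subseteq> tree_edges ` liu_trees n i"
    proof
      fix T assume T: "T \<in> rooted_trees n i"
      then obtain t where "t \<in> liu_on {1..n}" "tree_edges t = T"
        using rooted_tree_liu[of "{1..n}" T] by (auto simp: rooted_trees_def)
      then show "T \<in> tree_edges ` liu_trees n i" using T D by (auto simp: liu_trees_eq rooted_trees_def)
    qed
  qed
qed

section \<open>Covers and maximal chains of weighted partitions\<close>

definition inside :: "wpartition \<Rightarrow> nat set \<Rightarrow> wpartition" where
  "inside X B = {p \<in> X. fst p \<subseteq> B}"

lemma wpartitionsD:
  assumes "X \<in> wpartitions n"
  shows "partition_on {1..n} (fst ` X)" "inj_on fst X" "\<And>p. p \<in> X \<Longrightarrow> snd p < card (fst p)"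
    "\<And>p. p \<in> X \<Longrightarrow> fst p \<noteq> {}" "finite X" "\<Union> (fst ` X) = {1..n}"
    "\<And>p. p \<in> X \<Longrightarrow> fst p \<subseteq> {1..n}"
proof -
  show P: "partition_on {1..n} (fst ` X)" and I: "inj_on fst X"
    and "\<And>p. p \<in> X \<Longrightarrow> snd p < card (fst p)"
    using assms by (auto simp: wpartitions_def)
  show "\<And>p. p \<in> X \<Longrightarrow> fst p \<noteq> {}" using partition_onD3[OF P] by force
  show U: "\<Union> (fst ` X) = {1..n}" using partition_onD1[OF P] by simp
  then show "\<And>p. p \<in> X \<Longrightarrow> fst p \<subseteq> {1..n}" by blast
  have "finite (fst ` X)" using U by (metis finite_UnionD finite_atLeastAtMost)
  then show "finite X" using I finite_imageD by blast
qed

lemma block_unique: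
  assumes "X \<in> wpartitions n" "p \<in> X" "q \<in> X" "x \<in> fst p" "x \<in> fst q"
  shows "p = q"
proof -
  have "fst p = fst q"
    using partition_onD2[OF wpartitionsD(1)[OF assms(1)]] assms(2-) by (auto simp: disjoint_def)
  then show ?thesis using wpartitionsD(2)[OF assms(1)] assms(2,3) by (simp add: inj_on_def)
qed

lemma block_inter:
  assumes "X \<in> wpartitions n" "p \<in> X" "q \<in> X" "p \<noteq> q"
  shows "fst p \<inter> fst q = {}"
  using block_unique[OF assms(1-3)] assms(4) by blast

definition refines :: "wpartition \<Rightarrow> wpartition \<Rightarrow> bool" where
  "refines X Y \<longleftrightarrow> (\<forall>p \<in> X. \<exists>q \<in> Y. fst p \<subseteq> fst q)"

lemma inside_Union:
  assumes "X \<in> wpartitions n" "Y \<in> wpartitions n" "refines X Y" "q \<in> Y"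
  shows "\<Union> (fst ` inside X (fst q)) = fst q"
proof
  show "\<Union> (fst ` inside X (fst q)) \<subseteq> fst q" by (auto simp: inside_def)
  show "fst q \<subseteq> \<Union> (fst ` inside X (fst q))"
  proof
    fix x assume x: "x \<in> fst q"
    then have "x \<in> \<Union> (fst ` X)"
      using wpartitionsD(6)[OF assms(1)] wpartitionsD(7)[OF assms(2,4)] by blast
    then obtain p where p: "p \<in> X" "x \<in> fst p" by blast
    then obtain q' where "q' \<in> Y" "fst p \<subseteq> fst q'" using assms(3) by (auto simp: refines_def)
    then have "fst p \<subseteq> fst q" using block_unique[OF assms(2) assms(4)] x p by blast
    then show "x \<in> \<Union> (fst ` inside X (fst q))" using p unfolding inside_def by blast
  qed
qed

text \<open>Blocks are nonempty and disjoint, so a family of blocks is determined by its union.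
  Hence the quantifier over \<open>S\<close> in \<open>wp_le\<close> concerns a single
  family.\<close>

lemma inside_eqI:
  assumes "X \<in> wpartitions n" "S \<subseteq> X" "B = \<Union> (fst ` S)"
  shows "S = inside X B"
proof
  show "S \<subseteq> inside X B" using assms by (auto simp: inside_def)
  show "inside X B \<subseteq> S"
  proof
    fix p assume p: "p \<in> inside X B"
    then have "p \<in> X" "fst p \<subseteq> B" by (auto simp: inside_def)
    moreover obtain x where "x \<in> fst p" using wpartitionsD(4)[OF assms(1) \<open>p \<in> X\<close>] by blast
    ultimately obtain q where "q \<in> S" "x \<in> fst q" using assms(3) by blast
    then show "p \<in> S" using block_unique[OF assms(1) \<open>p \<in> X\<close>] assms(2) \<open>x \<in> fst p\<close> by blast
  qed
qed

lemma finite_inside: "X \<in> wpartitions n \<Longrightarrow> finite (inside X B)"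
  using wpartitionsD(5) by (simp add: inside_def)

text \<open>The condition that the excess of weight lies between 0 and the number of parts minus 1,
  written without subtraction to stay within the naturals.\<close>

definition weights_ok :: "wpartition \<Rightarrow> nat set \<times> nat \<Rightarrow> bool" where
  "weights_ok X q \<longleftrightarrow> sum snd (inside X (fst q)) \<le> snd q \<and>
    snd q < sum snd (inside X (fst q)) + card (inside X (fst q))"

lemma wp_le_iff:
  assumes X: "X \<in> wpartitions n" and Y: "Y \<in> wpartitions n"
  shows "wp_le X Y \<longleftrightarrow> refines X Y \<and> (\<forall>q \<in> Y. weights_ok X q)"
proof -
  have r: "(\<forall>(A, w) \<in> X. \<exists>(B, v) \<in> Y. A \<subseteq> B) \<longleftrightarrow> refines X Y"
    by (simp add: refines_def case_prod_unfold)
  have w: "int v - (\<Sum>(A, w) \<in> inside X B. int w) \<in> {0..int (card (inside X B)) - 1} \<longleftrightarrow> weights_ok X (B, v)"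
    for B v
  proof -
    have "(\<Sum>(A, w) \<in> inside X B. int w) = int (sum snd (inside X B))"
      by (simp add: case_prod_unfold)
    then show ?thesis unfolding weights_ok_def fst_conv snd_conv atLeastAtMost_iff by linarith
  qed
  have "(\<forall>(B, v) \<in> Y. \<forall>S \<subseteq> X. B = \<Union> (fst ` S) \<longrightarrow>
        int v - (\<Sum>(A, w) \<in> S. int w) \<in> {0..int (card S) - 1}) \<longleftrightarrow> (\<forall>q \<in> Y. weights_ok X q)"
    if R: "refines X Y"
  proof -
    have "(\<forall>S \<subseteq> X. B = \<Union> (fst ` S) \<longrightarrow>
        int v - (\<Sum>(A, w) \<in> S. int w) \<in> {0..int (card S) - 1}) \<longleftrightarrow> weights_ok X (B, v)"
      if "(B, v) \<in> Y" for B v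
    proof -
      have E: "S \<subseteq> X \<and> B = \<Union> (fst ` S) \<longleftrightarrow> S = inside X B" for S
      proof
        assume "S \<subseteq> X \<and> B = \<Union> (fst ` S)"
        then show "S = inside X B" by (intro inside_eqI[OF X]) simp_all
      next
        assume S: "S = inside X B"
        have "S \<subseteq> X" unfolding S inside_def by simp
        moreover have "\<Union> (fst ` S) = B" unfolding S by (rule inside_Union[OF X Y R that, unfolded fst_conv])
        ultimately show "S \<subseteq> X \<and> B = \<Union> (fst ` S)" by simp
      qed
      have "(\<forall>S \<subseteq> X. B = \<Union> (fst ` S) \<longrightarrow> Q S) \<longleftrightarrow> Q (inside X B)" for Q
      proof
        assume "\<forall>S \<subseteq> X. B = \<Union> (fst ` S) \<longrightarrow> Q S"
        then show "Q (inside X B)" using E[of "inside X B"] by simp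
      next
        assume "Q (inside X B)"
        then show "\<forall>S \<subseteq> X. B = \<Union> (fst ` S) \<longrightarrow> Q S" using E by metis
      qed
      then show ?thesis by (simp only: w)
    qed
    then show ?thesis by auto
  qed
  then show ?thesis unfolding wp_le_def r by blast
qed

lemma inside_self:
  assumes "X \<in> wpartitions n" "q \<in> X"
  shows "inside X (fst q) = {q}"
  using inside_eqI[OF assms(1), of "{q}" "fst q"] assms(2) by auto

text \<open>Both bounds add up over the blocks of \<open>Y\<close> inside a block of
  \<open>Z\<close>. The upper one is summed in the form weight plus 1; the ones add up to
  \<open>card S\<close>, which is just what the step from \<open>Y\<close> to \<open>Z\<close> may
  add.\<close>

lemma wp_le_trans:
  assumes X: "X \<in> wpartitions n" and Y: "Y \<in> wpartitions n" and Z: "Z \<in> wpartitions n"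
    and XY: "wp_le X Y" and YZ: "wp_le Y Z"
  shows "wp_le X Z"
proof -
  have R: "refines X Y" "refines Y Z" and W: "\<And>q. q \<in> Y \<Longrightarrow> weights_ok X q" "\<And>q. q \<in> Z \<Longrightarrow> weights_ok Y q"
    using XY YZ wp_le_iff[OF X Y] wp_le_iff[OF Y Z] by auto
  have RXZ: "refines X Z" using R unfolding refines_def by (meson subset_trans)
  have "weights_ok X r" if r: "r \<in> Z" for r
  proof -
    define S where "S = inside Y (fst r)"
    have S: "S \<subseteq> Y" "finite S" using finite_inside[OF Y] by (auto simp: S_def inside_def)
    have eq: "inside X (fst r) = (\<Union>q \<in> S. inside X (fst q))"
    proof
      show "inside X (fst r) \<subseteq> (\<Union>q \<in> S. inside X (fst q))"
      proof
        fix p assume p: "p \<in> inside X (fst r)"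
        then obtain q where q: "q \<in> Y" "fst p \<subseteq> fst q" using R(1) by (auto simp: inside_def refines_def)
        then obtain r' where r': "r' \<in> Z" "fst q \<subseteq> fst r'" using R(2) by (auto simp: refines_def)
        have "p \<in> X" using p by (simp add: inside_def)
        from wpartitionsD(4)[OF X this] obtain x where "x \<in> fst p" by blast
        then have "r' = r" using block_unique[OF Z r'(1) r] q r' p by (auto simp: inside_def)
        then show "p \<in> (\<Union>q \<in> S. inside X (fst q))" using p q r' unfolding inside_def S_def by blast
      qed
      show "(\<Union>q \<in> S. inside X (fst q)) \<subseteq> inside X (fst r)" by (auto simp: inside_def S_def)
    qed
    have disj: "inside X (fst q) \<inter> inside X (fst q') = {}" if "q \<in> S" "q' \<in> S" "q \<noteq> q'" for q q'
    proof -
      have "fst q \<inter> fst q' = {}" using block_inter[OF Y] S that by blast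
      then show ?thesis using wpartitionsD(4)[OF X] by (fastforce simp: inside_def)
    qed
    have s: "sum snd (inside X (fst r)) = (\<Sum>q \<in> S. sum snd (inside X (fst q)))"
      unfolding eq by (rule sum.UNION_disjoint) (use S finite_inside[OF X] disj in auto)
    have c: "card (inside X (fst r)) = (\<Sum>q \<in> S. card (inside X (fst q)))"
      unfolding eq by (rule card_UN_disjoint) (use S finite_inside[OF X] disj in auto)
    have lo: "(\<Sum>q \<in> S. sum snd (inside X (fst q))) \<le> sum snd S"
      by (rule sum_mono) (use W(1) S in \<open>auto simp: weights_ok_def\<close>)
    have "(\<Sum>q \<in> S. snd q + 1) \<le> (\<Sum>q \<in> S. sum snd (inside X (fst q)) + card (inside X (fst q)))"
      by (rule sum_mono) (use W(1) S in \<open>fastforce simp: weights_ok_def\<close>)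
    then have hi: "sum snd S + card S \<le> sum snd (inside X (fst r)) + card (inside X (fst r))"
      unfolding s c by (simp only: sum.distrib sum_constant) simp
    show ?thesis using W(2)[OF r] lo hi s by (simp add: weights_ok_def S_def)
  qed
  then show ?thesis using RXZ wp_le_iff[OF X Z] by blast
qed

section \<open>Merging two blocks: covers and rank\<close>

definition mergeable :: "wpartition \<Rightarrow> nat set \<Rightarrow> nat set \<Rightarrow> bool" where
  "mergeable X A B \<longleftrightarrow> A \<in> fst ` X \<and> B \<in> fst ` X \<and> A \<noteq> B"

lemma mergeableE:
  assumes "mergeable X A B"
  obtains a b where "(A, a) \<in> X" "(B, b) \<in> X" "A \<noteq> B"
  using assms by (force simp: mergeable_def)

lemma wp_merge_eq:
  assumes "X \<in> wpartitions n" "(A, a) \<in> X" "(B, b) \<in> X"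
  shows "wp_merge u A B X = insert (A \<union> B, a + b + u) (X - {(A, a), (B, b)})"
proof -
  have "(A, a') \<in> X \<longleftrightarrow> a' = a" "(B, b') \<in> X \<longleftrightarrow> b' = b" for a' b'
    using wpartitionsD(2)[OF assms(1)] assms(2,3) by (force simp: inj_on_def)+
  then show ?thesis by (auto simp: wp_merge_def)
qed

lemma wp_merge_new:
  assumes "X \<in> wpartitions n" "(A, a) \<in> X" "(B, b) \<in> X" "A \<noteq> B"
  shows "A \<inter> B = {}" "A \<noteq> {}" "B \<noteq> {}" "p \<in> X - {(A, a), (B, b)} \<Longrightarrow> fst p \<inter> (A \<union> B) = {}"
    "(A \<union> B, v) \<notin> X - {(A, a), (B, b)}"
proof -
  show AB: "A \<inter> B = {}" using block_inter[OF assms(1-3)] assms(4) by auto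
  show ne: "A \<noteq> {}" "B \<noteq> {}" using wpartitionsD(4)[OF assms(1)] assms by fastforce+
  show d: "p \<in> X - {(A, a), (B, b)} \<Longrightarrow> fst p \<inter> (A \<union> B) = {}" for p
    using block_inter[OF assms(1), of p "(A, a)"] block_inter[OF assms(1), of p "(B, b)"] assms(2,3) by auto
  show "(A \<union> B, v) \<notin> X - {(A, a), (B, b)}" using d[of "(A \<union> B, v)"] ne by auto
qed

lemma wp_merge_wpartitions:
  assumes X: "X \<in> wpartitions n" and m: "mergeable X A B" and u: "u \<le> 1"
  shows "wp_merge u A B X \<in> wpartitions n" "card (wp_merge u A B X) + 1 = card X"
proof -
  obtain a b where ab: "(A, a) \<in> X" "(B, b) \<in> X" "A \<noteq> B" using m by (rule mergeableE)
  note N = wp_merge_new[OF X ab] and W = wpartitionsD[OF X]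
  let ?Y = "insert (A \<union> B, a + b + u) (X - {(A, a), (B, b)})"
  have eq: "wp_merge u A B X = ?Y" by (rule wp_merge_eq[OF X ab(1,2)])
  have "\<Union> (fst ` ?Y) = \<Union> (fst ` X)"
  proof -
    have "X = insert (A, a) (insert (B, b) (X - {(A, a), (B, b)}))" using ab by blast
    then have "\<Union> (fst ` X) = A \<union> (B \<union> \<Union> (fst ` (X - {(A, a), (B, b)})))"
      by (metis UN_insert fst_conv)
    then show ?thesis by auto
  qed
  moreover have "disjoint (fst ` ?Y)"
  proof (rule disjointI)
    fix S T assume ST: "S \<in> fst ` ?Y" "T \<in> fst ` ?Y" "S \<noteq> T"
    then obtain p q where pq: "p \<in> ?Y" "q \<in> ?Y" "S = fst p" "T = fst q" by blast
    show "S \<inter> T = {}"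
    proof (cases "p \<in> X - {(A, a), (B, b)}"; cases "q \<in> X - {(A, a), (B, b)}")
      assume "p \<in> X - {(A, a), (B, b)}" "q \<in> X - {(A, a), (B, b)}"
      then show ?thesis using block_inter[OF X, of p q] pq ST by auto
    next
      assume "p \<in> X - {(A, a), (B, b)}" "q \<notin> X - {(A, a), (B, b)}"
      then show ?thesis using N(4)[of p] pq by auto
    next
      assume "p \<notin> X - {(A, a), (B, b)}" "q \<in> X - {(A, a), (B, b)}"
      then show ?thesis using N(4)[of q] pq by auto
    next
      assume "p \<notin> X - {(A, a), (B, b)}" "q \<notin> X - {(A, a), (B, b)}"
      then show ?thesis using pq ST by auto
    qed
  qed
  moreover have "{} \<notin> fst ` ?Y" using W(4) N(2) by force
  ultimately have P: "partition_on {1..n} (fst ` ?Y)" using W(6) by (simp add: partition_on_def)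
  have I: "inj_on fst ?Y"
  proof -
    have "inj_on fst (X - {(A, a), (B, b)})" using W(2) by (rule inj_on_subset) auto
    moreover have "A \<union> B \<notin> fst ` (X - {(A, a), (B, b)})" using N(5) by force
    ultimately show ?thesis by (auto simp: inj_on_insert)
  qed
  have fin: "finite A" "finite B" using W(7)[OF ab(1)] W(7)[OF ab(2)] finite_subset by fastforce+
  have "a < card A" "b < card B" using W(3)[OF ab(1)] W(3)[OF ab(2)] by auto
  then have "a + b + u < card (A \<union> B)" using u N(1) fin by (simp add: card_Un_disjoint)
  then have "\<forall>(B, v) \<in> ?Y. v < card B" using W(3) by auto
  then show "wp_merge u A B X \<in> wpartitions n" unfolding eq wpartitions_def using P I by blast
  have "card (X - {(A, a), (B, b)}) = card X - card {(A, a), (B, b)}"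
    by (rule card_Diff_subset) (use ab in auto)
  moreover have "card {(A, a), (B, b)} \<le> card X" by (rule card_mono) (use W(5) ab in auto)
  moreover have "card ?Y = Suc (card (X - {(A, a), (B, b)}))"
    by (rule card_insert_disjoint[OF _ N(5)]) (use W(5) in simp)
  ultimately show "card (wp_merge u A B X) + 1 = card X"
    unfolding eq using ab(3) by simp
qed

text \<open>A merge inside \<open>q\<close> uses up one part of \<open>q\<close> and
  \<open>u\<close> units of its excess; the assumptions \<open>w\<close> say that what remains is
  still in range. The other blocks of \<open>Y\<close> see no change.\<close>

lemma wp_merge_le_upper:
  assumes X: "X \<in> wpartitions n" and Y: "Y \<in> wpartitions n" and le: "wp_le X Y"
    and ab: "(A, a) \<in> X" "(B, b) \<in> X" "A \<noteq> B" and u: "u \<le> 1"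
    and q: "q \<in> Y" "A \<subseteq> fst q" "B \<subseteq> fst q"
    and w: "sum snd (inside X (fst q)) + u \<le> snd q"
      "snd q + 1 < sum snd (inside X (fst q)) + u + card (inside X (fst q))"
  shows "wp_le (wp_merge u A B X) Y"
proof -
  let ?X = "wp_merge u A B X"
  have m: "mergeable X A B" using ab by (force simp: mergeable_def)
  note N = wp_merge_new[OF X ab] and eq = wp_merge_eq[OF X ab(1,2), of u]
  have R: "refines X Y" and W: "\<And>q. q \<in> Y \<Longrightarrow> weights_ok X q"
    using le wp_le_iff[OF X Y] by auto
  have "refines ?X Y" using R q unfolding refines_def eq by auto
  moreover have "weights_ok ?X r" if r: "r \<in> Y" for r
  proof (cases "r = q")
    case True
    define S where "S = inside X (fst q) - {(A, a), (B, b)}"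
    have fin: "finite S" using finite_inside[OF X] by (simp add: S_def)
    have ins: "inside X (fst q) = insert (A, a) (insert (B, b) S)"
      using ab q by (auto simp: S_def inside_def)
    have 1: "sum snd (inside X (fst q)) = a + b + sum snd S" "card (inside X (fst q)) = 2 + card S"
      using fin ab(3) unfolding ins by (auto simp: S_def)
    have "inside ?X (fst q) = insert (A \<union> B, a + b + u) S" using q unfolding eq by (auto simp: inside_def S_def)
    moreover have "(A \<union> B, a + b + u) \<notin> S" using N(5) unfolding S_def inside_def by blast
    ultimately have "sum snd (inside ?X (fst q)) = a + b + u + sum snd S" "card (inside ?X (fst q)) = 1 + card S"
      using fin by simp_all
    then show ?thesis using w 1 True by (simp add: weights_ok_def)
  next
    case False
    have "fst r \<inter> fst q = {}" using block_inter[OF Y r q(1) False] .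
    then have "\<not> A \<subseteq> fst r" "\<not> B \<subseteq> fst r" using q N(2,3) by blast+
    then have "inside ?X (fst r) = inside X (fst r)" unfolding eq by (auto simp: inside_def)
    then show ?thesis using W[OF r] by (simp add: weights_ok_def)
  qed
  ultimately show ?thesis using wp_le_iff[OF wp_merge_wpartitions(1)[OF X m u] Y] by blast
qed

lemma wp_merge_above:
  assumes X: "X \<in> wpartitions n" and m: "mergeable X A B" and u: "u \<le> 1"
  shows "wp_le X (wp_merge u A B X)" "wp_merge u A B X \<noteq> X"
proof -
  let ?Y = "wp_merge u A B X"
  obtain a b where ab: "(A, a) \<in> X" "(B, b) \<in> X" "A \<noteq> B" using m by (rule mergeableE)
  note N = wp_merge_new[OF X ab] and eq = wp_merge_eq[OF X ab(1,2), of u]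
  have "refines X ?Y" unfolding refines_def eq by force
  moreover have "weights_ok X q" if q: "q \<in> ?Y" for q
  proof (cases "q \<in> X - {(A, a), (B, b)}")
    case True
    then have "inside X (fst q) = {q}" using inside_self[OF X] by blast
    then show ?thesis by (simp add: weights_ok_def)
  next
    case False
    then have qq: "q = (A \<union> B, a + b + u)" using q eq by auto
    have "inside X (A \<union> B) = {(A, a), (B, b)}"
      using inside_eqI[OF X, of "{(A, a), (B, b)}" "A \<union> B"] ab by auto
    then show ?thesis using ab(3) u by (simp add: weights_ok_def qq)
  qed
  ultimately show "wp_le X ?Y"
    using wp_le_iff[OF X wp_merge_wpartitions(1)[OF X m u]] by blast
  show "?Y \<noteq> X" using wp_merge_wpartitions(2)[OF X m u] by auto
qed

text \<open>This makes the poset graded by the number of blocks. Some block of \<open>Y\<close> has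
  at least two parts in \<open>X\<close>, since a single part leaves no freedom for the weight. The
  merge takes weight 1 iff there is excess to spend; with at least two parts the remainder is in
  range in both cases.\<close>

lemma wp_less_merge:
  assumes X: "X \<in> wpartitions n" and Y: "Y \<in> wpartitions n" and less: "wp_less X Y"
  obtains u A B where "u \<le> 1" "mergeable X A B" "wp_le (wp_merge u A B X) Y"
proof -
  have le: "wp_le X Y" and ne: "X \<noteq> Y" using less by (auto simp: wp_less_def)
  have R: "refines X Y" and W: "\<And>q. q \<in> Y \<Longrightarrow> weights_ok X q"
    using le wp_le_iff[OF X Y] by auto
  have "\<exists>q \<in> Y. card (inside X (fst q)) \<noteq> 1"
  proof (rule ccontr)
    assume "\<not> ?thesis"
    then have c1: "\<And>q. q \<in> Y \<Longrightarrow> card (inside X (fst q)) = 1" by blast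
    have ins: "inside X (fst q) = {q}" if q: "q \<in> Y" for q
    proof -
      obtain p where p: "inside X (fst q) = {p}" using c1[OF q] card_1_singletonE by blast
      have "fst p = fst q" using inside_Union[OF X Y R q] p by simp
      moreover have "snd p = snd q" using W[OF q] p by (simp add: weights_ok_def)
      ultimately show ?thesis using p by (simp add: prod_eqI)
    qed
    then have "Y \<subseteq> X" by (auto simp: inside_def)
    moreover have "X \<subseteq> Y"
    proof
      fix p assume p: "p \<in> X"
      then obtain q where "q \<in> Y" "fst p \<subseteq> fst q" using R by (auto simp: refines_def)
      then show "p \<in> Y" using ins[of q] p by (auto simp: inside_def)
    qed
    ultimately show False using ne by blast
  qed
  then obtain q where q: "q \<in> Y" "card (inside X (fst q)) \<noteq> 1" by blast
  then have c2: "2 \<le> card (inside X (fst q))" using W[OF q(1)]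
    by (cases "card (inside X (fst q))") (auto simp: weights_ok_def dest!: card_eq_0_iff[THEN iffD1] simp: finite_inside[OF X])
  then obtain p p' where p: "p \<in> inside X (fst q)" "p' \<in> inside X (fst q)" "p \<noteq> p'"
    using card_le_Suc0_iff_eq[OF finite_inside[OF X], of "fst q"] by fastforce
  obtain A a B b where AB: "p = (A, a)" "p' = (B, b)" by fastforce
  have ab: "(A, a) \<in> X" "(B, b) \<in> X" "A \<noteq> B" "A \<subseteq> fst q" "B \<subseteq> fst q"
  proof -
    show ab: "(A, a) \<in> X" "(B, b) \<in> X" "A \<subseteq> fst q" "B \<subseteq> fst q"
      using p AB by (auto simp: inside_def)
    show "A \<noteq> B" using inj_onD[OF wpartitionsD(2)[OF X] _ ab(1,2)] p(3) AB by auto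
  qed
  define u :: nat where "u = (if sum snd (inside X (fst q)) < snd q then 1 else 0)"
  have "wp_le (wp_merge u A B X) Y"
  proof (rule wp_merge_le_upper[OF X Y le ab(1-3) _ q(1) ab(4,5)])
    have *: "u' \<le> 1 \<and> s + u' \<le> v \<and> v + 1 < s + u' + k"
      if "s \<le> v" "v < s + k" "2 \<le> k" "u' = (if s < v then 1 else 0)" for s v k u' :: nat
      using that by (auto split: if_splits)
    show "u \<le> 1" "sum snd (inside X (fst q)) + u \<le> snd q"
      "snd q + 1 < sum snd (inside X (fst q)) + u + card (inside X (fst q))"
      using *[OF _ _ c2 u_def] W[OF q(1)] unfolding weights_ok_def by blast+
  qed
  moreover have "u \<le> 1" by (simp add: u_def)
  moreover have "A \<in> fst ` X" "B \<in> fst ` X" using ab(1,2) by force+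
  ultimately show ?thesis using that[of u A B] ab(3) by (simp add: mergeable_def)
qed

lemma wp_less_card:
  assumes "X \<in> wpartitions n" "Y \<in> wpartitions n" "wp_less X Y"
  shows "card Y < card X"
  using assms
proof (induction "card X" arbitrary: X rule: less_induct)
  case less
  obtain u A B where u: "u \<le> 1" "mergeable X A B" "wp_le (wp_merge u A B X) Y"
    using wp_less_merge[OF less.prems] by blast
  note M = wp_merge_wpartitions[OF less.prems(1) u(2,1)]
  show ?case
  proof (cases "wp_merge u A B X = Y")
    case True
    then show ?thesis using M(2) by simp
  next
    case False
    then have "card Y < card (wp_merge u A B X)"
      using less.hyps[OF _ M(1) less.prems(2)] M(2) u(3) by (simp add: wp_less_def)
    then show ?thesis using M(2) by simp
  qed
qed

lemma wp_less_trans: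
  assumes "X \<in> wpartitions n" "Y \<in> wpartitions n" "Z \<in> wpartitions n" "wp_less X Y" "wp_less Y Z"
  shows "wp_less X Z"
  using wp_le_trans[OF assms(1-3)] wp_less_card[OF assms(1,2,4)] wp_less_card[OF assms(2,3,5)] assms(4,5)
  by (auto simp: wp_less_def)

lemma wp_cover_merge:
  assumes "X \<in> wpartitions n" "Y \<in> wpartitions n" "wp_less X Y" "card X \<le> card Y + 1"
  obtains u A B where "u \<le> 1" "mergeable X A B" "Y = wp_merge u A B X"
proof -
  obtain u A B where u: "u \<le> 1" "mergeable X A B" "wp_le (wp_merge u A B X) Y"
    using wp_less_merge[OF assms(1-3)] by blast
  note M = wp_merge_wpartitions[OF assms(1) u(2,1)]
  have "wp_merge u A B X = Y"
  proof (rule ccontr)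
    assume "wp_merge u A B X \<noteq> Y"
    then have "card Y < card (wp_merge u A B X)"
      using wp_less_card[OF M(1) assms(2)] u(3) by (simp add: wp_less_def)
    then show False using M(2) assms(4) by simp
  qed
  then show ?thesis using that u by blast
qed


section \<open>Maximal chains as sequences of merges\<close>

type_synonym merge = "color \<times> nat set \<times> nat set"

fun apply_merge :: "wpartition \<Rightarrow> merge \<Rightarrow> wpartition" where
  "apply_merge X (c, A, B) = wp_merge (color_weight c) A B X"

fun valid_merges :: "wpartition \<Rightarrow> merge list \<Rightarrow> bool" where
  "valid_merges X [] = True"
| "valid_merges X ((c, A, B) # ms) \<longleftrightarrow> mergeable X A B \<and> valid_merges (wp_merge (color_weight c) A B X) ms"

abbreviation run :: "wpartition \<Rightarrow> merge list \<Rightarrow> wpartition" where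
  "run \<equiv> foldl apply_merge"

lemma color_weight_le: "color_weight c \<le> 1"
  by (cases c) auto

lemma color_weight_surj: "u \<le> 1 \<Longrightarrow> \<exists>c. color_weight c = u"
  using color_weight.simps by (metis le_zero_eq less_one linorder_not_less order_antisym)

lemma valid_merges_append: "valid_merges X (ms @ ms') \<longleftrightarrow> valid_merges X ms \<and> valid_merges (run X ms) ms'"
  by (induction X ms rule: valid_merges.induct) auto

lemma merge_chain_length: "length (merge_chain X ms) = Suc (length ms)"
  by (induction X ms rule: merge_chain.induct) auto

lemma merge_chain_nth: "k \<le> length ms \<Longrightarrow> merge_chain X ms ! k = run X (take k ms)"
proof (induction X ms arbitrary: k rule: merge_chain.induct)
  case (2 X c A B ms)
  then show ?case by (cases k) auto
qed auto

lemma valid_merges_run: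
  "X \<in> wpartitions n \<Longrightarrow> valid_merges X ms \<Longrightarrow>
    run X ms \<in> wpartitions n \<and> card (run X ms) + length ms = card X"
proof (induction X ms rule: valid_merges.induct)
  case (2 X c A B ms)
  then show ?case using wp_merge_wpartitions[OF 2(2) _ color_weight_le, of A B c] by auto
qed simp

lemma merge_chain_sorted:
  "X \<in> wpartitions n \<Longrightarrow> valid_merges X ms \<Longrightarrow>
    sorted_wrt wp_less (merge_chain X ms) \<and> set (merge_chain X ms) \<subseteq> wpartitions n"
proof (induction X ms rule: valid_merges.induct)
  case (2 X c A B ms)
  let ?Y = "wp_merge (color_weight c) A B X"
  have Y: "?Y \<in> wpartitions n" using wp_merge_wpartitions(1) color_weight_le 2 by auto
  have XY: "wp_less X ?Y"
    using wp_merge_above[OF 2(2) _ color_weight_le, of A B c] 2(3) by (simp add: wp_less_def)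
  have IH: "sorted_wrt wp_less (merge_chain ?Y ms)" "set (merge_chain ?Y ms) \<subseteq> wpartitions n"
    using 2 Y by auto
  have "wp_less X Z" if Z: "Z \<in> set (merge_chain ?Y ms)" for Z
  proof (cases "Z = ?Y")
    case False
    obtain W where W: "merge_chain ?Y ms = ?Y # W" by (cases "(?Y, ms)" rule: merge_chain.cases) auto
    then have "wp_less ?Y Z" using IH(1) Z False by auto
    then show ?thesis using wp_less_trans[OF 2(2) Y _ XY] IH(2) Z by blast
  qed (use XY in simp)
  then show ?case using IH 2(2) by auto
qed simp

text \<open>Maximality is encoded by the length: from \<open>n\<close> blocks down to one, a strict
  chain with \<open>n\<close> elements loses exactly one block at each step.\<close>

definition max_chain :: "nat \<Rightarrow> nat \<Rightarrow> wpartition list \<Rightarrow> bool" where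
  "max_chain n i W \<longleftrightarrow> length W = n \<and> W \<noteq> [] \<and> hd W = wp_bot n \<and> last W = wp_top n i \<and>
    sorted_wrt wp_less W \<and> set W \<subseteq> wpartitions n"

lemma wp_bot_wpartitions: "wp_bot n \<in> wpartitions n" "card (wp_bot n) = n"
proof -
  have f: "fst ` wp_bot n = (\<lambda>k. {k}) ` {1..n}" by (auto simp: wp_bot_def image_image)
  have "partition_on {1..n} (fst ` wp_bot n)"
    unfolding f by (auto simp: partition_on_def disjoint_def)
  moreover have "inj_on fst (wp_bot n)" by (auto simp: wp_bot_def inj_on_def)
  ultimately show "wp_bot n \<in> wpartitions n" by (auto simp: wpartitions_def wp_bot_def)
  show "card (wp_bot n) = n" unfolding wp_bot_def by (subst card_image) (auto simp: inj_on_def)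
qed

lemma wp_top_wpartitions:
  assumes "1 \<le> n" "i \<le> n - 1"
  shows "wp_top n i \<in> wpartitions n" "card (wp_top n i) = 1"
  using assms by (auto simp: wpartitions_def wp_top_def partition_on_def)

definition full_merges :: "nat \<Rightarrow> nat \<Rightarrow> merge list \<Rightarrow> bool" where
  "full_merges n i ms \<longleftrightarrow> valid_merges (wp_bot n) ms \<and> run (wp_bot n) ms = wp_top n i"

lemma full_merges_max_chain:
  assumes "1 \<le> n" "i \<le> n - 1" "full_merges n i ms"
  shows "max_chain n i (merge_chain (wp_bot n) ms)"
proof -
  note V = valid_merges_run[OF wp_bot_wpartitions(1)] and S = merge_chain_sorted[OF wp_bot_wpartitions(1)]
  have "valid_merges (wp_bot n) ms" and r: "run (wp_bot n) ms = wp_top n i"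
    using assms by (auto simp: full_merges_def)
  note v = V[OF this(1)] S[OF this(1)]
  have len: "Suc (length ms) = n" using v(1) r wp_bot_wpartitions(2)[of n] wp_top_wpartitions[OF assms(1,2)] by simp
  have "hd (merge_chain (wp_bot n) ms) = wp_bot n"
    by (cases "(wp_bot n, ms)" rule: merge_chain.cases) auto
  moreover have "last (merge_chain (wp_bot n) ms) = run (wp_bot n) ms"
    using merge_chain_nth[of "length ms" ms "wp_bot n"] merge_chain_length[of "wp_bot n" ms]
    by (metis diff_Suc_1 last_conv_nth length_0_conv nat.distinct(1) order_refl take_all)
  ultimately show ?thesis using v r len merge_chain_length[of "wp_bot n" ms]
    by (auto simp: max_chain_def)
qed

text \<open>Each step loses at least one block, and the bound on \<open>card X\<close> leaves no
  room for losing two. So every step is a cover, hence a merge.\<close>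

lemma sorted_wp_merges:
  "sorted_wrt wp_less (X # W) \<Longrightarrow> set (X # W) \<subseteq> wpartitions n \<Longrightarrow> card X \<le> length W + card (last (X # W)) \<Longrightarrow>
    \<exists>ms. valid_merges X ms \<and> merge_chain X ms = X # W \<and> run X ms = last (X # W)"
proof (induction W arbitrary: X)
  case Nil
  show ?case by (rule exI[of _ "[]"]) simp
next
  case (Cons Y W)
  have XY: "X \<in> wpartitions n" "Y \<in> wpartitions n" "wp_less X Y" using Cons.prems by auto
  have drop: "sorted_wrt wp_less (Z # W) \<Longrightarrow> set (Z # W) \<subseteq> wpartitions n \<Longrightarrow>
      card (last (Z # W)) + length W \<le> card Z" for Z W
  proof (induction W arbitrary: Z)
    case (Cons Y W)
    then show ?case using wp_less_card[of Z n Y] by fastforce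
  qed simp
  have dY: "card (last (Y # W)) + length W \<le> card Y" using drop[of Y W] Cons.prems by simp
  have "card X \<le> card Y + 1" using Cons.prems(3) dY by simp
  then obtain u A B where u: "u \<le> 1" "mergeable X A B" "Y = wp_merge u A B X"
    using wp_cover_merge[OF XY] by blast
  obtain c where c: "color_weight c = u" using color_weight_surj u by blast
  have "card Y < card X" by (rule wp_less_card[OF XY])
  then obtain ms where "valid_merges Y ms" "merge_chain Y ms = Y # W" "run Y ms = last (Y # W)"
    using Cons.IH[of Y] Cons.prems by auto
  then show ?case using u c by (intro exI[of _ "(c, A, B) # ms"]) auto
qed

lemma max_chain_full_merges:
  assumes "1 \<le> n" "i \<le> n - 1" "max_chain n i W"
  obtains ms where "full_merges n i ms" "W = merge_chain (wp_bot n) ms"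
proof -
  obtain W' where W: "W = wp_bot n # W'" using assms(3) by (cases W) (auto simp: max_chain_def)
  have "\<exists>ms. valid_merges (wp_bot n) ms \<and> merge_chain (wp_bot n) ms = wp_bot n # W' \<and> run (wp_bot n) ms = last (wp_bot n # W')"
    by (rule sorted_wp_merges[of _ _ n])
      (use assms W wp_bot_wpartitions(2)[of n] wp_top_wpartitions[OF assms(1,2)] in \<open>auto simp: max_chain_def\<close>)
  then show ?thesis using that assms(3) W by (auto simp: full_merges_def max_chain_def)
qed

section \<open>Rank two intervals\<close>

lemma merge_chain_Cons: "merge_chain X (m # ms) = X # merge_chain (apply_merge X m) ms"
  by (cases m) auto

lemma merge_chain_not_Nil: "merge_chain X ms \<noteq> []"
  using merge_chain_length[of X ms] by auto

lemma merge_chain_append: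
  "merge_chain X (ms @ ms') = butlast (merge_chain X ms) @ merge_chain (run X ms) ms'"
  by (induction ms arbitrary: X) (auto simp: merge_chain_Cons merge_chain_not_Nil)

lemma wp_merge_commute: "wp_merge u A B X = wp_merge u B A X"
  by (auto simp: wp_merge_def Un_commute)

lemma sub_blocks:
  assumes "X \<in> wpartitions n" "S \<subseteq> X" "p \<in> X" "fst p \<subseteq> \<Union> (fst ` S)"
  shows "p \<in> S"
proof -
  have "S = inside X (\<Union> (fst ` S))" by (rule inside_eqI[OF assms(1,2) refl])
  moreover have "p \<in> inside X (\<Union> (fst ` S))" using assms(3,4) by (simp add: inside_def)
  ultimately show ?thesis by simp
qed

text \<open>This confines the inner elements of a rank two interval: the blocks merged first lie in
  one block \<open>q\<close> of the top, and the weight condition at \<open>q\<close> restricts the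
  color of the first merge.\<close>

lemma first_merge_block:
  assumes X: "X \<in> wpartitions n" and v: "valid_merges X [(c, A, B), m]"
  obtains q where "q \<in> run X [(c, A, B), m]" "A \<subseteq> fst q" "B \<subseteq> fst q"
    "weights_ok (wp_merge (color_weight c) A B X) q"
proof -
  obtain d C D where m: "m = (d, C, D)" by (cases m)
  let ?Y = "wp_merge (color_weight c) A B X" and ?Z = "run X [(c, A, B), m]"
  have Z: "?Z = wp_merge (color_weight d) C D ?Y" by (simp add: m)
  have AB: "mergeable X A B" "mergeable ?Y C D" using v by (auto simp: m)
  note Y = wp_merge_wpartitions(1)[OF X AB(1) color_weight_le, of c]
  have "wp_le ?Y ?Z" unfolding Z by (rule wp_merge_above(1)[OF Y AB(2) color_weight_le])
  then have le: "refines ?Y ?Z" "\<And>q. q \<in> ?Z \<Longrightarrow> weights_ok ?Y q"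
    using wp_le_iff[OF Y wp_merge_wpartitions(1)[OF Y AB(2) color_weight_le, of d]] unfolding Z by blast+
  obtain a b where ab: "(A, a) \<in> X" "(B, b) \<in> X" using AB(1) by (rule mergeableE)
  have "(A \<union> B, a + b + color_weight c) \<in> ?Y" using wp_merge_eq[OF X ab] by simp
  then obtain q where "q \<in> ?Z" "A \<union> B \<subseteq> fst q" using le(1) unfolding refines_def by fastforce
  then show ?thesis using that le(2) by blast
qed

lemma mergeable_wp_merge:
  assumes X: "X \<in> wpartitions n" and ab: "(A, a) \<in> X" "(B, b) \<in> X" "A \<noteq> B"
    and C: "C \<in> fst ` wp_merge u A B X" "\<not> A \<union> B \<subseteq> C"
  obtains g where "(C, g) \<in> X" "C \<noteq> A" "C \<noteq> B"
proof -
  have "\<exists>g. (C, g) \<in> X - {(A, a), (B, b)}" using C unfolding wp_merge_eq[OF X ab(1,2)] by force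
  then obtain g where g: "(C, g) \<in> X - {(A, a), (B, b)}" by blast
  have "C \<inter> (A \<union> B) = {}" using wp_merge_new(4)[OF X ab g] by simp
  moreover have "A \<noteq> {}" "B \<noteq> {}" using wp_merge_new(2,3)[OF X ab] by auto
  ultimately have "C \<noteq> A" "C \<noteq> B" by blast+
  then show ?thesis using that g by blast
qed

lemma run_three:
  assumes X: "X \<in> wpartitions n" and abc: "(A, a) \<in> X" "(B, b) \<in> X" "(C, g) \<in> X"
    and ne: "A \<noteq> B" "A \<noteq> C" "B \<noteq> C"
  shows "valid_merges X [(c, A, B), (d, A \<union> B, C)]"
    "run X [(c, A, B), (d, A \<union> B, C)] =
      insert (A \<union> B \<union> C, a + b + g + color_weight c + color_weight d) (X - {(A, a), (B, b), (C, g)})"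
proof -
  let ?Y = "wp_merge (color_weight c) A B X"
  have m: "mergeable X A B" using abc ne by (force simp: mergeable_def)
  note N = wp_merge_new[OF X abc(1,2) ne(1)]
  have eq: "?Y = insert (A \<union> B, a + b + color_weight c) (X - {(A, a), (B, b)})"
    by (rule wp_merge_eq[OF X abc(1,2)])
  have Y: "?Y \<in> wpartitions n" by (rule wp_merge_wpartitions(1)[OF X m color_weight_le])
  have C: "(C, g) \<in> X - {(A, a), (B, b)}" using abc ne by auto
  have CD: "(A \<union> B, a + b + color_weight c) \<in> ?Y" "(C, g) \<in> ?Y" using C eq by auto
  have CAB: "A \<union> B \<noteq> C" using N(4)[OF C] N(2) by auto
  have "A \<union> B \<in> fst ` ?Y" "C \<in> fst ` ?Y" using CD by force+
  then have "mergeable ?Y (A \<union> B) C" using CAB by (simp add: mergeable_def)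
  then show "valid_merges X [(c, A, B), (d, A \<union> B, C)]" using m by simp
  have "(A \<union> B, a + b + color_weight c) \<notin> X - {(A, a), (B, b)}" by (rule N(5))
  then show "run X [(c, A, B), (d, A \<union> B, C)] =
      insert (A \<union> B \<union> C, a + b + g + color_weight c + color_weight d) (X - {(A, a), (B, b), (C, g)})"
    using wp_merge_eq[OF Y CD, of "color_weight d"] CAB by (auto simp: eq ac_simps)
qed

lemma run_two:
  assumes X: "X \<in> wpartitions n" and v: "valid_merges X [(c, A, B), (d, C, D)]"
    and disj: "(A \<union> B) \<inter> (C \<union> D) = {}"
  obtains a b g h where "(A, a) \<in> X" "(B, b) \<in> X" "(C, g) \<in> X" "(D, h) \<in> X"
    "valid_merges X [(d, C, D), (c, A, B)]"
    "run X [(c, A, B), (d, C, D)] = insert (A \<union> B, a + b + color_weight c)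
      (insert (C \<union> D, g + h + color_weight d) (X - {(A, a), (B, b), (C, g), (D, h)}))"
    "run X [(d, C, D), (c, A, B)] = run X [(c, A, B), (d, C, D)]"
proof -
  have mm: "mergeable X A B" "mergeable (wp_merge (color_weight c) A B X) C D" using v by auto
  obtain a b where ab: "(A, a) \<in> X" "(B, b) \<in> X" "A \<noteq> B" using mm(1) by (rule mergeableE)
  note N = wp_merge_new[OF X ab]
  have "\<not> A \<union> B \<subseteq> C" "\<not> A \<union> B \<subseteq> D" using N(2) disj by blast+
  then obtain g h where gh: "(C, g) \<in> X" "C \<noteq> A" "C \<noteq> B" "(D, h) \<in> X" "D \<noteq> A" "D \<noteq> B"
    using mm(2) mergeable_wp_merge[OF X ab] unfolding mergeable_def by metis
  have CD: "C \<noteq> D" using mm(2) by (simp add: mergeable_def)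
  note M = wp_merge_new[OF X gh(1,4) CD]
  have step: "run X [(c, A, B), (d, C, D)] = insert (A \<union> B, a + b + color_weight c)
      (insert (C \<union> D, g + h + color_weight d) (X - {(A, a), (B, b), (C, g), (D, h)})) \<and>
      valid_merges X [(c, A, B), (d, C, D)]"
    if X: "X \<in> wpartitions n" and ab: "(A, a) \<in> X" "(B, b) \<in> X" "A \<noteq> B" and gh: "(C, g) \<in> X" "(D, h) \<in> X" "C \<noteq> D"
      and ne: "C \<noteq> A" "C \<noteq> B" "D \<noteq> A" "D \<noteq> B" and disj: "(A \<union> B) \<inter> (C \<union> D) = {}"
    for c d A a B b C g D h
  proof -
    let ?Y = "wp_merge (color_weight c) A B X"
    have m: "mergeable X A B" using ab by (force simp: mergeable_def)
    have Y: "?Y \<in> wpartitions n" by (rule wp_merge_wpartitions(1)[OF X m color_weight_le])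
    have eq: "?Y = insert (A \<union> B, a + b + color_weight c) (X - {(A, a), (B, b)})"
      by (rule wp_merge_eq[OF X ab(1,2)])
    have CDY: "(C, g) \<in> ?Y" "(D, h) \<in> ?Y" using gh ne eq by auto
    then have "C \<in> fst ` ?Y" "D \<in> fst ` ?Y" by force+
    then have "mergeable ?Y C D" using gh(3) by (simp add: mergeable_def)
    moreover have "A \<noteq> {}" using wp_merge_new(2)[OF X ab] .
    then have "A \<union> B \<noteq> C" "A \<union> B \<noteq> D" using disj by blast+
    ultimately show ?thesis
      using m wp_merge_eq[OF Y CDY, of "color_weight d"] by (auto simp: eq)
  qed
  note s1 = step[OF X ab gh(1,4) CD gh(2,3,5,6) disj]
  have "(C \<union> D) \<inter> (A \<union> B) = {}" using disj by blast
  note s2 = step[OF X gh(1,4) CD ab gh(2)[symmetric] gh(5)[symmetric] gh(3)[symmetric] gh(6)[symmetric] this]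
  show ?thesis
    by (rule that[OF ab(1,2) gh(1,4)]) (use s1[of c d] s2[of d c] in auto)
qed

text \<open>The two blocks merged first lie together in \<open>A \<union> B\<close> or in
  \<open>C \<union> D\<close>. They fill that block, so its weight fixes the color, and at most two
  inner elements remain.\<close>

lemma run_two_first:
  assumes X: "X \<in> wpartitions n" and v: "valid_merges X [(c, A, B), (d, C, D)]"
    and disj: "(A \<union> B) \<inter> (C \<union> D) = {}"
    and v': "valid_merges X [m, m']" and eq: "run X [m, m'] = run X [(c, A, B), (d, C, D)]"
  shows "apply_merge X m = apply_merge X (c, A, B) \<or> apply_merge X m = apply_merge X (d, C, D)"
proof -
  obtain e E F where m: "m = (e, E, F)" by (cases m)
  obtain a b g h where X4: "(A, a) \<in> X" "(B, b) \<in> X" "(C, g) \<in> X" "(D, h) \<in> X"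
    and Z: "run X [(c, A, B), (d, C, D)] = insert (A \<union> B, a + b + color_weight c)
      (insert (C \<union> D, g + h + color_weight d) (X - {(A, a), (B, b), (C, g), (D, h)}))"
    using run_two[OF X v disj] by metis
  let ?Y = "wp_merge (color_weight e) E F X"
  have EF: "mergeable X E F" using v' by (simp add: m)
  obtain x y where xy: "(E, x) \<in> X" "(F, y) \<in> X" "E \<noteq> F" using EF by (rule mergeableE)
  have Y: "?Y \<in> wpartitions n" by (rule wp_merge_wpartitions(1)[OF X EF color_weight_le])
  obtain q where q: "q \<in> run X [(c, A, B), (d, C, D)]" "E \<subseteq> fst q" "F \<subseteq> fst q" "weights_ok ?Y q"
    using first_merge_block[OF X v'[unfolded m]] eq[unfolded m] by metis
  have *: "apply_merge X m = apply_merge X (c, A, B)"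
    if X2: "(A, a) \<in> X" "(B, b) \<in> X" and qq: "q = (A \<union> B, a + b + color_weight c)" for c A a B b
  proof -
    have "(E, x) \<in> {(A, a), (B, b)}" "(F, y) \<in> {(A, a), (B, b)}"
      using sub_blocks[OF X, of "{(A, a), (B, b)}" "(E, x)"] sub_blocks[OF X, of "{(A, a), (B, b)}" "(F, y)"] X2 xy q(2,3)
      by (auto simp: qq)
    then have EFs: "(E = A \<and> x = a \<and> F = B \<and> y = b) \<or> (E = B \<and> x = b \<and> F = A \<and> y = a)" using xy(3) by auto
    have "E \<union> F = A \<union> B" "x + y = a + b" using EFs by auto
    then have "(A \<union> B, a + b + color_weight e) \<in> ?Y"
      using wp_merge_eq[OF X xy(1,2), of "color_weight e"] by simp
    from inside_self[OF Y this] have "color_weight e = color_weight c"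
      using q(4) by (simp add: weights_ok_def qq)
    then show ?thesis using EFs wp_merge_commute by (auto simp: m)
  qed
  have "q \<notin> X - {(A, a), (B, b), (C, g), (D, h)}"
  proof
    assume qX: "q \<in> X - {(A, a), (B, b), (C, g), (D, h)}"
    have "(E, x) \<in> {q}" "(F, y) \<in> {q}"
      using sub_blocks[OF X, of "{q}" "(E, x)"] sub_blocks[OF X, of "{q}" "(F, y)"] qX xy q(2,3) by auto
    then show False using xy(3) by auto
  qed
  then show ?thesis using q(1) *[OF X4(1,2)] *[OF X4(3,4)] unfolding Z by blast
qed

text \<open>When three blocks become one, the first merge takes one of three pairs, and its color
  has to be one of \<open>c\<close> and \<open>d\<close>. This leaves 3 candidates for
  \<open>c = d\<close> and 6 otherwise, the terms of the Jacobi identities.\<close>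

lemma run_three_first:
  assumes X: "X \<in> wpartitions n" and abc: "(A, a) \<in> X" "(B, b) \<in> X" "(C, g) \<in> X"
    and ne: "A \<noteq> B" "A \<noteq> C" "B \<noteq> C"
    and v': "valid_merges X [m, m']" and eq: "run X [m, m'] = run X [(c, A, B), (d, A \<union> B, C)]"
  shows "\<exists>c' d' A' B' C'. (c', d') \<in> {(c, d), (d, c)} \<and> (A', B', C') \<in> {(A, B, C), (A, C, B), (B, C, A)} \<and>
    apply_merge X m = apply_merge X (c', A', B') \<and>
    run X [(c', A', B'), (d', A' \<union> B', C')] = run X [(c, A, B), (d, A \<union> B, C)] \<and>
    valid_merges X [(c', A', B'), (d', A' \<union> B', C')]"
proof -
  obtain e E F where m: "m = (e, E, F)" by (cases m)
  note Z = run_three(2)[OF X abc ne, of c d]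
  let ?Y = "wp_merge (color_weight e) E F X"
  have EF: "mergeable X E F" using v' by (simp add: m)
  obtain x y where xy: "(E, x) \<in> X" "(F, y) \<in> X" "E \<noteq> F" using EF by (rule mergeableE)
  have Y: "?Y \<in> wpartitions n" by (rule wp_merge_wpartitions(1)[OF X EF color_weight_le])
  obtain q where q: "q \<in> run X [(c, A, B), (d, A \<union> B, C)]" "E \<subseteq> fst q" "F \<subseteq> fst q" "weights_ok ?Y q"
    using first_merge_block[OF X v'[unfolded m]] eq[unfolded m] by metis
  have "q \<notin> X - {(A, a), (B, b), (C, g)}"
  proof
    assume qX: "q \<in> X - {(A, a), (B, b), (C, g)}"
    have "(E, x) \<in> {q}" "(F, y) \<in> {q}"
      using sub_blocks[OF X, of "{q}" "(E, x)"] sub_blocks[OF X, of "{q}" "(F, y)"] qX xy q(2,3) by auto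
    then show False using xy(3) by auto
  qed
  then have qq: "q = (A \<union> B \<union> C, a + b + g + color_weight c + color_weight d)" using q(1) unfolding Z by blast
  have in3: "(E, x) \<in> {(A, a), (B, b), (C, g)}" "(F, y) \<in> {(A, a), (B, b), (C, g)}"
    by (rule sub_blocks[OF X]; use abc xy q(2,3) in \<open>auto simp: qq\<close>)+
  have *: ?thesis
    if abc': "(A', a') \<in> X" "(B', b') \<in> X" "(C', g') \<in> X" "A' \<noteq> B'" "A' \<noteq> C'" "B' \<noteq> C'"
      and perm: "(A', B', C') \<in> {(A, B, C), (A, C, B), (B, C, A)}"
        "{(A', a'), (B', b'), (C', g')} = {(A, a), (B, b), (C, g)}" "a' + b' + g' = a + b + g"
      and EF': "(E = A' \<and> F = B' \<and> x = a' \<and> y = b') \<or> (E = B' \<and> F = A' \<and> x = b' \<and> y = a')"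
    for A' a' B' b' C' g'
  proof -
    have U: "A' \<union> B' \<union> C' = A \<union> B \<union> C" using perm(1) by auto
    have ap: "apply_merge X m = apply_merge X (e, A', B')" using EF' wp_merge_commute by (auto simp: m)
    then have Yeq: "?Y = insert (A' \<union> B', a' + b' + color_weight e) (X - {(A', a'), (B', b')})"
      using wp_merge_eq[OF X abc'(1,2)] by (simp add: m)
    note N = wp_merge_new[OF X abc'(1,2,4)]
    have C'in: "(C', g') \<in> X - {(A', a'), (B', b')}" using abc' by auto
    have "A' \<union> B' \<noteq> C'" using N(4)[OF C'in] N(2) by auto
    have "{(A' \<union> B', a' + b' + color_weight e), (C', g')} = inside ?Y (A \<union> B \<union> C)"
      by (rule inside_eqI[OF Y]) (use Yeq C'in U in auto)
    \<comment> \<open>Two parts of \<open>q\<close> are left after the first merge, so the excess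
      that remains is 0 or 1.\<close>
    from this[symmetric] have w: "color_weight e \<le> color_weight c + color_weight d"
      "color_weight c + color_weight d \<le> color_weight e + 1"
      using q(4) \<open>A' \<union> B' \<noteq> C'\<close> perm(3) by (auto simp: weights_ok_def qq)
    have "\<exists>d'. (e, d') \<in> {(c, d), (d, c)}" using w by (cases c; cases d; cases e) auto
    then obtain d' where d': "(e, d') \<in> {(c, d), (d, c)}" by blast
    then have "color_weight e + color_weight d' = color_weight c + color_weight d" by auto
    then have "a' + b' + g' + color_weight e + color_weight d' = a + b + g + color_weight c + color_weight d"
      using perm(3) by simp
    then have "run X [(e, A', B'), (d', A' \<union> B', C')] = run X [(c, A, B), (d, A \<union> B, C)]"
      unfolding run_three(2)[OF X abc'] Z U perm(2) by simp
    then show ?thesis using d' perm(1) ap run_three(1)[OF X abc', of e d'] by blast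
  qed
  consider "(E = A \<and> F = B \<and> x = a \<and> y = b) \<or> (E = B \<and> F = A \<and> x = b \<and> y = a)"
    | "(E = A \<and> F = C \<and> x = a \<and> y = g) \<or> (E = C \<and> F = A \<and> x = g \<and> y = a)"
    | "(E = B \<and> F = C \<and> x = b \<and> y = g) \<or> (E = C \<and> F = B \<and> x = g \<and> y = b)"
    using in3 xy(3) by auto
  then show ?thesis
  proof cases
    case 1
    show ?thesis by (rule *[OF abc ne _ _ _ 1]) auto
  next
    case 2
    show ?thesis by (rule *[OF abc(1,3,2) ne(2,1) ne(3)[symmetric] _ _ _ 2]) auto
  next
    case 3
    show ?thesis by (rule *[OF abc(2,3,1) ne(3) ne(1)[symmetric] ne(2)[symmetric] _ _ _ 3]) auto
  qed
qed


lemma mset_two_last: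
  assumes "f \<in> set fs" "g \<in> set fs" "f \<noteq> g"
  obtains rest where "mset (rest @ [f, g]) = mset fs"
proof -
  obtain xs ys where xy: "fs = xs @ f # ys" using assms(1) by (meson split_list)
  then have "g \<in> set (xs @ ys)" using assms(2,3) by auto
  then obtain us vs where uv: "xs @ ys = us @ g # vs" by (meson split_list)
  have "mset fs = add_mset f (mset (xs @ ys))" unfolding xy by simp
  also have "\<dots> = mset ((us @ vs) @ [f, g])" unfolding uv by simp
  finally show ?thesis using that by metis
qed

definition support :: "merge \<Rightarrow> nat set" where
  "support m = fst (snd m) \<union> snd (snd m)"

lemma postorder_support: "m \<in> set (postorder t) \<Longrightarrow> support m \<subseteq> set (leaves t)"
  by (induction t) (auto simp: support_def)

text \<open>
  \<open>P\<close> stands for membership of a maximal chain in a submodule containing the coboundaries. Then any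
  term of a relation with unit coefficients is in it once the others are, whatever the signs.
\<close>

locale chain_closed =
  fixes n i :: nat and P :: "wpartition list \<Rightarrow> bool"
  assumes n: "1 \<le> n" "i \<le> n - 1"
    and closed: "\<And>W j. max_chain n i W \<Longrightarrow> 0 < j \<Longrightarrow> Suc j < length W \<Longrightarrow>
      (\<And>Y. Y \<in> wpartitions n \<Longrightarrow> wp_less (W ! (j - 1)) Y \<Longrightarrow> wp_less Y (W ! Suc j) \<Longrightarrow> Y \<noteq> W ! j \<Longrightarrow>
        P (W[j := Y])) \<Longrightarrow> P W"
begin

text \<open>Vacuous for sequences that are not full, so that rewriting does not have to carry
  validity along.\<close>

definition reached :: "merge list \<Rightarrow> bool" where
  "reached ms \<longleftrightarrow> (full_merges n i ms \<longrightarrow> P (merge_chain (wp_bot n) ms))"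

text \<open>The property \<open>closed\<close> in terms of merges: the elements of the rank two
  interval between \<open>X\<close> and \<open>Z\<close> are covers of \<open>X\<close> covered by
  \<open>Z\<close>, so each arises from a pair of merges with the same result.\<close>

lemma reached_replace:
  assumes f: "full_merges n i (pre @ [m1, m2] @ post)"
    and r: "\<And>m1' m2'. valid_merges (run (wp_bot n) pre) [m1', m2'] \<Longrightarrow>
      run (run (wp_bot n) pre) [m1', m2'] = run (run (wp_bot n) pre) [m1, m2] \<Longrightarrow>
      apply_merge (run (wp_bot n) pre) m1' \<noteq> apply_merge (run (wp_bot n) pre) m1 \<Longrightarrow>
      reached (pre @ [m1', m2'] @ post)"
  shows "reached (pre @ [m1, m2] @ post)"
proof -
  define X where "X = run (wp_bot n) pre"
  define Z where "Z = run X [m1, m2]"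
  have val: "valid_merges (wp_bot n) pre" "valid_merges X [m1, m2]" "valid_merges Z post"
    using f by (auto simp: full_merges_def valid_merges_append X_def Z_def simp flip: append_Cons)
  have fin: "run Z post = wp_top n i" using f by (simp add: full_merges_def X_def Z_def)
  have X: "X \<in> wpartitions n" using valid_merges_run[OF wp_bot_wpartitions(1) val(1)] by (simp add: X_def)
  have Z: "Z \<in> wpartitions n" "card Z + 2 = card X"
    using valid_merges_run[OF X val(2)] by (auto simp: Z_def)
  have chain: "merge_chain (wp_bot n) (pre @ [m1', m2'] @ post) =
      butlast (merge_chain (wp_bot n) pre) @ X # apply_merge X m1' # merge_chain Z post"
    if "run X [m1', m2'] = Z" for m1' m2'
    using that by (simp add: merge_chain_append merge_chain_Cons X_def)
  let ?W = "merge_chain (wp_bot n) (pre @ [m1, m2] @ post)"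
  let ?j = "Suc (length pre)"
  have lb: "length (butlast (merge_chain (wp_bot n) pre)) = length pre" by (simp add: merge_chain_length)
  have W: "?W = butlast (merge_chain (wp_bot n) pre) @ X # apply_merge X m1 # merge_chain Z post"
    by (rule chain) (simp add: Z_def)
  have nth: "?W ! (?j - 1) = X" "?W ! ?j = apply_merge X m1" "?W ! Suc ?j = Z"
    using lb merge_chain_nth[of 0 post Z] unfolding W by (simp_all add: nth_append)
  have "P ?W"
  proof (rule closed[where j = ?j])
    show "max_chain n i ?W" by (rule full_merges_max_chain[OF n f])
    show "Suc ?j < length ?W" by (simp add: merge_chain_length)
    fix Y assume Y: "Y \<in> wpartitions n" "wp_less (?W ! (?j - 1)) Y" "wp_less Y (?W ! Suc ?j)" "Y \<noteq> ?W ! ?j"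
    have XY: "wp_less X Y" and YZ: "wp_less Y Z" using Y(2,3) nth by simp_all
    have c: "card X \<le> card Y + 1" "card Y \<le> card Z + 1"
      using wp_less_card[OF X Y(1) XY] wp_less_card[OF Y(1) Z(1) YZ] Z(2) by auto
    obtain u A B where u: "u \<le> 1" "mergeable X A B" "Y = wp_merge u A B X"
      using wp_cover_merge[OF X Y(1) XY c(1)] by blast
    obtain u' A' B' where u': "u' \<le> 1" "mergeable Y A' B'" "Z = wp_merge u' A' B' Y"
      using wp_cover_merge[OF Y(1) Z(1) YZ c(2)] by blast
    obtain c c' where cc: "color_weight c = u" "color_weight c' = u'" using color_weight_surj u u' by metis
    let ?m1 = "(c, A, B)" and ?m2 = "(c', A', B')"
    have v: "valid_merges X [?m1, ?m2]" "run X [?m1, ?m2] = Z" "apply_merge X ?m1 = Y"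
      using u u' cc by auto
    have "reached (pre @ [?m1, ?m2] @ post)"
      by (rule r) (use v Y(4) nth(2) in \<open>simp_all add: X_def Z_def del: foldl_Cons valid_merges.simps\<close>)
    moreover have "full_merges n i (pre @ [?m1, ?m2] @ post)"
      using v val fin unfolding full_merges_def valid_merges_append foldl_append X_def[symmetric] by simp
    moreover have "?W[?j := Y] = merge_chain (wp_bot n) (pre @ [?m1, ?m2] @ post)"
      using chain[OF v(2)] lb v(3) unfolding W by (simp add: list_update_append)
    ultimately show "P (?W[?j := Y])" by (simp add: reached_def)
  qed simp
  then show ?thesis by (simp add: reached_def)
qed

lemma reached_cong:
  assumes "full_merges n i (pre @ ms @ post) \<Longrightarrow> full_merges n i (pre @ ms' @ post) \<and>
      merge_chain (wp_bot n) (pre @ ms @ post) = merge_chain (wp_bot n) (pre @ ms' @ post)"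
    "reached (pre @ ms' @ post)"
  shows "reached (pre @ ms @ post)"
  using assms by (auto simp: reached_def)

lemma reached_same:
  assumes "valid_merges (run (wp_bot n) pre) [m1, m2]"
    "run (run (wp_bot n) pre) [m1', m2'] = run (run (wp_bot n) pre) [m1, m2]"
    "apply_merge (run (wp_bot n) pre) m1' = apply_merge (run (wp_bot n) pre) m1"
    "reached (pre @ [m1, m2] @ post)"
  shows "reached (pre @ [m1', m2'] @ post)"
proof (rule reached_cong[OF _ assms(4)])
  assume f: "full_merges n i (pre @ [m1', m2'] @ post)"
  have r: "run (wp_bot n) (pre @ [m1', m2'] @ post) = run (wp_bot n) (pre @ [m1, m2] @ post)"
    using assms(2) by simp
  have "valid_merges (wp_bot n) (pre @ [m1, m2] @ post)"
    using f assms(1,2) unfolding full_merges_def valid_merges_append by simp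
  moreover have "merge_chain (wp_bot n) (pre @ [m1', m2'] @ post) = merge_chain (wp_bot n) (pre @ [m1, m2] @ post)"
    using assms(2,3) by (simp add: merge_chain_append merge_chain_Cons)
  ultimately show "full_merges n i (pre @ [m1, m2] @ post) \<and>
      merge_chain (wp_bot n) (pre @ [m1', m2'] @ post) = merge_chain (wp_bot n) (pre @ [m1, m2] @ post)"
    using f r by (simp add: full_merges_def)
qed

lemma state_wpartitions:
  assumes "full_merges n i (pre @ [m1, m2] @ post)"
  shows "run (wp_bot n) pre \<in> wpartitions n" "valid_merges (run (wp_bot n) pre) [m1, m2]"
proof -
  have v: "valid_merges (wp_bot n) pre" "valid_merges (run (wp_bot n) pre) ([m1, m2] @ post)"
    using assms unfolding full_merges_def valid_merges_append by blast+
  show "run (wp_bot n) pre \<in> wpartitions n"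
    using valid_merges_run[OF wp_bot_wpartitions(1) v(1)] by blast
  show "valid_merges (run (wp_bot n) pre) [m1, m2]"
    using v(2) unfolding valid_merges_append by blast
qed

text \<open>The only candidate for another inner element of the rank two interval is the one
  obtained by performing \<open>m'\<close> first.\<close>

lemma reached_swap:
  assumes disj: "support m \<inter> support m' = {}" and r: "reached (pre @ [m', m] @ post)"
  shows "reached (pre @ [m, m'] @ post)"
proof (cases "full_merges n i (pre @ [m, m'] @ post)")
  case False
  then show ?thesis by (simp add: reached_def)
next
  case f: True
  define X where "X = run (wp_bot n) pre"
  obtain c A B where m: "m = (c, A, B)" by (cases m)
  obtain d C D where m': "m' = (d, C, D)" by (cases m')
  have d: "(A \<union> B) \<inter> (C \<union> D) = {}" using disj by (simp add: support_def m m')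
  have X: "X \<in> wpartitions n" and v: "valid_merges X [(c, A, B), (d, C, D)]"
    using state_wpartitions[OF f] by (auto simp: X_def m m')
  have v2: "valid_merges X [m', m]" "run X [m', m] = run X [m, m']"
    using run_two[OF X v d] unfolding m m' by metis+
  show ?thesis
  proof (rule reached_replace[OF f])
    fix m1 m2
    assume a: "valid_merges (run (wp_bot n) pre) [m1, m2]"
      "run (run (wp_bot n) pre) [m1, m2] = run (run (wp_bot n) pre) [m, m']"
      "apply_merge (run (wp_bot n) pre) m1 \<noteq> apply_merge (run (wp_bot n) pre) m"
    then have "apply_merge X m1 = apply_merge X m'"
      using run_two_first[OF X v d, of m1 m2] by (simp add: X_def m m')
    then show "reached (pre @ [m1, m2] @ post)"
      using reached_same[of pre m' m m1 m2] v2 a r by (simp add: X_def)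
  qed
qed

lemma reached_flip:
  assumes "reached (pre @ [(c, B, A)] @ post)"
  shows "reached (pre @ [(c, A, B)] @ post)"
  by (rule reached_cong[OF _ assms])
    (auto simp: full_merges_def valid_merges_append merge_chain_append mergeable_def wp_merge_commute)

text \<open>By \<open>run_three_first\<close> the premise lists all inner elements; the triple
  excluded in it yields the present chain.\<close>

lemma reached_jacobi:
  assumes disj: "(A \<union> B) \<inter> C = {}"
    and r: "\<And>c' d' A' B' C'. (c', d') \<in> {(c, d), (d, c)} \<Longrightarrow> (A', B', C') \<in> {(A, B, C), (A, C, B), (B, C, A)} \<Longrightarrow>
      (c', A', B') \<noteq> (c, A, B) \<Longrightarrow> reached (pre @ [(c', A', B'), (d', A' \<union> B', C')] @ post)"
  shows "reached (pre @ [(c, A, B), (d, A \<union> B, C)] @ post)"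
proof (cases "full_merges n i (pre @ [(c, A, B), (d, A \<union> B, C)] @ post)")
  case False
  then show ?thesis by (simp add: reached_def)
next
  case f: True
  define X where "X = run (wp_bot n) pre"
  have X: "X \<in> wpartitions n" and v: "valid_merges X [(c, A, B), (d, A \<union> B, C)]"
    using state_wpartitions[OF f] by (auto simp: X_def)
  have mm: "mergeable X A B" "mergeable (wp_merge (color_weight c) A B X) (A \<union> B) C" using v by auto
  obtain a b where ab: "(A, a) \<in> X" "(B, b) \<in> X" "A \<noteq> B" using mm(1) by (rule mergeableE)
  have "\<not> A \<union> B \<subseteq> C" using wp_merge_new(2)[OF X ab] disj by blast
  then obtain g where g: "(C, g) \<in> X" "C \<noteq> A" "C \<noteq> B"
    using mergeable_wp_merge[OF X ab] mm(2) unfolding mergeable_def by metis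
  show ?thesis
  proof (rule reached_replace[OF f])
    fix m1 m2
    assume a: "valid_merges (run (wp_bot n) pre) [m1, m2]"
      "run (run (wp_bot n) pre) [m1, m2] = run (run (wp_bot n) pre) [(c, A, B), (d, A \<union> B, C)]"
      "apply_merge (run (wp_bot n) pre) m1 \<noteq> apply_merge (run (wp_bot n) pre) (c, A, B)"
    obtain c' d' A' B' C' where p: "(c', d') \<in> {(c, d), (d, c)}" "(A', B', C') \<in> {(A, B, C), (A, C, B), (B, C, A)}"
      "apply_merge X m1 = apply_merge X (c', A', B')"
      "run X [(c', A', B'), (d', A' \<union> B', C')] = run X [(c, A, B), (d, A \<union> B, C)]"
      "valid_merges X [(c', A', B'), (d', A' \<union> B', C')]"
      using run_three_first[OF X ab(1,2) g(1) ab(3) g(2)[symmetric] g(3)[symmetric] a(1,2)[folded X_def]]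
      by (elim exE conjE) (rule that)
    have "(c', A', B') \<noteq> (c, A, B)" using p(3) a(3)[folded X_def] by metis
    then have R: "reached (pre @ [(c', A', B'), (d', A' \<union> B', C')] @ post)" by (rule r[OF p(1,2)])
    show "reached (pre @ [m1, m2] @ post)"
      by (rule reached_same[OF p(5)[unfolded X_def] _ p(3)[unfolded X_def] R])
        (rule trans[OF a(2) p(4)[unfolded X_def, symmetric]])
  qed
qed

section \<open>From commuting merges to rewriting of trees\<close>

lemma reached_move_one:
  "\<forall>x \<in> set xs. support x \<inter> support y = {} \<Longrightarrow> reached (pre @ [y] @ xs @ post) \<Longrightarrow> reached (pre @ xs @ [y] @ post)"
proof (induction xs arbitrary: post rule: rev_induct)
  case (snoc x xs)
  have "reached (pre @ xs @ [y] @ [x] @ post)"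
    by (rule snoc.IH) (use snoc.prems in auto)
  then show ?case using reached_swap[of x y "pre @ xs" post] snoc.prems(1) by simp
qed simp

lemma reached_move:
  "\<forall>x \<in> set xs. \<forall>y \<in> set ys. support x \<inter> support y = {} \<Longrightarrow> reached (pre @ ys @ xs @ post) \<Longrightarrow>
    reached (pre @ xs @ ys @ post)"
proof (induction ys arbitrary: pre)
  case (Cons y ys)
  have "reached ((pre @ [y]) @ xs @ ys @ post)"
    by (rule Cons.IH) (use Cons.prems in auto)
  then show ?case using reached_move_one[of xs y pre "ys @ post"] Cons.prems(1) by simp
qed simp

lemma reached_move_trees:
  assumes "set (leaves l) \<inter> set (leaves r) = {}" "reached (pre @ postorder r @ postorder l @ post)"
  shows "reached (pre @ postorder l @ postorder r @ post)"
  by (rule reached_move[OF _ assms(2)]) (use postorder_support assms(1) in blast)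

lemma reached_move_merge:
  assumes "support m \<inter> set (leaves r) = {}"
  shows "reached (pre @ [m] @ postorder r @ post) \<longleftrightarrow> reached (pre @ postorder r @ [m] @ post)"
proof -
  have "\<forall>x \<in> set (postorder r). support x \<inter> support m = {}"
    "\<forall>x \<in> set (postorder r). support m \<inter> support x = {}" using postorder_support assms by blast+
  then show ?thesis
    using reached_move[of "[m]" "postorder r"] reached_move[of "postorder r" "[m]"] by auto
qed

text \<open>The merges of a subtree form a segment of the postorder, so \<open>pre\<close> and
  \<open>post\<close> are kept general and rewriting changes one segment. In the Jacobi case all
  merges inside \<open>A\<close>, \<open>B\<close> and \<open>C\<close> are moved in front, past
  merges with disjoint support, to make the two merges concerned adjacent.\<close>

lemma reached_rewr:
  "rewr t S \<Longrightarrow> distinct (leaves t) \<Longrightarrow> (\<And>s. s \<in> S \<Longrightarrow> reached (pre @ postorder s @ post)) \<Longrightarrow>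
    reached (pre @ postorder t @ post)"
proof (induction arbitrary: pre post rule: rewr.induct)
  case (swap c l r)
  have "reached (pre @ postorder r @ postorder l @ [(c, set (leaves r), set (leaves l))] @ post)"
    using swap(2) by simp
  then have "reached (pre @ postorder l @ postorder r @ [(c, set (leaves r), set (leaves l))] @ post)"
    by (rule reached_move_trees[rotated]) (use swap(1) in simp)
  then show ?case
    using reached_flip[of "pre @ postorder l @ postorder r" c "set (leaves r)" "set (leaves l)" post] by simp
next
  case (jacobi v u A B C)
  have d: "set (leaves A) \<inter> set (leaves B) = {}" "set (leaves A) \<inter> set (leaves C) = {}"
    "set (leaves B) \<inter> set (leaves C) = {}" using jacobi(1) by auto
  define pre' where "pre' = pre @ postorder A @ postorder B @ postorder C"
  have main: "reached (pre' @ [(u, set (leaves A), set (leaves B)), (v, set (leaves A) \<union> set (leaves B), set (leaves C))] @ post)"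
  proof (rule reached_jacobi)
    show "(set (leaves A) \<union> set (leaves B)) \<inter> set (leaves C) = {}" using d by blast
    fix u' v' A' B' C'
    assume uv: "(u', v') \<in> {(u, v), (v, u)}"
      and ABC: "(A', B', C') \<in> {(set (leaves A), set (leaves B), set (leaves C)),
        (set (leaves A), set (leaves C), set (leaves B)), (set (leaves B), set (leaves C), set (leaves A))}"
      and ne: "(u', A', B') \<noteq> (u, set (leaves A), set (leaves B))"
    obtain X Y Z where XYZ: "(X, Y, Z) \<in> {(A, B, C), (A, C, B), (B, C, A)}"
      "A' = set (leaves X)" "B' = set (leaves Y)" "C' = set (leaves Z)" using ABC by blast
    have "Node v' (Node u' X Y) Z \<in> jacobi_others u v A B C"
      using uv XYZ ne unfolding jacobi_others_def by blast
    then have "reached (pre @ postorder (Node v' (Node u' X Y) Z) @ post)" by (rule jacobi(2))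
    then have R: "reached ((pre @ postorder X @ postorder Y) @ [(u', A', B')] @ postorder Z @ [(v', A' \<union> B', C')] @ post)"
      by (simp add: XYZ)
    have "support (u', A', B') \<inter> set (leaves Z) = {}"
      using d XYZ(1) unfolding support_def XYZ(2-) by auto
    with R have S: "reached ((pre @ postorder X @ postorder Y) @ postorder Z @ [(u', A', B')] @ [(v', A' \<union> B', C')] @ post)"
      using reached_move_merge by blast
    consider "(X, Y, Z) = (A, B, C)" | "(X, Y, Z) = (A, C, B)" | "(X, Y, Z) = (B, C, A)" using XYZ(1) by blast
    then show "reached (pre' @ [(u', A', B'), (v', A' \<union> B', C')] @ post)"
    proof cases
      case 1
      then show ?thesis using S by (simp add: pre'_def)
    next
      case 2
      then have "reached ((pre @ postorder A) @ postorder B @ postorder C @ [(u', A', B'), (v', A' \<union> B', C')] @ post)"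
        using S by (simp add: reached_move_trees[OF d(3), of "pre @ postorder A", simplified])
      then show ?thesis by (simp add: pre'_def)
    next
      case 3
      then have "reached (pre @ postorder B @ postorder A @ postorder C @ [(u', A', B'), (v', A' \<union> B', C')] @ post)"
        using S d(2) reached_move_trees[of A C "pre @ postorder B"] by simp
      then have "reached (pre @ postorder A @ postorder B @ postorder C @ [(u', A', B'), (v', A' \<union> B', C')] @ post)"
        by (rule reached_move_trees[OF d(1)])
      then show ?thesis by (simp add: pre'_def)
    qed
  qed
  have "support (u, set (leaves A), set (leaves B)) \<inter> set (leaves C) = {}" using d unfolding support_def by auto
  from reached_move_merge[OF this, of "pre @ postorder A @ postorder B"] main
  show ?case by (simp add: pre'_def)
next
  case (left t S c r)
  have "reached (pre @ postorder t @ (postorder r @ [(c, set (leaves t), set (leaves r))] @ post))"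
  proof (rule left.IH)
    show "distinct (leaves t)" using left.prems(1) by simp
    fix s assume s: "s \<in> S"
    then have "set (leaves s) = set (leaves t)" using rewr_invariant[OF left.hyps s] by (metis set_mset_mset)
    then show "reached (pre @ postorder s @ (postorder r @ [(c, set (leaves t), set (leaves r))] @ post))"
      using left.prems(2)[of "Node c s r"] s by simp
  qed
  then show ?case by simp
next
  case (right t S c l)
  have "reached ((pre @ postorder l) @ postorder t @ [(c, set (leaves l), set (leaves t))] @ post)"
  proof (rule right.IH)
    show "distinct (leaves t)" using right.prems(1) by simp
    fix s assume s: "s \<in> S"
    then have "set (leaves s) = set (leaves t)" using rewr_invariant[OF right.hyps s] by (metis set_mset_mset)
    then show "reached ((pre @ postorder l) @ postorder s @ [(c, set (leaves l), set (leaves t))] @ post)"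
      using right.prems(2)[of "Node c l s"] s by simp
  qed
  then show ?case by simp
qed

section \<open>Arranging a merge sequence as the postorder of a tree\<close>

lemma reached_reorder:
  assumes "mset fs = mset gs" "distinct (concat (map leaves fs))" "reached (concat (map postorder fs) @ post)"
  shows "reached (concat (map postorder gs) @ post)"
proof -
  define Q where "Q hs \<longleftrightarrow> (distinct (concat (map leaves hs)) \<and> reached (concat (map postorder hs) @ post))" for hs
  have "Q ([] @ gs)"
  proof (rule perm_adjacent[of Q "[]" fs])
    fix xs a b ys assume q: "Q (xs @ a # b # ys)"
    then have "distinct (concat (map leaves (xs @ b # a # ys)))" by (auto simp: Q_def)
    moreover have "set (leaves b) \<inter> set (leaves a) = {}" using q by (auto simp: Q_def)
    then have "reached (concat (map postorder (xs @ b # a # ys)) @ post)"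
      using q reached_move_trees[of b a "concat (map postorder xs)"] by (simp add: Q_def)
    ultimately show "Q (xs @ b # a # ys)" by (simp add: Q_def)
  qed (use assms in \<open>simp_all add: Q_def\<close>)
  then show ?thesis by (simp add: Q_def)
qed

definition forest_state :: "btree list \<Rightarrow> wpartition" where
  "forest_state fs = (\<lambda>f. (set (leaves f), red_count f)) ` set fs"

text \<open>A merge sequence builds a forest with one tree for each current block, the number of red
  nodes being the weight. Merges in different trees have disjoint supports, so they can be sorted
  into consecutive postorders; the two trees joined by the next merge are brought to the end
  first.\<close>

lemma merges_forest:
  "valid_merges (wp_bot n) ms \<Longrightarrow> \<exists>fs. distinct (concat (map leaves fs)) \<and> run (wp_bot n) ms = forest_state fs \<and>
    (\<forall>post. reached (concat (map postorder fs) @ post) \<longrightarrow> reached (ms @ post))"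
proof (induction ms rule: rev_induct)
  case Nil
  let ?fs = "map Leaf [1..<Suc n]"
  have "concat (map leaves ?fs) = [1..<Suc n]" "concat (map postorder ?fs) = []"
    by (simp_all add: o_def del: upt_Suc)
  moreover have "wp_bot n = forest_state ?fs"
    by (force simp: wp_bot_def forest_state_def image_image)
  ultimately show ?case
    by (intro exI[of _ ?fs]) (simp only: distinct_upt append_Nil foldl_Nil simp_thms)
next
  case (snoc m ms)
  obtain c A B where m: "m = (c, A, B)" by (cases m)
  have v: "valid_merges (wp_bot n) ms" "mergeable (run (wp_bot n) ms) A B"
    using snoc.prems by (auto simp: valid_merges_append m)
  have X: "run (wp_bot n) ms \<in> wpartitions n"
    using valid_merges_run[OF wp_bot_wpartitions(1) v(1)] by simp
  obtain fs where fs: "distinct (concat (map leaves fs))" "run (wp_bot n) ms = forest_state fs"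
    "\<And>post. reached (concat (map postorder fs) @ post) \<Longrightarrow> reached (ms @ post)"
    using snoc.IH[OF v(1)] by blast
  have "A \<noteq> B" "A \<in> fst ` forest_state fs" "B \<in> fst ` forest_state fs"
    using v(2) by (simp_all add: mergeable_def fs(2))
  then obtain f g where fg: "f \<in> set fs" "g \<in> set fs" "A = set (leaves f)" "B = set (leaves g)" "A \<noteq> B"
    unfolding forest_state_def image_image fst_conv by blast
  have "f \<noteq> g" using fg by blast
  then obtain rest where ms: "mset (rest @ [f, g]) = mset fs" using mset_two_last fg(1,2) by metis
  have dist: "distinct (concat (map leaves (rest @ [f, g])))"
  proof -
    have "mset (concat (map leaves hs)) = sum_mset (image_mset (mset \<circ> leaves) (mset hs))" for hs
      by (induction hs) auto
    then have "mset (concat (map leaves (rest @ [f, g]))) = mset (concat (map leaves fs))"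
      using ms by metis
    then show ?thesis using fs(1) mset_eq_imp_distinct_iff by blast
  qed
  let ?fs = "rest @ [Node c f g]"
  have "set fs = set (rest @ [f, g])" by (metis ms set_mset_mset)
  then have sfs: "set fs = set rest \<union> {f, g}" by simp
  have st: "run (wp_bot n) (ms @ [m]) = forest_state ?fs"
  proof -
    have fgX: "(A, red_count f) \<in> run (wp_bot n) ms" "(B, red_count g) \<in> run (wp_bot n) ms"
      using fg unfolding fs(2) forest_state_def by auto
    have "\<forall>h \<in> set rest. set (leaves h) \<inter> set (leaves f) = {} \<and> set (leaves h) \<inter> set (leaves g) = {}"
      using dist by auto
    then have "(A, x) \<notin> forest_state rest" "(B, x) \<notin> forest_state rest" for x
      using valency_in[of f] valency_in[of g] unfolding forest_state_def fg(3,4) by blast+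
    moreover have "run (wp_bot n) ms = insert (A, red_count f) (insert (B, red_count g) (forest_state rest))"
      unfolding fs(2) forest_state_def sfs fg(3,4) by blast
    ultimately have "run (wp_bot n) ms - {(A, red_count f), (B, red_count g)} = forest_state rest" by auto
    then show ?thesis
      using wp_merge_eq[OF X fgX, of "color_weight c"] fg(3,4)
      by (cases c) (simp_all add: m forest_state_def ac_simps)
  qed
  have "reached ((ms @ [m]) @ post)" if "reached (concat (map postorder ?fs) @ post)" for post
  proof -
    have "reached (concat (map postorder (rest @ [f, g])) @ ([m] @ post))" using that by (simp add: m fg(3,4))
    then have "reached (concat (map postorder fs) @ ([m] @ post))" by (rule reached_reorder[OF ms dist])
    then show ?thesis using fs(3)[of "[m] @ post"] by simp
  qed
  then show ?case using st dist by (intro exI[of _ ?fs]) simp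
qed

lemma full_merges_tree:
  assumes "full_merges n i ms"
  obtains t where "t \<in> bicolored_trees n i" "reached (postorder t) \<Longrightarrow> reached ms"
proof -
  obtain fs where fs: "distinct (concat (map leaves fs))" "run (wp_bot n) ms = forest_state fs"
    "\<And>post. reached (concat (map postorder fs) @ post) \<Longrightarrow> reached (ms @ post)"
    using merges_forest assms unfolding full_merges_def by blast
  have top: "forest_state fs = {({1..n}, i)}" using fs(2) assms by (simp add: full_merges_def wp_top_def)
  have "fs \<noteq> []" using top by (auto simp: forest_state_def)
  then obtain t gs where t: "fs = t # gs" by (cases fs) auto
  have "gs = []"
  proof (cases gs)
    case (Cons g gs')
    then have "set (leaves t) = set (leaves g)" using top t by (auto simp: forest_state_def)
    then have False using fs(1) leaves_nonempty[of g] t Cons by auto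
    then show ?thesis ..
  qed simp
  then show ?thesis using that[of t] fs(1) fs(3)[of "[]"] top t
    by (simp add: bicolored_trees_def forest_state_def)
qed

theorem max_chain_reached:
  assumes liu: "\<And>t. t \<in> liu_trees n i \<Longrightarrow> reached (postorder t)" and W: "max_chain n i W"
  shows "P W"
proof -
  obtain ms where ms: "full_merges n i ms" "W = merge_chain (wp_bot n) ms"
    using max_chain_full_merges[OF n W] by blast
  obtain t where t: "t \<in> bicolored_trees n i" "reached (postorder t) \<Longrightarrow> reached ms"
    using full_merges_tree[OF ms(1)] by blast
  have "generated (liu_on {1..n}) t"
    using liu_trees_generate[of t] t(1) by (simp add: bicolored_trees_def)
  then have "t \<in> bicolored_trees n i \<Longrightarrow> reached (postorder t)"
  proof induction
    case (base t)
    then show ?case by (intro liu) (simp add: liu_on_def liu_trees_def)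
  next
    case (rewrite t S)
    have "s \<in> bicolored_trees n i" if "s \<in> S" for s
      using rewr_invariant[OF rewrite(1) that] rewrite.prems unfolding bicolored_trees_def
      by (metis (mono_tags, lifting) mem_Collect_eq mset_eq_imp_distinct_iff set_mset_mset)
    then show ?case
      using reached_rewr[OF rewrite(1), of "[]" "[]"] rewrite by (simp add: bicolored_trees_def)
  qed
  then have "reached ms" using t by blast
  then show ?thesis using ms by (simp add: reached_def)
qed

end

section \<open>Chains of trees inside the Boolean algebra of a rooted tree\<close>

lemma rooted_treeD:
  assumes "rooted_tree V T"
  obtains r where "r \<in> V" "T \<subseteq> V \<times> V" "\<And>p. (p, r) \<notin> T" "\<And>c. c \<in> V \<Longrightarrow> c \<noteq> r \<Longrightarrow> \<exists>!p. (p, c) \<in> T"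
    "\<And>c. c \<in> V \<Longrightarrow> (r, c) \<in> T\<^sup>*"
proof -
  obtain r where "r \<in> V" "(\<forall>p. (p, r) \<notin> T) \<and> (\<forall>c \<in> V - {r}. \<exists>!p. (p, c) \<in> T) \<and> (\<forall>c \<in> V. (r, c) \<in> T\<^sup>*)"
    "T \<subseteq> V \<times> V" using assms unfolding rooted_tree_def by blast
  then show ?thesis by (intro that[of r]) simp_all
qed

lemma rooted_tree_parent_unique:
  "rooted_tree V T \<Longrightarrow> (p, c) \<in> T \<Longrightarrow> (q, c) \<in> T \<Longrightarrow> p = q"
  by (erule rooted_treeD) blast

lemma rooted_tree_acyclic:
  assumes "rooted_tree V T"
  shows "acyclic T"
proof -
  obtain r where r: "r \<in> V" "T \<subseteq> V \<times> V" "\<And>p. (p, r) \<notin> T" "\<And>c. c \<in> V \<Longrightarrow> (r, c) \<in> T\<^sup>*"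
    using assms by (rule rooted_treeD) blast
  have "(c, c) \<notin> T\<^sup>+" if "(r, c) \<in> T\<^sup>*" for c
    using that
  proof (induction rule: rtrancl_induct)
    case base
    show ?case using r(3) by (meson tranclE)
  next
    case (step y z)
    show ?case
    proof
      assume "(z, z) \<in> T\<^sup>+"
      then obtain p where p: "(z, p) \<in> T\<^sup>*" "(p, z) \<in> T" by (meson tranclD2)
      then have "p = y" using rooted_tree_parent_unique[OF assms] step(2) by blast
      then have "(y, y) \<in> T\<^sup>+" using p step(2) by auto
      then show False using step.IH by blast
    qed
  qed
  moreover have "c \<in> V" if "(c, c) \<in> T\<^sup>+" for c
    using that r(2) by (meson SigmaD1 subsetD tranclD)
  ultimately show ?thesis using r(4) unfolding acyclic_def by blast
qed

text \<open>Along an undirected path, a step up either retraces the last edge of the descent from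
  \<open>z\<close>, as parents are unique, or starts at \<open>z\<close> itself, whose parent then
  takes over.\<close>

lemma common_ancestor:
  assumes uniq: "\<And>p q c. (p, c) \<in> E \<Longrightarrow> (q, c) \<in> E \<Longrightarrow> p = q"
  shows "(x, y) \<in> (E \<union> E\<inverse>)\<^sup>* \<Longrightarrow> \<exists>z. (z, x) \<in> E\<^sup>* \<and> (z, y) \<in> E\<^sup>*"
proof (induction rule: rtrancl_induct)
  case (step y y')
  then obtain z where z: "(z, x) \<in> E\<^sup>*" "(z, y) \<in> E\<^sup>*" by blast
  show ?case
  proof (cases "(y, y') \<in> E")
    case True
    then show ?thesis using z by (meson rtrancl.rtrancl_into_rtrancl)
  next
    case False
    then have p: "(y', y) \<in> E" using step(2) by blast
    from z(2) show ?thesis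
    proof (cases rule: rtranclE)
      case base
      then show ?thesis using p z(1) by (meson converse_rtrancl_into_rtrancl rtrancl.rtrancl_refl)
    next
      case (step w)
      then have "w = y'" using uniq p by blast
      then show ?thesis using step z(1) by blast
    qed
  qed
qed blast

section \<open>Components of subforests\<close>

definition linked :: "nat \<Rightarrow> (nat \<times> nat) set \<Rightarrow> (nat \<times> nat) set" where
  "linked n E = {(u, v) \<in> {1..n} \<times> {1..n}. (u, v) \<in> (E \<union> E\<inverse>)\<^sup>*}"

lemma equiv_linked: "equiv {1..n} (linked n E)"
proof (rule equivI)
  show "linked n E \<subseteq> {1..n} \<times> {1..n}" by (auto simp: linked_def)
  show "refl_on {1..n} (linked n E)" by (auto simp: linked_def refl_on_def)
  have "sym ((E \<union> E\<inverse>)\<^sup>*)" by (rule sym_rtrancl) (auto simp: sym_def)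
  then show "sym (linked n E)" by (auto simp: linked_def sym_def)
  show "trans (linked n E)" by (auto simp: linked_def trans_def)
qed

lemma components_linked: "components n E = {1..n} // linked n E"
  by (simp add: components_def linked_def)

lemma component_props:
  assumes "S \<in> components n E" "E \<subseteq> {1..n} \<times> {1..n}"
  shows "S \<subseteq> {1..n}" "S \<noteq> {}" "u \<in> S \<Longrightarrow> v \<in> S \<Longrightarrow> (u, v) \<in> (E \<union> E\<inverse>)\<^sup>*"
    "(u, v) \<in> E \<Longrightarrow> u \<in> S \<longleftrightarrow> v \<in> S"
proof -
  note Q = assms(1)[unfolded components_linked]
  show "S \<subseteq> {1..n}" using in_quotient_imp_subset[OF equiv_linked Q] .
  show "S \<noteq> {}" using in_quotient_imp_non_empty[OF equiv_linked Q] .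
  show "u \<in> S \<Longrightarrow> v \<in> S \<Longrightarrow> (u, v) \<in> (E \<union> E\<inverse>)\<^sup>*"
    using quotient_eq_iff[OF equiv_linked Q Q] by (auto simp: linked_def)
  assume e: "(u, v) \<in> E"
  then have "(u, v) \<in> linked n E" "(v, u) \<in> linked n E" using assms(2) by (auto simp: linked_def)
  then show "u \<in> S \<longleftrightarrow> v \<in> S" using in_quotient_imp_closed[OF equiv_linked Q] by blast
qed

text \<open>A component is an induced subtree of \<open>T\<close>. An edge of \<open>T\<close>
  inside \<open>S\<close> cannot end at the root of \<open>S\<close>, as this would close a cycle;
  its end therefore has a parent in \<open>E\<close>, and by uniqueness of parents the edge is in
  \<open>E\<close>.\<close>

lemma component_rooted:
  assumes T: "rooted_tree {1..n} T" and E: "E \<subseteq> T" and S: "S \<in> components n E"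
  shows "rooted_tree S (T \<inter> S \<times> S)" "descents (T \<inter> S \<times> S) = S \<inter> descents E"
proof -
  have TV: "T \<subseteq> {1..n} \<times> {1..n}" using T by (simp add: rooted_tree_def)
  then have EV: "E \<subseteq> {1..n} \<times> {1..n}" using E by blast
  note C = component_props[OF S EV]
  have uniq: "(p, c) \<in> T \<Longrightarrow> (q, c) \<in> T \<Longrightarrow> p = q" for p q c by (rule rooted_tree_parent_unique[OF T])
  have finT: "finite T" using TV finite_subset by blast
  have acT: "acyclic T" by (rule rooted_tree_acyclic[OF T])
  have "wf E" using finite_acyclic_wf[of E] finT acT E by (meson acyclic_subset finite_subset)
  then obtain r where r: "r \<in> S" "\<And>p. (p, r) \<in> E \<Longrightarrow> p \<notin> S" using C(2) by (metis wfE_min ex_in_conv)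
  have rE: "(p, r) \<notin> E" for p using r C(4) by blast
  \<comment> \<open>A common ancestor of \<open>r\<close> and \<open>x\<close> has to be
    \<open>r\<close>, which has no parent in \<open>E\<close>.\<close>
  have reach: "(r, x) \<in> (E \<inter> S \<times> S)\<^sup>*" if x: "x \<in> S" for x
  proof -
    have "\<exists>z. (z, r) \<in> E\<^sup>* \<and> (z, x) \<in> E\<^sup>*"
      by (rule common_ancestor) (use uniq E C(3)[OF r(1) x] in blast)+
    then have "(r, x) \<in> E\<^sup>*" using rE by (metis rtranclE)
    then show ?thesis
    proof (induction rule: rtrancl_induct)
      case (step y z)
      have "y \<in> S" using step(1) r(1) by (induction rule: rtrancl_induct) (use C(4) in blast)+
      then show ?case using step C(4) by (meson IntI SigmaI rtrancl.rtrancl_into_rtrancl)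
    qed simp
  qed
  have eq: "T \<inter> S \<times> S = E \<inter> S \<times> S"
  proof
    show "T \<inter> S \<times> S \<subseteq> E \<inter> S \<times> S"
    proof
      fix e assume e: "e \<in> T \<inter> S \<times> S"
      then obtain p c where pc: "e = (p, c)" "(p, c) \<in> T" "p \<in> S" "c \<in> S" by blast
      have mono: "(E \<inter> S \<times> S)\<^sup>* \<subseteq> T\<^sup>*" by (rule rtrancl_mono) (use E in blast)
      have "c \<noteq> r"
      proof
        assume "c = r"
        then have "(r, r) \<in> T\<^sup>+" using reach[OF pc(3)] mono pc(2) by (meson rtrancl_into_trancl1 subsetD)
        then show False using acT by (simp add: acyclic_def)
      qed
      then obtain q where "(q, c) \<in> E \<inter> S \<times> S" using reach[OF pc(4)] by (metis rtranclE)
      then show "e \<in> E \<inter> S \<times> S" using uniq pc E by blast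
    qed
  qed (use E in blast)
  have "\<exists>!p. (p, c) \<in> E \<inter> S \<times> S" if c: "c \<in> S - {r}" for c
  proof -
    obtain p where "(p, c) \<in> E \<inter> S \<times> S" using reach c by (metis DiffD1 DiffD2 rtranclE singletonI)
    then show ?thesis using uniq E by blast
  qed
  then show "rooted_tree S (T \<inter> S \<times> S)"
    unfolding rooted_tree_def eq using r(1) rE reach by (intro conjI bexI[of _ r]) blast+
  show "descents (T \<inter> S \<times> S) = S \<inter> descents E" unfolding eq descents_def using C(4) by blast
qed

section \<open>From connected subtrees to a fit\<close>

fun subtrees :: "btree \<Rightarrow> btree set" where
  "subtrees (Leaf a) = {Leaf a}"
| "subtrees (Node c l r) = insert (Node c l r) (subtrees l \<union> subtrees r)"

lemma self_subtree: "t \<in> subtrees t"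
  by (cases t) auto

text \<open>Both halves are subtrees of \<open>T\<close> with one root each, and their union has a
  single root. So exactly one of the two roots has its parent in the other half, which gives the
  edge across the node; counting descents gives its color.\<close>

lemma fits_if_subtrees_connected:
  assumes "distinct (leaves t)"
    "\<And>s. s \<in> subtrees t \<Longrightarrow> rooted_tree (set (leaves s)) (T \<inter> set (leaves s) \<times> set (leaves s)) \<and>
      card (descents (T \<inter> set (leaves s) \<times> set (leaves s))) = red_count s"
  shows "\<exists>w. fits t w (T \<inter> set (leaves t) \<times> set (leaves t))"
  using assms
proof (induction t)
  case (Leaf a)
  have "rooted_tree {a} (T \<inter> {a} \<times> {a})" using Leaf(2)[of "Leaf a"] by simp
  then have "T \<inter> {a} \<times> {a} = {}" by (auto simp: rooted_tree_def)
  then show ?case using fits.leaf by auto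
next
  case (Node c l r)
  let ?A = "set (leaves l)" and ?B = "set (leaves r)"
  let ?F = "T \<inter> ?A \<times> ?A" and ?G = "T \<inter> ?B \<times> ?B" and ?H = "T \<inter> (?A \<union> ?B) \<times> (?A \<union> ?B)"
  have d: "?A \<inter> ?B = {}" and dist: "distinct (leaves l)" "distinct (leaves r)" using Node.prems(1) by auto
  obtain u where u: "fits l u ?F" using Node.IH(1)[OF dist(1)] Node.prems(2) by auto
  obtain v where v: "fits r v ?G" using Node.IH(2)[OF dist(2)] Node.prems(2) by auto
  have uA: "u \<in> ?A" and vB: "v \<in> ?B" using fits_subset[OF u] fits_subset[OF v] by auto
  have H: "rooted_tree (?A \<union> ?B) ?H" "card (descents ?H) = red_count (Node c l r)"
    using Node.prems(2)[OF self_subtree] by simp_all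
  obtain w where w: "w \<in> ?A \<union> ?B" "\<And>p. (p, w) \<notin> ?H" "\<And>c. c \<in> ?A \<union> ?B \<Longrightarrow> c \<noteq> w \<Longrightarrow> \<exists>!p. (p, c) \<in> ?H"
    using H(1) by (rule rooted_treeD) blast
  have uniq: "(p, x) \<in> ?H \<Longrightarrow> (q, x) \<in> ?H \<Longrightarrow> p = q" for p q x by (rule rooted_tree_parent_unique[OF H(1)])
  have parA: "\<exists>p. (p, x) \<in> ?F" if "x \<in> ?A" "x \<noteq> u" for x
    using fits_rooted[OF u dist(1)] that by blast
  have parB: "\<exists>p. (p, x) \<in> ?G" if "x \<in> ?B" "x \<noteq> v" for x
    using fits_rooted[OF v dist(2)] that by blast
  have noA: "(p, u) \<notin> ?F" and noB: "(p, v) \<notin> ?G" for p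
    using fits_rooted[OF u dist(1)] fits_rooted[OF v dist(2)] by blast+
  have split: "?H = insert (p, x) (?F \<union> ?G)"
    if p: "(p, x) \<in> ?H" and all: "\<And>y. y \<in> ?A \<union> ?B \<Longrightarrow> y \<noteq> w \<Longrightarrow> y \<noteq> x \<Longrightarrow> \<exists>q. (q, y) \<in> ?F \<union> ?G" for p x
  proof
    show "?H \<subseteq> insert (p, x) (?F \<union> ?G)"
    proof
      fix e assume "e \<in> ?H"
      then obtain q y where qy: "e = (q, y)" "(q, y) \<in> ?H" by (metis surj_pair)
      show "e \<in> insert (p, x) (?F \<union> ?G)"
      proof (cases "y = x")
        case True
        then show ?thesis using uniq[OF p] qy by blast
      next
        case False
        moreover have "y \<noteq> w" "y \<in> ?A \<union> ?B" using w(2) qy(2) by blast+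
        ultimately obtain q' where q': "(q', y) \<in> ?F \<union> ?G" using all by blast
        then have "q' = q" using uniq[OF _ qy(2)] by blast
        then show ?thesis using q' qy(1) by blast
      qed
    qed
  qed (use p in blast)
  have "w = u \<or> w = v" using w(1,2) parA[of w] parB[of w] by blast
  then have "\<exists>c'. fits (Node c' l r) w ?H"
  proof
    assume wu: "w = u"
    then have "v \<noteq> w" using uA vB d by blast
    then obtain p where p: "(p, v) \<in> ?H" using w(3)[of v] vB by blast
    then have "p \<in> ?A \<union> ?B" by blast
    moreover have "p \<notin> ?B" using noB[of p] p vB by simp
    ultimately have pA: "p \<in> ?A" by simp
    have "?H = insert (p, v) (?F \<union> ?G)" by (rule split[OF p]) (use parA parB wu in blast)
    moreover have "fits (Node (if v < p then Red else Blue) l r) u (insert (p, v) (?F \<union> ?G))"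
      by (rule fits.keep_left[OF u v pA]) simp
    ultimately show ?thesis using wu by metis
  next
    assume wv: "w = v"
    then have "u \<noteq> w" using uA vB d by blast
    then obtain p where p: "(p, u) \<in> ?H" using w(3)[of u] uA by blast
    then have "p \<in> ?A \<union> ?B" by blast
    moreover have "p \<notin> ?A" using noA[of p] p uA by simp
    ultimately have pB: "p \<in> ?B" by simp
    have "?H = insert (p, u) (?F \<union> ?G)" by (rule split[OF p]) (use parA parB wv in blast)
    moreover have "fits (Node (if u < p then Red else Blue) l r) v (insert (p, u) (?F \<union> ?G))"
      by (rule fits.keep_right[OF u v pB]) simp
    ultimately show ?thesis using wv by metis
  qed
  then obtain c' where c': "fits (Node c' l r) w ?H" by blast
  have "card (descents ?H) = red_count (Node c' l r)"
    using fits_descents[OF c'] Node.prems(1) by simp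
  then have "c' = c" using H(2) by (cases c; cases c') auto
  then show ?case using c' by auto
qed

text \<open>The last conjunct serves the comparison with rooted trees: every subtree occurs as a
  block of some element of the chain, weighted by its number of red nodes.\<close>

lemma run_postorder:
  assumes "X \<in> wpartitions n" "distinct (leaves t)" "\<And>a. a \<in> set (leaves t) \<Longrightarrow> ({a}, 0) \<in> X"
  shows "valid_merges X (postorder t) \<and>
    run X (postorder t) = insert (set (leaves t), red_count t) (X - (\<lambda>a. ({a}, 0)) ` set (leaves t)) \<and>
    (\<forall>s \<in> subtrees t. \<exists>Y \<in> set (merge_chain X (postorder t)). (set (leaves s), red_count s) \<in> Y)"
  using assms
proof (induction t arbitrary: X)
  case (Leaf a)
  then show ?case by auto
next
  case (Node c l r)
  let ?L = "(\<lambda>a. ({a}, 0 :: nat)) ` set (leaves l)" and ?R = "(\<lambda>a. ({a}, 0 :: nat)) ` set (leaves r)"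
  have d: "set (leaves l) \<inter> set (leaves r) = {}" and dist: "distinct (leaves l)" "distinct (leaves r)"
    using Node.prems(2) by auto
  define Y where "Y = run X (postorder l)"
  define Z where "Z = run Y (postorder r)"
  have L: "valid_merges X (postorder l)" "Y = insert (set (leaves l), red_count l) (X - ?L)"
    "\<forall>s \<in> subtrees l. \<exists>Y \<in> set (merge_chain X (postorder l)). (set (leaves s), red_count s) \<in> Y"
    using Node.IH(1)[OF Node.prems(1) dist(1) Node.prems(3)] unfolding Y_def by simp_all
  have Y: "Y \<in> wpartitions n" using valid_merges_run[OF Node.prems(1) L(1)] by (simp add: Y_def)
  have inY: "({a}, 0) \<in> Y" if "a \<in> set (leaves r)" for a
    using Node.prems(3)[of a] that d unfolding L(2) by auto
  have R: "valid_merges Y (postorder r)" "Z = insert (set (leaves r), red_count r) (Y - ?R)"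
    "\<forall>s \<in> subtrees r. \<exists>Z \<in> set (merge_chain Y (postorder r)). (set (leaves s), red_count s) \<in> Z"
    using Node.IH(2)[OF Y dist(2) inY] unfolding Z_def by simp_all
  have Z: "Z \<in> wpartitions n" using valid_merges_run[OF Y R(1)] by (simp add: Z_def)
  have lr: "(set (leaves l), red_count l) \<in> Z" "(set (leaves r), red_count r) \<in> Z" "set (leaves l) \<noteq> set (leaves r)"
    using R(2) L(2) d valency_in[of l] by auto
  have "set (leaves l) \<in> fst ` Z" "set (leaves r) \<in> fst ` Z" using lr(1,2) by force+
  then have m: "mergeable Z (set (leaves l)) (set (leaves r))" using lr(3) by (simp add: mergeable_def)
  have run: "run X (postorder (Node c l r)) = wp_merge (color_weight c) (set (leaves l)) (set (leaves r)) Z"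
    by (simp add: Y_def Z_def)
  have val: "valid_merges X (postorder (Node c l r))"
    using L(1) R(1) m by (simp add: valid_merges_append Y_def Z_def)
  have lX: "(set (leaves l), red_count l) \<notin> X - ?L - ?R"
  proof
    assume a: "(set (leaves l), red_count l) \<in> X - ?L - ?R"
    have "valency l \<in> set (leaves l)" by (rule valency_in)
    moreover have "({valency l}, 0) \<in> X" using Node.prems(3)[of "valency l"] valency_in[of l] by simp
    ultimately have "(set (leaves l), red_count l) = ({valency l}, 0)"
      using block_unique[OF Node.prems(1), of "(set (leaves l), red_count l)" "({valency l}, 0)" "valency l"] a by auto
    then show False using a valency_in[of l] by auto
  qed
  have rX: "(set (leaves r), red_count r) \<notin> X - ?L - ?R"
  proof
    assume a: "(set (leaves r), red_count r) \<in> X - ?L - ?R"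
    have "valency r \<in> set (leaves r)" by (rule valency_in)
    moreover have "({valency r}, 0) \<in> X" using Node.prems(3)[of "valency r"] valency_in[of r] by simp
    ultimately have "(set (leaves r), red_count r) = ({valency r}, 0)"
      using block_unique[OF Node.prems(1), of "(set (leaves r), red_count r)" "({valency r}, 0)" "valency r"] a by auto
    then show False using a valency_in[of r] by auto
  qed
  have "Z - {(set (leaves l), red_count l), (set (leaves r), red_count r)} = X - ?L - ?R"
  proof -
    have "(set (leaves l), red_count l) \<notin> ?R" using valency_in[of l] d by auto
    then have "Z = insert (set (leaves r), red_count r) (insert (set (leaves l), red_count l) (X - ?L - ?R))"
      unfolding R(2) L(2) by (simp only: insert_Diff_if if_False)
    then show ?thesis using lX rX by (simp only: insert_Diff_if) auto
  qed
  then have "run X (postorder (Node c l r)) =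
      insert (set (leaves l) \<union> set (leaves r), red_count l + red_count r + color_weight c) (X - ?L - ?R)"
    unfolding run wp_merge_eq[OF Z lr(1,2)] by simp
  then have eq: "run X (postorder (Node c l r)) =
      insert (set (leaves (Node c l r)), red_count (Node c l r)) (X - (\<lambda>a. ({a}, 0)) ` set (leaves (Node c l r)))"
  proof -
    have "X - (\<lambda>a. ({a}, 0)) ` set (leaves (Node c l r)) = X - ?L - ?R" by auto
    moreover assume "run X (postorder (Node c l r)) =
      insert (set (leaves l) \<union> set (leaves r), red_count l + red_count r + color_weight c) (X - ?L - ?R)"
    ultimately show ?thesis by (cases c) simp_all
  qed
  have chain: "set (merge_chain X (postorder l)) \<subseteq> set (merge_chain X (postorder (Node c l r))) \<and>
    set (merge_chain Y (postorder r)) \<subseteq> set (merge_chain X (postorder (Node c l r))) \<and>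
    run X (postorder (Node c l r)) \<in> set (merge_chain X (postorder (Node c l r)))"
  proof -
    have mem: "set (merge_chain X ms) \<subseteq> set (merge_chain X (ms @ ms')) \<and>
        set (merge_chain (run X ms) ms') \<subseteq> set (merge_chain X (ms @ ms'))" for X ms ms'
      by (induction ms arbitrary: X) (auto simp: merge_chain_Cons, cases ms', auto simp: merge_chain_Cons)
    have "run X ms \<in> set (merge_chain X ms)" for X ms
      by (induction ms arbitrary: X) (auto simp: merge_chain_Cons)
    then show ?thesis
      using mem[of X "postorder l" "postorder r @ [(c, set (leaves l), set (leaves r))]"]
        mem[of Y "postorder r" "[(c, set (leaves l), set (leaves r))]"]
      by (simp add: Y_def) blast
  qed
  show ?case
  proof (intro conjI ballI)
    fix s assume s: "s \<in> subtrees (Node c l r)"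
    then consider "s = Node c l r" | "s \<in> subtrees l" | "s \<in> subtrees r" by auto
    then show "\<exists>Y \<in> set (merge_chain X (postorder (Node c l r))). (set (leaves s), red_count s) \<in> Y"
    proof cases
      case 1
      then show ?thesis using chain eq by (metis insertI1)
    next
      case 2
      then show ?thesis using chain L(3) by blast
    next
      case 3
      then show ?thesis using chain R(3) by blast
    qed
  qed (use val eq in blast)+
qed


section \<open>The Boolean algebra of subforests\<close>

lemma componentI:
  assumes "S \<subseteq> {1..n}" "S \<noteq> {}" "\<And>u v. u \<in> S \<Longrightarrow> v \<in> S \<Longrightarrow> (u, v) \<in> (E \<union> E\<inverse>)\<^sup>*"
    "\<And>u v. (u, v) \<in> E \<Longrightarrow> u \<in> S \<longleftrightarrow> v \<in> S"
  shows "S \<in> components n E"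
proof -
  obtain x where x: "x \<in> S" using assms(2) by blast
  have "linked n E `` {x} \<subseteq> S"
  proof
    fix y assume "y \<in> linked n E `` {x}"
    then have "(x, y) \<in> (E \<union> E\<inverse>)\<^sup>*" by (simp add: linked_def)
    then show "y \<in> S" by (induction rule: rtrancl_induct) (use x assms(4) in blast)+
  qed
  moreover have "S \<subseteq> linked n E `` {x}" using x assms(1,3) by (auto simp: linked_def)
  ultimately have "S = linked n E `` {x}" by blast
  then show ?thesis unfolding components_linked using x assms(1) by (auto intro: quotientI)
qed

lemma component_unique:
  "S \<in> components n E \<Longrightarrow> S' \<in> components n E \<Longrightarrow> x \<in> S \<Longrightarrow> x \<in> S' \<Longrightarrow> S = S'"
  using quotient_disj[OF equiv_linked] unfolding components_linked by blast

lemma component_ex: "x \<in> {1..n} \<Longrightarrow> \<exists>S \<in> components n E. x \<in> S"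
  unfolding components_linked using Union_quotient[OF equiv_linked, of n E] by blast

lemma components_insert:
  assumes E: "E \<subseteq> {1..n} \<times> {1..n}" and AB: "A \<in> components n E" "B \<in> components n E" "A \<noteq> B"
    and pc: "p \<in> A" "c \<in> B"
  shows "components n (insert (p, c) E) = insert (A \<union> B) (components n E - {A, B})"
proof -
  let ?E = "insert (p, c) E"
  let ?R = "(?E \<union> ?E\<inverse>)\<^sup>*"
  note CA = component_props[OF AB(1) E] and CB = component_props[OF AB(2) E]
  have mono: "(E \<union> E\<inverse>)\<^sup>* \<subseteq> ?R" by (rule rtrancl_mono) blast
  have pcR: "(p, c) \<in> ?R" "(c, p) \<in> ?R" by blast+
  have 1: "A \<union> B \<in> components n ?E"
  proof (rule componentI)
    show "A \<union> B \<subseteq> {1..n}" "A \<union> B \<noteq> {}" using CA CB by blast+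
    have toA: "(u, p) \<in> ?R \<and> (p, u) \<in> ?R" if "u \<in> A \<union> B" for u
    proof (cases "u \<in> A")
      case True
      then show ?thesis using CA(3) pc mono by blast
    next
      case False
      then have "(u, c) \<in> ?R" "(c, u) \<in> ?R" using that CB(3) pc mono by blast+
      then show ?thesis using pcR by (meson rtrancl_trans)
    qed
    then show "(u, v) \<in> ?R" if "u \<in> A \<union> B" "v \<in> A \<union> B" for u v
      using that by (meson rtrancl_trans)
    show "u \<in> A \<union> B \<longleftrightarrow> v \<in> A \<union> B" if "(u, v) \<in> ?E" for u v
      using that CA(4) CB(4) pc by blast
  qed
  have 2: "S \<in> components n ?E" if S: "S \<in> components n E - {A, B}" for S
  proof (rule componentI)
    have S': "S \<in> components n E" using S by blast
    note CS = component_props[OF S' E]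
    show "S \<subseteq> {1..n}" "S \<noteq> {}" using CS by blast+
    show "(u, v) \<in> ?R" if "u \<in> S" "v \<in> S" for u v using CS(3)[OF that] mono by blast
    have "p \<notin> S" "c \<notin> S" using component_unique[OF S'] AB pc S by blast+
    then show "u \<in> S \<longleftrightarrow> v \<in> S" if "(u, v) \<in> ?E" for u v
      using that CS(4) by blast
  qed
  show ?thesis
  proof
    show "insert (A \<union> B) (components n E - {A, B}) \<subseteq> components n ?E" using 1 2 by blast
    show "components n ?E \<subseteq> insert (A \<union> B) (components n E - {A, B})"
    proof
      fix S assume S: "S \<in> components n ?E"
      have E': "?E \<subseteq> {1..n} \<times> {1..n}" using E pc CA(1) CB(1) by blast
      obtain x where x: "x \<in> S" "x \<in> {1..n}" using component_props(1,2)[OF S E'] by blast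
      obtain D where D: "D \<in> components n E" "x \<in> D" using component_ex[OF x(2)] by blast
      show "S \<in> insert (A \<union> B) (components n E - {A, B})"
      proof (cases "D = A \<or> D = B")
        case True
        then have "S = A \<union> B" using component_unique[OF S 1 x(1)] D by blast
        then show ?thesis by blast
      next
        case False
        then have "S = D" using component_unique[OF S 2 x(1)] D by blast
        then show ?thesis using D False by blast
      qed
    qed
  qed
qed

text \<open>Adding an edge merges the components of its ends with weight 1 iff the edge is a
  descent. The assumption \<open>new\<close> ensures that \<open>c\<close> was not a descent before,
  so it is counted only once.\<close>

lemma forest_insert:
  assumes E: "E \<subseteq> {1..n} \<times> {1..n}" and AB: "A \<in> components n E" "B \<in> components n E" "A \<noteq> B"
    and pc: "p \<in> A" "c \<in> B" and new: "\<And>q. (q, c) \<notin> E" and X: "forest_wpartition n E \<in> wpartitions n"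
  shows "forest_wpartition n (insert (p, c) E) = wp_merge (if c < p then 1 else 0) A B (forest_wpartition n E)"
    "mergeable (forest_wpartition n E) A B"
proof -
  let ?w = "\<lambda>S. card (S \<inter> descents E)" and ?w' = "\<lambda>S. card (S \<inter> descents (insert (p, c) E))"
  let ?u = "if c < p then 1 else 0 :: nat"
  have ABX: "(A, ?w A) \<in> forest_wpartition n E" "(B, ?w B) \<in> forest_wpartition n E"
    using AB by (auto simp: forest_wpartition_def)
  note CA = component_props[OF AB(1) E] and CB = component_props[OF AB(2) E]
  have disj: "A \<inter> B = {}" using component_unique[OF AB(1,2)] AB(3) by blast
  have fin: "finite A" "finite B" using CA(1) CB(1) finite_subset by blast+
  have cE: "c \<notin> descents E" using new by (simp add: descents_def)
  have cA: "c \<notin> A" using disj pc by blast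
  have "?w' (A \<union> B) = ?w A + ?w B + ?u"
  proof -
    have U: "(A \<union> B) \<inter> descents E = (A \<inter> descents E) \<union> (B \<inter> descents E)" by blast
    have "card ((A \<union> B) \<inter> descents E) = ?w A + ?w B"
      unfolding U by (rule card_Un_disjoint) (use fin disj in auto)
    moreover have "(A \<union> B) \<inter> insert c (descents E) = insert c ((A \<union> B) \<inter> descents E)" using pc by blast
    ultimately show ?thesis using fin cE by (simp add: descents_insert)
  qed
  moreover have "?w' S = ?w S" if "S \<in> components n E - {A, B}" for S
  proof -
    have "c \<notin> S" using component_unique[OF _ AB(2) _ pc(2)] that by blast
    then have "S \<inter> descents (insert (p, c) E) = S \<inter> descents E" by (auto simp: descents_insert)
    then show ?thesis by simp
  qed
  ultimately have "forest_wpartition n (insert (p, c) E) =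
      insert (A \<union> B, ?w A + ?w B + ?u) ((\<lambda>S. (S, ?w S)) ` (components n E - {A, B}))"
    unfolding forest_wpartition_def components_insert[OF E AB pc] by simp
  moreover have "(\<lambda>S. (S, ?w S)) ` (components n E - {A, B}) = forest_wpartition n E - {(A, ?w A), (B, ?w B)}"
    by (auto simp: forest_wpartition_def)
  ultimately show "forest_wpartition n (insert (p, c) E) = wp_merge ?u A B (forest_wpartition n E)"
    using wp_merge_eq[OF X ABX] by simp
  have "A \<in> fst ` forest_wpartition n E" "B \<in> fst ` forest_wpartition n E" using ABX by force+
  then show "mergeable (forest_wpartition n E) A B" using AB(3) by (simp add: mergeable_def)
qed

lemma forest_empty: "forest_wpartition n {} = wp_bot n"
proof -
  have "linked n {} = Id_on {1..n}" by (auto simp: linked_def)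
  then have "components n {} = (\<lambda>k. {k}) ` {1..n}" by (auto simp: components_linked quotient_def)
  then show ?thesis by (simp add: forest_wpartition_def wp_bot_def descents_def image_image)
qed

text \<open>Since \<open>c\<close> has no parent in \<open>E\<close>, a common ancestor of
  \<open>p\<close> and \<open>c\<close> would be \<open>c\<close> itself, and the edge from
  \<open>p\<close> would close a cycle in \<open>T\<close>.\<close>

lemma not_linked:
  assumes T: "rooted_tree V T" and E: "E \<subseteq> T" and e: "(p, c) \<in> T - E"
  shows "(p, c) \<notin> (E \<union> E\<inverse>)\<^sup>*" "(q, c) \<notin> E"
proof -
  have uniq: "(p, c) \<in> T \<Longrightarrow> (q, c) \<in> T \<Longrightarrow> p = q" for p q c by (rule rooted_tree_parent_unique[OF T])
  show new: "(q, c) \<notin> E" for q using uniq e E by blast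
  show "(p, c) \<notin> (E \<union> E\<inverse>)\<^sup>*"
  proof
    assume "(p, c) \<in> (E \<union> E\<inverse>)\<^sup>*"
    then have "\<exists>z. (z, p) \<in> E\<^sup>* \<and> (z, c) \<in> E\<^sup>*"
      by (rule common_ancestor[rotated]) (use uniq E in blast)
    then have "(c, p) \<in> E\<^sup>*" using new by (metis rtranclE)
    then have "(c, p) \<in> T\<^sup>*" using rtrancl_mono[OF E] by blast
    then have "(c, c) \<in> T\<^sup>+" using e by (meson DiffD1 rtrancl_into_trancl1)
    then show False using rooted_tree_acyclic[OF T] by (simp add: acyclic_def)
  qed
qed

lemma forest_step:
  assumes T: "rooted_tree {1..n} T" and E: "E \<subseteq> T" and e: "(p, c) \<in> T - E"
    and X: "forest_wpartition n E \<in> wpartitions n"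
  shows "forest_wpartition n (insert (p, c) E) \<in> wpartitions n \<and>
    wp_less (forest_wpartition n E) (forest_wpartition n (insert (p, c) E))"
proof -
  have TV: "T \<subseteq> {1..n} \<times> {1..n}" using T by (simp add: rooted_tree_def)
  then have EV: "E \<subseteq> {1..n} \<times> {1..n}" and pcV: "p \<in> {1..n}" "c \<in> {1..n}" using E e by blast+
  obtain A B where AB: "A \<in> components n E" "p \<in> A" "B \<in> components n E" "c \<in> B"
    using component_ex pcV by meson
  have ne: "A \<noteq> B"
  proof
    assume "A = B"
    then have "(p, c) \<in> (E \<union> E\<inverse>)\<^sup>*" using component_props(3)[OF AB(1) EV AB(2)] AB(4) by simp
    then show False using not_linked(1)[OF T E e] by simp
  qed
  note F = forest_insert[OF EV AB(1,3) ne AB(2,4) not_linked(2)[OF T E e] X]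
  have u: "(if c < p then 1 else 0 :: nat) \<le> 1" by simp
  have "wp_merge (if c < p then 1 else 0) A B (forest_wpartition n E) \<in> wpartitions n"
    by (rule wp_merge_wpartitions(1)[OF X F(2) u])
  moreover have "wp_less (forest_wpartition n E) (wp_merge (if c < p then 1 else 0) A B (forest_wpartition n E))"
    using wp_merge_above[OF X F(2) u] unfolding wp_less_def by metis
  ultimately show ?thesis unfolding F(1) by blast
qed

lemma forest_wpartitions:
  assumes T: "rooted_tree {1..n} T" and E: "E \<subseteq> T"
  shows "forest_wpartition n E \<in> wpartitions n"
proof -
  have "T \<subseteq> {1..n} \<times> {1..n}" using T by (simp add: rooted_tree_def)
  then have "finite E" using E by (meson finite_SigmaI finite_atLeastAtMost finite_subset)
  then show ?thesis using E
  proof (induction rule: finite_induct)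
    case empty
    show ?case using forest_empty wp_bot_wpartitions(1) by simp
  next
    case (insert e E)
    then show ?case using forest_step[OF T, of E "fst e" "snd e"] by simp
  qed
qed

lemma forest_less:
  assumes T: "rooted_tree {1..n} T" and E: "E \<subset> E'" "E' \<subseteq> T"
  shows "wp_less (forest_wpartition n E) (forest_wpartition n E')"
proof -
  have "T \<subseteq> {1..n} \<times> {1..n}" using T by (simp add: rooted_tree_def)
  then have "finite (E' - E)" using E(2) by (meson finite_Diff finite_SigmaI finite_atLeastAtMost finite_subset)
  moreover have "finite D \<Longrightarrow> E \<union> D \<subseteq> T \<Longrightarrow> D \<inter> E = {} \<Longrightarrow> D \<noteq> {} \<Longrightarrow>
      wp_less (forest_wpartition n E) (forest_wpartition n (E \<union> D))" for D
  proof (induction rule: finite_induct)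
    case (insert e D)
    have ED: "E \<union> D \<subseteq> T" using insert.prems by blast
    note W = forest_wpartitions[OF T]
    have e: "(fst e, snd e) \<in> T - (E \<union> D)" using insert by auto
    have step: "wp_less (forest_wpartition n (E \<union> D)) (forest_wpartition n (E \<union> insert e D))"
      using forest_step[OF T ED e W[OF ED]] by simp
    show ?case
    proof (cases "D = {}")
      case True
      then show ?thesis using step by simp
    next
      case False
      have "wp_less (forest_wpartition n E) (forest_wpartition n (E \<union> D))"
        using insert False by blast
      then show ?thesis
        using wp_less_trans[OF W W W _ step] insert.prems(1) ED by blast
    qed
  qed simp
  ultimately have "wp_less (forest_wpartition n E) (forest_wpartition n (E \<union> (E' - E)))"
    using E by blast
  moreover have "E \<union> (E' - E) = E'" using E by blast
  ultimately show ?thesis by simp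
qed

text \<open>The underlying partition suffices: by \<open>not_linked\<close>, the edges of
  \<open>T\<close> with both ends in one component of \<open>E'\<close> are precisely those of
  \<open>E'\<close>.\<close>

lemma forest_inj:
  assumes T: "rooted_tree {1..n} T"
  shows "inj_on (forest_wpartition n) (Pow T)"
proof -
  have TV: "T \<subseteq> {1..n} \<times> {1..n}" using T by (simp add: rooted_tree_def)
  have "E \<subseteq> E'" if sub: "E \<subseteq> T" "E' \<subseteq> T" and eq: "forest_wpartition n E = forest_wpartition n E'" for E E'
  proof
    fix e assume e: "e \<in> E"
    obtain p c where pc: "e = (p, c)" by (cases e)
    have EV: "E \<subseteq> {1..n} \<times> {1..n}" "E' \<subseteq> {1..n} \<times> {1..n}" using sub TV by blast+
    obtain A where A: "A \<in> components n E" "p \<in> A" using component_ex[of p n E] EV e pc by blast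
    then have "c \<in> A" using component_props(4)[OF A(1) EV(1)] e pc by blast
    have "fst ` forest_wpartition n E = components n E" for E
      by (auto simp: forest_wpartition_def image_image)
    then have "A \<in> components n E'" using A(1) eq by metis
    then have "(p, c) \<in> (E' \<union> E'\<inverse>)\<^sup>*" using component_props(3)[OF _ EV(2)] A(2) \<open>c \<in> A\<close> by blast
    then show "e \<in> E'" using not_linked(1)[OF T sub(2), of p c] e sub(1) pc by blast
  qed
  then show ?thesis by (intro inj_onI subset_antisym) (metis PowD)+
qed

lemma forest_full:
  assumes "1 \<le> n" "T \<in> rooted_trees n i"
  shows "forest_wpartition n T = wp_top n i"
proof -
  have T: "rooted_tree {1..n} T" "card (descents T) = i" using assms(2) by (auto simp: rooted_trees_def)
  obtain r where r: "r \<in> {1..n}" "T \<subseteq> {1..n} \<times> {1..n}" "\<And>c. c \<in> {1..n} \<Longrightarrow> (r, c) \<in> T\<^sup>*"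
    using T(1) by (rule rooted_treeD) blast
  have "{1..n} \<in> components n T"
  proof (rule componentI)
    have R: "(r, u) \<in> (T \<union> T\<inverse>)\<^sup>* \<and> (u, r) \<in> (T \<union> T\<inverse>)\<^sup>*" if "u \<in> {1..n}" for u
    proof -
      have "(u, r) \<in> (T\<inverse>)\<^sup>*" using r(3)[OF that] by (simp add: rtrancl_converse)
      then show ?thesis using r(3)[OF that] rtrancl_mono[of T "T \<union> T\<inverse>"] rtrancl_mono[of "T\<inverse>" "T \<union> T\<inverse>"]
        by blast
    qed
    then show "(u, v) \<in> (T \<union> T\<inverse>)\<^sup>*" if "u \<in> {1..n}" "v \<in> {1..n}" for u v
      using that by (meson rtrancl_trans)
  qed (use assms(1) r(2) in auto)
  moreover have "S = {1..n}" if S: "S \<in> components n T" for S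
  proof -
    obtain x where "x \<in> S" "x \<in> {1..n}" using component_props(1,2)[OF S r(2)] by blast
    then show ?thesis by (rule component_unique[OF S calculation])
  qed
  ultimately have "components n T = {{1..n}}" by blast
  moreover have "descents T \<subseteq> {1..n}" using r(2) by (auto simp: descents_def)
  ultimately show ?thesis using T(2) by (simp add: forest_wpartition_def wp_top_def Int_absorb1)
qed


section \<open>The chain of a Liu--Lyndon tree as a growing forest\<close>

fun edge_list :: "btree \<Rightarrow> (nat \<times> nat) list" where
  "edge_list (Leaf a) = []"
| "edge_list (Node c l r) = edge_list l @ edge_list r @ [(valency l, valency r)]"

lemma set_edge_list: "set (edge_list t) = tree_edges t"
  by (induction t) auto

lemma length_edge_list: "length (edge_list t) = length (postorder t)"
  by (induction t) auto

lemma distinct_edge_list: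
  "liu_lyndon t \<Longrightarrow> distinct (leaves t) \<Longrightarrow> distinct (edge_list t)"
proof (induction t)
  case (Node c l r)
  note N = liu_Node_valency[OF Node.prems]
  have d: "set (leaves l) \<inter> set (leaves r) = {}" using Node by auto
  have s: "tree_edges l \<subseteq> set (leaves l) \<times> set (leaves l)" "tree_edges r \<subseteq> set (leaves r) \<times> set (leaves r)"
    using fits_subset[OF fits_tree_edges] N Node.prems by auto
  have "tree_edges l \<inter> tree_edges r = {}" "(valency l, valency r) \<notin> tree_edges l \<union> tree_edges r"
    using s d valency_in[of l] valency_in[of r] by blast+
  then show ?case using Node N by (simp add: set_edge_list)
qed simp

lemma leaves_component:
  assumes t: "liu_lyndon t" "distinct (leaves t)" "set (leaves t) \<subseteq> {1..n}" and E: "tree_edges t \<subseteq> E"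
    and iso: "\<And>u v. (u, v) \<in> E - tree_edges t \<Longrightarrow> u \<notin> set (leaves t) \<and> v \<notin> set (leaves t)"
  shows "set (leaves t) \<in> components n E"
proof (rule componentI)
  note F = fits_tree_edges[OF t(1,2)]
  have R: "(valency t, u) \<in> (E \<union> E\<inverse>)\<^sup>* \<and> (u, valency t) \<in> (E \<union> E\<inverse>)\<^sup>*" if "u \<in> set (leaves t)" for u
  proof -
    have "(valency t, u) \<in> (tree_edges t)\<^sup>*" using fits_rooted[OF F t(2)] that by blast
    then have e: "(valency t, u) \<in> E\<^sup>*" using rtrancl_mono[OF E] by blast
    then have "(u, valency t) \<in> (E\<inverse>)\<^sup>*" by (simp add: rtrancl_converse)
    then show ?thesis using e rtrancl_mono[of E "E \<union> E\<inverse>"] rtrancl_mono[of "E\<inverse>" "E \<union> E\<inverse>"] by blast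
  qed
  then show "(u, v) \<in> (E \<union> E\<inverse>)\<^sup>*" if "u \<in> set (leaves t)" "v \<in> set (leaves t)" for u v
    using that by (meson rtrancl_trans)
  show "u \<in> set (leaves t) \<longleftrightarrow> v \<in> set (leaves t)" if "(u, v) \<in> E" for u v
    using that iso[of u v] fits_subset[OF F] by blast
qed (use t leaves_nonempty in auto)

text \<open>\<open>E\<close> collects the edges built earlier in other parts of the tree, away from
  the leaves of \<open>t\<close>. The prefix length \<open>k\<close> gives access to every element
  of the chain rather than only to the last.\<close>

lemma run_forest:
  assumes T: "rooted_tree {1..n} T"
  shows "liu_lyndon t \<Longrightarrow> distinct (leaves t) \<Longrightarrow> set (leaves t) \<subseteq> {1..n} \<Longrightarrow> E \<union> tree_edges t \<subseteq> T \<Longrightarrow>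
    (\<And>u v. (u, v) \<in> E \<Longrightarrow> u \<notin> set (leaves t) \<and> v \<notin> set (leaves t)) \<Longrightarrow> k \<le> length (edge_list t) \<Longrightarrow>
    run (forest_wpartition n E) (take k (postorder t)) = forest_wpartition n (E \<union> set (take k (edge_list t)))"
proof (induction t arbitrary: E k)
  case (Leaf a)
  then show ?case by simp
next
  case (Node c l r)
  note N = liu_Node_valency[OF Node.prems(1,2)]
  have d: "set (leaves l) \<inter> set (leaves r) = {}" and dist: "distinct (leaves l)" "distinct (leaves r)"
    and V: "set (leaves l) \<subseteq> {1..n}" "set (leaves r) \<subseteq> {1..n}" using Node.prems by auto
  have s: "tree_edges l \<subseteq> set (leaves l) \<times> set (leaves l)" "tree_edges r \<subseteq> set (leaves r) \<times> set (leaves r)"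
    using fits_subset[OF fits_tree_edges] N dist by auto
  let ?a = "length (edge_list l)" and ?b = "length (edge_list r)"
  let ?E1 = "E \<union> tree_edges l" and ?E2 = "E \<union> tree_edges l \<union> tree_edges r"
  have T1: "E \<union> tree_edges l \<subseteq> T" and T2: "?E1 \<union> tree_edges r \<subseteq> T" and e: "(valency l, valency r) \<in> T"
    using Node.prems(4) by auto
  have L: "run (forest_wpartition n E) (take j (postorder l)) = forest_wpartition n (E \<union> set (take j (edge_list l)))"
    if "j \<le> ?a" for j
    by (rule Node.IH(1)[OF N(3) dist(1) V(1) T1 _ that]) (use Node.prems(5) in auto)
  have iso1: "u \<notin> set (leaves r) \<and> v \<notin> set (leaves r)" if "(u, v) \<in> ?E1" for u v
    using that Node.prems(5)[of u v] s(1) d by auto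
  have R: "run (forest_wpartition n ?E1) (take j (postorder r)) = forest_wpartition n (?E1 \<union> set (take j (edge_list r)))"
    if "j \<le> ?b" for j
    by (rule Node.IH(2)[OF N(4) dist(2) V(2) T2 iso1 that])
  have full: "run (forest_wpartition n E) (postorder l) = forest_wpartition n ?E1"
    "run (forest_wpartition n ?E1) (postorder r) = forest_wpartition n ?E2"
    using L[of ?a] R[of ?b] by (simp_all add: length_edge_list set_edge_list)
  consider "k \<le> ?a" | "?a < k" "k \<le> ?a + ?b" | "k = ?a + ?b + 1" using Node.prems(6) by fastforce
  then show ?case
  proof cases
    case 1
    then show ?thesis using L[OF 1] by (simp add: length_edge_list[symmetric])
  next
    case 2
    then have "k - ?a \<le> ?b" by simp
    from R[OF this] full(1) show ?thesis using 2
      by (simp add: length_edge_list[symmetric] set_edge_list Un_assoc)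
  next
    case 3
    have iso2: "u \<notin> set (leaves l) \<and> v \<notin> set (leaves l)" if "(u, v) \<in> ?E2 - tree_edges l" for u v
      using that Node.prems(5)[of u v] s(2) d by auto
    have iso3: "u \<notin> set (leaves r) \<and> v \<notin> set (leaves r)" if "(u, v) \<in> ?E2 - tree_edges r" for u v
      using that iso1[of u v] by blast
    have comps: "set (leaves l) \<in> components n ?E2" "set (leaves r) \<in> components n ?E2"
      by (rule leaves_component[OF N(3) dist(1) V(1) _ iso2], blast, assumption)
        (rule leaves_component[OF N(4) dist(2) V(2) _ iso3], blast, assumption)
    have ne: "set (leaves l) \<noteq> set (leaves r)" using d valency_in[of l] by blast
    have TV: "T \<subseteq> {1..n} \<times> {1..n}" using T by (simp add: rooted_tree_def)
    then have E2V: "?E2 \<subseteq> {1..n} \<times> {1..n}" using T2 by blast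
    have X: "forest_wpartition n ?E2 \<in> wpartitions n" by (rule forest_wpartitions[OF T T2])
    have new: "(q, valency r) \<notin> ?E2" for q
      using iso1[of q "valency r"] valency_in[of r] fits_rooted[OF fits_tree_edges[OF N(4) dist(2)] dist(2)] by blast
    have "forest_wpartition n (insert (valency l, valency r) ?E2) =
        wp_merge (if valency r < valency l then 1 else 0) (set (leaves l)) (set (leaves r)) (forest_wpartition n ?E2)"
      by (rule forest_insert(1)[OF E2V comps ne valency_in valency_in new X])
    moreover have "(if valency r < valency l then 1 else 0) = color_weight c"
      using N(2) by (cases c) auto
    moreover have "take k (postorder (Node c l r)) = postorder (Node c l r)"
      "take k (edge_list (Node c l r)) = edge_list (Node c l r)"
      using 3 by (simp_all add: length_edge_list[symmetric])
    ultimately show ?thesis using full by (simp add: set_edge_list Un_assoc)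
  qed
qed

lemma tree_chain_forest:
  assumes n: "1 \<le> n" and t: "t \<in> liu_trees n i"
  shows "tree_chain n t = map (\<lambda>k. forest_wpartition n (set (take k (edge_list t)))) [0..<n]"
    "length (edge_list t) + 1 = n"
proof -
  have L: "liu_lyndon t" "distinct (leaves t)" "set (leaves t) = {1..n}"
    using t by (auto simp: liu_trees_def bicolored_trees_def)
  have T: "rooted_tree {1..n} (tree_edges t)"
    using fits_rooted_tree[OF fits_tree_edges[OF L(1,2)] L(2)] L(3) by simp
  have "length (leaves t) = length (postorder t) + 1" by (induction t) auto
  then show len: "length (edge_list t) + 1 = n"
    using L by (metis card_atLeastAtMost diff_Suc_1 distinct_card length_edge_list)
  show "tree_chain n t = map (\<lambda>k. forest_wpartition n (set (take k (edge_list t)))) [0..<n]"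
  proof (rule nth_equalityI)
    show "length (tree_chain n t) = length (map (\<lambda>k. forest_wpartition n (set (take k (edge_list t)))) [0..<n])"
      using len by (simp add: tree_chain_def merge_chain_length length_edge_list)
    fix k assume "k < length (tree_chain n t)"
    then have k: "k \<le> length (edge_list t)" by (simp add: tree_chain_def merge_chain_length length_edge_list)
    have "run (forest_wpartition n {}) (take k (postorder t)) = forest_wpartition n ({} \<union> set (take k (edge_list t)))"
      by (rule run_forest[OF T L(1,2)]) (use L k in auto)
    then show "tree_chain n t ! k = map (\<lambda>k. forest_wpartition n (set (take k (edge_list t)))) [0..<n] ! k"
      using k len by (simp add: tree_chain_def merge_chain_nth length_edge_list forest_empty)
  qed
qed

lemma tree_chain_max_chain:
  assumes "1 \<le> n" "i \<le> n - 1" "t \<in> bicolored_trees n i"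
  shows "full_merges n i (postorder t)" "max_chain n i (tree_chain n t)"
    "s \<in> subtrees t \<Longrightarrow> \<exists>Y \<in> set (tree_chain n t). (set (leaves s), red_count s) \<in> Y"
proof -
  have t: "distinct (leaves t)" "set (leaves t) = {1..n}" "red_count t = i"
    using assms(3) by (auto simp: bicolored_trees_def)
  have a: "({a}, 0) \<in> wp_bot n" if "a \<in> set (leaves t)" for a
    using that t(2) by (auto simp: wp_bot_def)
  note R = run_postorder[OF wp_bot_wpartitions(1) t(1) a]
  have "(\<lambda>a. ({a}, 0)) ` set (leaves t) = wp_bot n" unfolding t(2) by (auto simp: wp_bot_def)
  then show f: "full_merges n i (postorder t)" using R t by (simp add: full_merges_def wp_top_def)
  show "max_chain n i (tree_chain n t)"
    unfolding tree_chain_def by (rule full_merges_max_chain[OF assms(1,2) f])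
  show "s \<in> subtrees t \<Longrightarrow> \<exists>Y \<in> set (tree_chain n t). (set (leaves s), red_count s) \<in> Y"
    using R unfolding tree_chain_def by blast
qed

lemma max_chain_cases:
  assumes "max_chain n i W"
  shows "n = 1 \<and> W = [wp_bot n] \<and> wp_bot n = wp_top n i \<or>
    2 \<le> n \<and> W = wp_bot n # butlast (tl W) @ [wp_top n i]"
proof -
  note W = assms[unfolded max_chain_def]
  obtain X W' where XW: "W = X # W'" using W by (cases W) auto
  show ?thesis
  proof (cases "W' = []")
    case True
    then show ?thesis using W XW by auto
  next
    case False
    then have "W = X # butlast W' @ [last W']" using XW by simp
    then show ?thesis using W XW False by (cases W') auto
  qed
qed

text \<open>For \<open>n = 1\<close> the single element is bottom and top at once; both sides are
  then the empty list, the generator in degree -2.\<close>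

lemma proper_part_max_chain:
  assumes "max_chain n i W"
  shows "filter (\<lambda>X. X \<noteq> wp_bot n \<and> X \<noteq> wp_top n i) W = butlast (tl W)"
proof -
  have sorted: "sorted_wrt wp_less W" using assms by (simp add: max_chain_def)
  from max_chain_cases[OF assms] show ?thesis
  proof
    assume "n = 1 \<and> W = [wp_bot n] \<and> wp_bot n = wp_top n i"
    then show ?thesis by auto
  next
    assume W: "2 \<le> n \<and> W = wp_bot n # butlast (tl W) @ [wp_top n i]"
    define M where "M = butlast (tl W)"
    have eq: "W = wp_bot n # M @ [wp_top n i]" using W by (simp add: M_def)
    have "\<forall>X \<in> set M. X \<noteq> wp_bot n \<and> X \<noteq> wp_top n i"
      using sorted unfolding eq by (auto simp: sorted_wrt_append wp_less_def)
    then have "filter (\<lambda>X. X \<noteq> wp_bot n \<and> X \<noteq> wp_top n i) W = M" unfolding eq by simp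
    then show ?thesis by (simp add: M_def)
  qed
qed

lemma proper_tree_chain_eq:
  assumes "1 \<le> n" "i \<le> n - 1" "t \<in> bicolored_trees n i"
  shows "proper_tree_chain n i t = butlast (tl (tree_chain n t))"
  unfolding proper_tree_chain_def by (rule proper_part_max_chain[OF tree_chain_max_chain(2)[OF assms]])

text \<open>The leaf set of each subtree of \<open>t\<close> is a block of some element of the
  chain, hence a component of a subforest of \<open>T\<close>. So it spans a subtree of
  \<open>T\<close> whose descents are counted by the weight, which is what a fit is assembled
  from.\<close>

theorem tree_chain_fits:
  assumes n: "1 \<le> n" "i \<le> n - 1" and t: "t \<in> bicolored_trees n i" and T: "T \<in> rooted_trees n i"
    and sub: "set (proper_tree_chain n i t) \<subseteq> tree_poset n T"
  shows "\<exists>w. fits t w T"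
proof -
  have RT: "rooted_tree {1..n} T" using T by (simp add: rooted_trees_def)
  have TV: "T \<subseteq> {1..n} \<times> {1..n}" using RT by (simp add: rooted_tree_def)
  have L: "distinct (leaves t)" "set (leaves t) = {1..n}" using t by (auto simp: bicolored_trees_def)
  have bt: "wp_bot n \<in> tree_poset n T" "wp_top n i \<in> tree_poset n T"
    using forest_empty forest_full[OF n(1) T] unfolding tree_poset_def by (metis Pow_bottom imageI, metis Pow_top imageI)
  have all: "set (tree_chain n t) \<subseteq> tree_poset n T"
    using sub bt unfolding proper_tree_chain_def by auto
  have "\<exists>w. fits t w (T \<inter> set (leaves t) \<times> set (leaves t))"
  proof (rule fits_if_subtrees_connected[OF L(1)])
    fix s assume "s \<in> subtrees t"
    then obtain Y where Y: "Y \<in> set (tree_chain n t)" "(set (leaves s), red_count s) \<in> Y"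
      using tree_chain_max_chain(3)[OF n t] by blast
    then obtain E where E: "E \<subseteq> T" "Y = forest_wpartition n E" using all unfolding tree_poset_def by blast
    then have S: "set (leaves s) \<in> components n E" "red_count s = card (set (leaves s) \<inter> descents E)"
      using Y(2) by (auto simp: forest_wpartition_def)
    show "rooted_tree (set (leaves s)) (T \<inter> set (leaves s) \<times> set (leaves s)) \<and>
      card (descents (T \<inter> set (leaves s) \<times> set (leaves s))) = red_count s"
      using component_rooted[OF RT E(1) S(1)] S(2) by simp
  qed
  moreover have "T \<inter> set (leaves t) \<times> set (leaves t) = T" using TV L(2) by auto
  ultimately show ?thesis by simp
qed

section \<open>Coefficients of fundamental cycles\<close>

lemma lookup_scale [simp]: "Poly_Mapping.lookup (scale c f) k = c * Poly_Mapping.lookup f k"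
  by (simp add: scale_def map.rep_eq when_def)

lemma boundary_superset:
  assumes "finite A" "Poly_Mapping.keys f \<subseteq> A"
  shows "boundary f = (\<Sum>xs \<in> A. \<Sum>j < length xs.
     Poly_Mapping.single (take j xs @ drop (Suc j) xs) ((- 1) ^ j * Poly_Mapping.lookup f xs))"
  unfolding boundary_def using assms
  by (intro sum.mono_neutral_left) (auto simp: in_keys_iff)

lemma boundary_add: "boundary (f + g) = boundary f + boundary g"
proof -
  let ?A = "Poly_Mapping.keys f \<union> Poly_Mapping.keys g"
  have "Poly_Mapping.keys (f + g) \<subseteq> ?A" by (rule keys_add)
  then show ?thesis
    using boundary_superset[of ?A f] boundary_superset[of ?A g] boundary_superset[of ?A "f + g"]
    by (simp add: lookup_add distrib_left single_add sum.distrib)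
qed

lemma boundary_zero [simp]: "boundary 0 = 0"
  by (simp add: boundary_def)

lemma boundary_sum: "boundary (sum f A) = (\<Sum>a \<in> A. boundary (f a))"
  by (induction A rule: infinite_finite_induct) (auto simp: boundary_add)

lemma boundary_single:
  "boundary (Poly_Mapping.single xs c) =
    (\<Sum>j < length xs. Poly_Mapping.single (take j xs @ drop (Suc j) xs) ((- 1) ^ j * c))"
  using boundary_superset[of "{xs}" "Poly_Mapping.single xs c"] by simp

definition perm_chain :: "nat \<Rightarrow> (nat \<times> nat) list \<Rightarrow> (nat \<Rightarrow> nat) \<Rightarrow> wpartition list" where
  "perm_chain n es p = map (\<lambda>k. forest_wpartition n ((\<lambda>j. es ! p j) ` {..<k})) [1..<length es]"

text \<open>
  Chains indexed by orderings of the edges are the facets of the barycentric subdivision of the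
  boundary of a simplex; adjacent facets differ by a transposition, so the sign orients them.
\<close>

definition sphere_cycle :: "nat \<Rightarrow> (nat \<times> nat) list \<Rightarrow> (wpartition list \<Rightarrow>\<^sub>0 int)" where
  "sphere_cycle n es = (\<Sum>p | p permutes {..<length es}. Poly_Mapping.single (perm_chain n es p) (sign p))"

text \<open>Only the prefix of length \<open>Suc j\<close> separates the two exchanged
  positions.\<close>

lemma perm_chain_transpose:
  assumes "Suc j < length es" "k \<noteq> Suc j"
  shows "(\<lambda>i. es ! (p \<circ> transpose j (Suc j)) i) ` {..<k} = (\<lambda>i. es ! p i) ` {..<k}"
proof -
  have "transpose j (Suc j) ` {..<k} = {..<k}"
  proof (cases "k \<le> j")
    case True
    then have "transpose j (Suc j) i = i" if "i < k" for i using that by (simp add: transpose_def)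
    then show ?thesis by force
  next
    case False
    then have "transpose j (Suc j) permutes {..<k}" using assms(2) by (intro permutes_swap_id) auto
    then show ?thesis by (rule permutes_image)
  qed
  moreover have "(\<lambda>i. es ! (p \<circ> transpose j (Suc j)) i) ` {..<k} = (\<lambda>i. es ! p i) ` (transpose j (Suc j) ` {..<k})"
    by (simp add: image_image)
  ultimately show ?thesis by simp
qed

text \<open>Deleting the entry at position \<open>j\<close> removes the prefix of length
  \<open>Suc j\<close>, the only one that tells \<open>p\<close> from its composite with the
  exchange of \<open>j\<close> and \<open>Suc j\<close>. These two orderings have opposite signs, so
  the faces cancel in pairs.\<close>

lemma sphere_cycle_boundary: "boundary (sphere_cycle n es) = 0"
proof -
  let ?P = "{p. p permutes {..<length es}}"
  let ?g = "\<lambda>j p. Poly_Mapping.single (take j (perm_chain n es p) @ drop (Suc j) (perm_chain n es p))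
      ((- 1) ^ j * sign p) :: wpartition list \<Rightarrow>\<^sub>0 int"
  have "(\<Sum>p \<in> ?P. ?g j p) = 0" if j: "j < length es - 1" for j
  proof -
    let ?t = "transpose j (Suc j)"
    have tp: "?t permutes {..<length es}" using j by (intro permutes_swap_id) auto
    have flip: "?g j (p \<circ> ?t) = - ?g j p" if p: "p \<in> ?P" for p
    proof -
      have "permutation p" using p permutation_permutes by blast
      then have "sign (p \<circ> ?t) = - sign p"
        by (simp add: sign_compose permutation_swap_id sign_swap_id)
      moreover have "take j (perm_chain n es (p \<circ> ?t)) = take j (perm_chain n es p)"
        unfolding perm_chain_def take_map
      proof (rule map_cong[OF refl])
        fix k assume "k \<in> set (take j [1..<length es])"
        then have "k \<noteq> Suc j" using j by (auto simp: take_upt)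
        then show "forest_wpartition n ((\<lambda>i. es ! (p \<circ> ?t) i) ` {..<k}) = forest_wpartition n ((\<lambda>i. es ! p i) ` {..<k})"
          using perm_chain_transpose[of j es k p] j by simp
      qed
      moreover have "drop (Suc j) (perm_chain n es (p \<circ> ?t)) = drop (Suc j) (perm_chain n es p)"
        unfolding perm_chain_def drop_map
      proof (rule map_cong[OF refl])
        fix k assume "k \<in> set (drop (Suc j) [1..<length es])"
        then have "k \<noteq> Suc j" by (auto simp: drop_upt)
        then show "forest_wpartition n ((\<lambda>i. es ! (p \<circ> ?t) i) ` {..<k}) = forest_wpartition n ((\<lambda>i. es ! p i) ` {..<k})"
          using perm_chain_transpose[of j es k p] j by simp
      qed
      ultimately show ?thesis by (simp add: single_uminus)
    qed
    have "(\<Sum>p \<in> ?P. ?g j p) = (\<Sum>p \<in> ?P. ?g j (p \<circ> ?t))"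
      by (rule sum.reindex_bij_witness[of _ "\<lambda>p. p \<circ> ?t" "\<lambda>p. p \<circ> ?t"])
        (use tp in \<open>auto simp: comp_assoc intro: permutes_compose\<close>)
    also have "\<dots> = - (\<Sum>p \<in> ?P. ?g j p)" unfolding sum_negf[symmetric] by (rule sum.cong[OF refl flip])
    finally have "S = - S" if "S = (\<Sum>p \<in> ?P. ?g j p)" for S using that by simp
    then have S: "(\<Sum>p \<in> ?P. ?g j p) = - (\<Sum>p \<in> ?P. ?g j p)" by blast
    \<comment> \<open>From \<open>S = - S\<close> to \<open>S = 0\<close> one passes to the
      coefficients, which are integers.\<close>
    show ?thesis
    proof (rule poly_mapping_eqI)
      fix k
      have "Poly_Mapping.lookup (\<Sum>p \<in> ?P. ?g j p) k = - Poly_Mapping.lookup (\<Sum>p \<in> ?P. ?g j p) k"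
        using arg_cong[OF S, of "\<lambda>f. Poly_Mapping.lookup f k"] by (simp only: lookup_uminus)
      then show "Poly_Mapping.lookup (\<Sum>p \<in> ?P. ?g j p) k = Poly_Mapping.lookup 0 k" by simp
    qed
  qed
  then have "(\<Sum>j < length es - 1. \<Sum>p \<in> ?P. ?g j p) = 0" by simp
  moreover have "boundary (sphere_cycle n es) = (\<Sum>p \<in> ?P. \<Sum>j < length es - 1. ?g j p)"
    unfolding sphere_cycle_def boundary_sum boundary_single by (simp add: perm_chain_def)
  ultimately show ?thesis by (subst (asm) sum.swap) simp
qed

lemma perm_set_prefix:
  assumes "distinct es" "p permutes {..<length es}" "k \<le> length es"
  shows "(\<lambda>j. es ! p j) ` {..<k} \<subseteq> set es" "card ((\<lambda>j. es ! p j) ` {..<k}) = k"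
proof -
  have p: "p j < length es" if "j < k" for j using permutes_in_image[OF assms(2), of j] that assms(3) by simp
  then show "(\<lambda>j. es ! p j) ` {..<k} \<subseteq> set es" by auto
  have "inj_on (\<lambda>j. es ! p j) {..<k}"
  proof
    fix x y assume xy: "x \<in> {..<k}" "y \<in> {..<k}" "es ! p x = es ! p y"
    then have "p x < length es" "p y < length es" using p by auto
    then have "p x = p y" using nth_eq_iff_index_eq[OF assms(1)] xy(3) by blast
    then show "x = y" using permutes_inj[OF assms(2)] by (simp add: inj_eq)
  qed
  then show "card ((\<lambda>j. es ! p j) ` {..<k}) = k" by (simp add: card_image)
qed

text \<open>The chain determines all prefix sets of the ordering, the empty and the full one being
  the same for every ordering, and the edge at position \<open>j\<close> is what the prefix of
  length \<open>Suc j\<close> adds to the one before.\<close>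

lemma perm_chain_inj:
  assumes es: "distinct es" and T: "rooted_tree {1..n} (set es)" and p: "p permutes {..<length es}"
    and eq: "perm_chain n es p = perm_chain n es id"
  shows "p = id"
proof -
  have img: "p ` {..<k} = {..<k}" if k: "k \<le> length es" for k
  proof -
    have sets: "(\<lambda>j. es ! p j) ` {..<k} = (\<lambda>j. es ! id j) ` {..<k}"
    proof -
      consider "k = 0" | "k = length es" | "1 \<le> k" "k < length es" using k by linarith
      then show ?thesis
      proof cases
        case 2
        have "(\<lambda>j. es ! p j) ` {..<k} = (!) es ` (p ` {..<k})" by (simp add: image_image)
        then show ?thesis using permutes_image[OF p] 2 by simp
      next
        case 3
        then have "k - 1 < length (perm_chain n es p)" by (simp add: perm_chain_def)
        then have "forest_wpartition n ((\<lambda>j. es ! p j) ` {..<k}) = forest_wpartition n ((\<lambda>j. es ! id j) ` {..<k})"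
          using arg_cong[OF eq, of "\<lambda>xs. xs ! (k - 1)"] 3 by (simp add: perm_chain_def)
        then show ?thesis
          by (rule inj_onD[OF forest_inj[OF T]])
            (use perm_set_prefix(1)[OF es p k] perm_set_prefix(1)[OF es permutes_id k] in auto)
      qed simp
    qed
    have pk: "p j < length es" if "j < k" for j using permutes_in_image[OF p, of j] that k by simp
    have "{..<k} \<subseteq> p ` {..<k}"
    proof
      fix j assume j: "j \<in> {..<k}"
      then have "es ! j \<in> (\<lambda>j. es ! p j) ` {..<k}" using sets by auto
      then obtain i where "i < k" "es ! j = es ! p i" by auto
      then have "j = p i" using nth_eq_iff_index_eq[OF es] pk j k by auto
      then show "j \<in> p ` {..<k}" using \<open>i < k\<close> by blast
    qed
    moreover have "card (p ` {..<k}) \<le> card {..<k}" by (rule card_image_le) simp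
    ultimately show ?thesis using card_seteq[of "p ` {..<k}" "{..<k}"] by simp
  qed
  have "p j = j" for j
  proof (cases "j < length es")
    case True
    have "p j \<in> p ` {..<Suc j}" by simp
    then have "p j \<in> {..<Suc j}" using img[of "Suc j"] True by auto
    moreover have "p j \<notin> p ` {..<j}" using permutes_inj[OF p] by (auto simp: inj_eq)
    then have "p j \<notin> {..<j}" using img[of j] True by auto
    ultimately show ?thesis by auto
  next
    case False
    then show ?thesis using p by (simp add: permutes_def)
  qed
  then show ?thesis by auto
qed

lemma sphere_cycle_coeff:
  assumes "distinct es" "rooted_tree {1..n} (set es)"
  shows "Poly_Mapping.lookup (sphere_cycle n es) (perm_chain n es id) = 1"
proof -
  have "Poly_Mapping.lookup (sphere_cycle n es) (perm_chain n es id) =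
      (\<Sum>p | p permutes {..<length es}. if p = id then 1 else 0)"
    unfolding sphere_cycle_def lookup_sum
    by (rule sum.cong[OF refl]) (use perm_chain_inj[OF assms] in \<open>auto simp: lookup_single when_def\<close>)
  also have "\<dots> = 1"
    using permutes_id[of "{..<length es}"] finite_permutations[of "{..<length es}"] by simp
  finally show ?thesis .
qed

section \<open>Chains and cycles in the top degree\<close>

lemma wp_bot_le: 
  assumes "X \<in> wpartitions n"
  shows "wp_le (wp_bot n) X"
proof -
  have "refines (wp_bot n) X"
    unfolding refines_def
  proof
    fix p assume "p \<in> wp_bot n"
    then obtain k where k: "p = ({k}, 0)" "k \<in> \<Union> (fst ` X)"
      using wpartitionsD(6)[OF assms] by (auto simp: wp_bot_def)
    then show "\<exists>q \<in> X. fst p \<subseteq> fst q" by auto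
  qed
  moreover have "weights_ok (wp_bot n) q" if q: "q \<in> X" for q
  proof -
    have "inside (wp_bot n) (fst q) = (\<lambda>k. ({k}, 0)) ` fst q"
      using wpartitionsD(7)[OF assms q] by (auto simp: inside_def wp_bot_def)
    moreover have "inj_on (\<lambda>k. ({k}, 0 :: nat)) (fst q)" by (auto simp: inj_on_def)
    ultimately show ?thesis using wpartitionsD(3)[OF assms q]
      by (simp add: weights_ok_def card_image sum.reindex)
  qed
  ultimately show ?thesis using wp_le_iff[OF wp_bot_wpartitions(1) assms] by blast
qed

lemma sorted_wp_length:
  "sorted_wrt wp_less (Z # W) \<Longrightarrow> set (Z # W) \<subseteq> wpartitions n \<Longrightarrow> card (last (Z # W)) + length W \<le> card Z"
proof (induction W arbitrary: Z)
  case (Cons Y W)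
  then show ?case using wp_less_card[of Z n Y] by fastforce
qed simp

lemma order_chains_length:
  assumes n: "1 \<le> n" "i \<le> n - 1" and Q: "Q \<subseteq> wpartitions n" and ne: "wp_bot n \<noteq> wp_top n i"
    and xs: "sorted_wrt wp_less xs" "set xs \<subseteq> open_interval wp_less Q (wp_bot n) (wp_top n i)"
  shows "length xs + 2 \<le> n"
proof -
  have "2 \<le> n" using ne n by (cases "n = 1") (auto simp: wp_bot_def wp_top_def)
  show ?thesis
  proof (cases xs)
    case (Cons Z W)
    have Z: "Z \<in> wpartitions n" "wp_less (wp_bot n) Z"
      and l: "last xs \<in> wpartitions n" "wp_less (last xs) (wp_top n i)"
      using xs(2) Q last_in_set[of xs] Cons by (auto simp: open_interval_def)
    have "card Z < n" using wp_less_card[OF wp_bot_wpartitions(1) Z] wp_bot_wpartitions(2)[of n] by simp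
    moreover have "1 < card (last xs)"
      using wp_less_card[OF l(1) wp_top_wpartitions(1)[OF n] l(2)] wp_top_wpartitions(2)[OF n] by simp
    moreover have "set (Z # W) \<subseteq> wpartitions n" using xs(2) Q Cons by (auto simp: open_interval_def)
    then have "card (last (Z # W)) + length W \<le> card Z" using sorted_wp_length xs(1) Cons by blast
    ultimately show ?thesis using Cons by simp
  qed (use \<open>2 \<le> n\<close> in simp)
qed

text \<open>A chain in the open interval loses a block at each step and stays between
  \<open>n - 1\<close> and 2 blocks, so it has at most \<open>n - 2\<close> elements; degree
  \<open>n - 2\<close> would take \<open>n - 1\<close>.\<close>

lemma interval_chains_above_top:
  assumes n: "1 \<le> n" "i \<le> n - 1" and Q: "Q \<subseteq> wpartitions n"
  shows "interval_chains wp_less Q (wp_bot n) (wp_top n i) (int n - 2) = {}"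
proof (cases "wp_bot n = wp_top n i")
  case False
  have "xs \<notin> order_chains wp_less (open_interval wp_less Q (wp_bot n) (wp_top n i)) (int n - 2)" for xs
  proof
    assume "xs \<in> order_chains wp_less (open_interval wp_less Q (wp_bot n) (wp_top n i)) (int n - 2)"
    then have "length xs + 2 \<le> n" "int (length xs) = int n - 1"
      using order_chains_length[OF n Q False, of xs] by (simp_all add: order_chains_def)
    then show "False" by linarith
  qed
  then show ?thesis using False by (auto simp only: interval_chains_def if_False)
qed (use n in \<open>simp add: interval_chains_def\<close>)

lemma chain_module_above_top:
  assumes "1 \<le> n" "i \<le> n - 1" "Q \<subseteq> wpartitions n"
  shows "chain_module wp_less Q (wp_bot n) (wp_top n i) (int n - 2) = {0}"
  using interval_chains_above_top[OF assms] by (auto simp: chain_module_def)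

lemma boundaries_top:
  assumes n: "1 \<le> n" "i \<le> n - 1" and Q: "Q \<subseteq> wpartitions n"
  shows "boundaries wp_less Q (wp_bot n) (wp_top n i) (int n - 3) = {0}"
proof -
  have "int n - 3 + 1 = int n - 2" by simp
  then show ?thesis by (simp add: boundaries_def chain_module_above_top[OF assms])
qed

lemma residue_class_zero: "residue_class {0} z = {z}"
  by (auto simp: residue_class_def)

lemma interval_chains_max_chain:
  assumes n: "1 \<le> n" "i \<le> n - 1"
  shows "interval_chains wp_less (wpartitions n) (wp_bot n) (wp_top n i) (int n - 3) =
    (\<lambda>W. butlast (tl W)) ` {W. max_chain n i W}"
proof (cases "wp_bot n = wp_top n i")
  case True
  then have n1: "n = 1" using wp_bot_wpartitions(2)[of n] wp_top_wpartitions(2)[OF n] by simp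
  have "max_chain n i [wp_bot n]" using n1 True wp_bot_wpartitions(1)[of n] by (simp add: max_chain_def)
  moreover have "butlast (tl W) = []" if "max_chain n i W" for W
    using max_chain_cases[OF that] n1 by auto
  ultimately show ?thesis using True n1 by (force simp: interval_chains_def)
next
  case False
  then have n2: "2 \<le> n" using n by (cases "n = 1") (auto simp: wp_bot_def wp_top_def)
  note B = wp_bot_wpartitions(1)[of n] and T = wp_top_wpartitions(1)[OF n]
  have bt: "wp_less (wp_bot n) (wp_top n i)" using wp_bot_le[OF T] False by (simp add: wp_less_def)
  have eq: "sorted_wrt wp_less xs \<and> set xs \<subseteq> open_interval wp_less (wpartitions n) (wp_bot n) (wp_top n i) \<and>
      int (length xs) = int n - 3 + 1 \<longleftrightarrow> max_chain n i (wp_bot n # xs @ [wp_top n i])" for xs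
    using bt B T n2 by (auto simp: max_chain_def open_interval_def sorted_wrt_append)
  have "xs \<in> (\<lambda>W. butlast (tl W)) ` {W. max_chain n i W} \<longleftrightarrow> max_chain n i (wp_bot n # xs @ [wp_top n i])" for xs
  proof
    assume "xs \<in> (\<lambda>W. butlast (tl W)) ` {W. max_chain n i W}"
    then obtain W where W: "max_chain n i W" "xs = butlast (tl W)" by blast
    then show "max_chain n i (wp_bot n # xs @ [wp_top n i])" using max_chain_cases[OF W(1)] n2 by auto
  next
    assume "max_chain n i (wp_bot n # xs @ [wp_top n i])"
    then show "xs \<in> (\<lambda>W. butlast (tl W)) ` {W. max_chain n i W}"
      by (intro image_eqI[of _ _ "wp_bot n # xs @ [wp_top n i]"]) auto
  qed
  then show ?thesis using eq False unfolding interval_chains_def order_chains_def by auto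
qed

lemma tree_poset_wpartitions: "rooted_tree {1..n} T \<Longrightarrow> tree_poset n T \<subseteq> wpartitions n"
  using forest_wpartitions by (auto simp: tree_poset_def)

text \<open>With no boundaries in this degree, homology classes are single cycles, and being
  fundamental means that every cycle is an integer multiple.\<close>

lemma fundamental_cycle_eq:
  assumes n: "1 \<le> n" "i \<le> n - 1" and T: "T \<in> rooted_trees n i"
  shows "fundamental_cycle n T z \<longleftrightarrow>
    z \<in> cycles wp_less (tree_poset n T) (wp_bot n) (wp_top n i) (int n - 3) \<and>
    cycles wp_less (tree_poset n T) (wp_bot n) (wp_top n i) (int n - 3) = range (\<lambda>k. scale k z)"
proof -
  have RT: "rooted_tree {1..n} T" using T by (simp add: rooted_trees_def)
  note b = boundaries_top[OF n tree_poset_wpartitions[OF RT]]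
  have "(\<lambda>z. {z}) ` A = range (\<lambda>k. {scale k z}) \<longleftrightarrow> A = range (\<lambda>k. scale k z)" for A
  proof -
    have "range (\<lambda>k. {scale k z}) = (\<lambda>z. {z}) ` range (\<lambda>k. scale k z)" by (simp add: image_image)
    moreover have "inj (\<lambda>z. {z} :: 'b set)" by (auto simp: inj_def)
    ultimately show ?thesis by (simp add: inj_image_eq_iff)
  qed
  then show ?thesis
    unfolding fundamental_cycle_def Let_def forest_empty forest_full[OF n(1) T] homology_def b
      residue_class_zero by simp
qed

lemma fundamental_cycle_support:
  assumes n: "1 \<le> n" "i \<le> n - 1" and T: "T \<in> rooted_trees n i" and z: "fundamental_cycle n T z"
  shows "z \<in> cycles wp_less (wpartitions n) (wp_bot n) (wp_top n i) (int n - 3)"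
    "xs \<in> Poly_Mapping.keys z \<Longrightarrow> set xs \<subseteq> tree_poset n T"
proof -
  have RT: "rooted_tree {1..n} T" using T by (simp add: rooted_trees_def)
  have c: "z \<in> cycles wp_less (tree_poset n T) (wp_bot n) (wp_top n i) (int n - 3)"
    using z fundamental_cycle_eq[OF n T] by blast
  have "open_interval wp_less (tree_poset n T) x y \<subseteq> open_interval wp_less (wpartitions n) x y" for x y
    using tree_poset_wpartitions[OF RT] by (auto simp: open_interval_def)
  then have "interval_chains wp_less (tree_poset n T) x y r \<subseteq> interval_chains wp_less (wpartitions n) x y r" for x y r
    unfolding interval_chains_def order_chains_def by auto
  then show "z \<in> cycles wp_less (wpartitions n) (wp_bot n) (wp_top n i) (int n - 3)"
    using c unfolding cycles_def chain_module_def by blast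
  have "set xs \<subseteq> tree_poset n T" if "xs \<in> interval_chains wp_less (tree_poset n T) x y r" for x y r
    using that by (auto simp: interval_chains_def order_chains_def open_interval_def split: if_splits)
  then show "xs \<in> Poly_Mapping.keys z \<Longrightarrow> set xs \<subseteq> tree_poset n T"
    using c by (auto simp: cycles_def chain_module_def)
qed

lemma sphere_cycle_in_cycles:
  assumes n: "1 \<le> n" "i \<le> n - 1" and T: "T \<in> rooted_trees n i"
    and es: "distinct es" "set es = T" "length es + 1 = n"
  shows "sphere_cycle n es \<in> cycles wp_less (tree_poset n T) (wp_bot n) (wp_top n i) (int n - 3)"
proof -
  have RT: "rooted_tree {1..n} T" using T by (simp add: rooted_trees_def)
  have "perm_chain n es p \<in> interval_chains wp_less (tree_poset n T) (wp_bot n) (wp_top n i) (int n - 3)"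
    if p: "p permutes {..<length es}" for p
  proof (cases "wp_bot n = wp_top n i")
    case True
    then have "n = 1" using wp_bot_wpartitions(2)[of n] wp_top_wpartitions(2)[OF n] by simp
    then show ?thesis using True es(3) by (simp add: interval_chains_def perm_chain_def)
  next
    case False
    let ?S = "\<lambda>k. (\<lambda>j. es ! p j) ` {..<k}"
    note S = perm_set_prefix[OF es(1) p]
    have n2: "2 \<le> n" using False n by (cases "n = 1") (auto simp: wp_bot_def wp_top_def)
    have strict: "?S k \<subset> ?S k'" if "k < k'" "k' \<le> length es" for k k'
    proof -
      have "?S k \<subseteq> ?S k'" using that by auto
      moreover have "card (?S k) \<noteq> card (?S k')" using S(2)[of k] S(2)[of k'] that by simp
      ultimately show ?thesis by auto
    qed
    have less: "wp_less (forest_wpartition n (?S k)) (forest_wpartition n (?S k'))" if "k < k'" "k' \<le> length es" for k k'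
      by (rule forest_less[OF RT strict[OF that]]) (use S(1)[of k'] that es(2) in auto)
    have full: "?S (length es) = T"
      using S(1)[of "length es"] S(2)[of "length es"] es distinct_card[OF es(1)]
      by (metis card_subset_eq List.finite_set order_refl)
    have bot: "wp_bot n = forest_wpartition n (?S 0)" by (simp add: forest_empty)
    have top: "wp_top n i = forest_wpartition n (?S (length es))" using full forest_full[OF n(1) T] by simp
    have "sorted_wrt wp_less (perm_chain n es p)"
      unfolding perm_chain_def sorted_wrt_map
      by (rule sorted_wrt_mono_rel[OF _ sorted_wrt_upt]) (use less in auto)
    moreover have "set (perm_chain n es p) \<subseteq> open_interval wp_less (tree_poset n T) (wp_bot n) (wp_top n i)"
    proof
      fix X assume "X \<in> set (perm_chain n es p)"
      then obtain k where k: "1 \<le> k" "k < length es" "X = forest_wpartition n (?S k)" by (auto simp: perm_chain_def)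
      have "X \<in> tree_poset n T" using S(1)[of k] k es(2) by (auto simp: tree_poset_def)
      moreover have "wp_less (wp_bot n) X" unfolding bot k(3) by (rule less) (use k in auto)
      moreover have "wp_less X (wp_top n i)" unfolding top k(3) by (rule less) (use k in auto)
      ultimately show "X \<in> open_interval wp_less (tree_poset n T) (wp_bot n) (wp_top n i)"
        by (simp add: open_interval_def)
    qed
    moreover have "int (length (perm_chain n es p)) = int n - 3 + 1" using es(3) n2 by (simp add: perm_chain_def)
    ultimately show ?thesis using False by (simp add: interval_chains_def order_chains_def)
  qed
  then have "Poly_Mapping.keys (sphere_cycle n es) \<subseteq> interval_chains wp_less (tree_poset n T) (wp_bot n) (wp_top n i) (int n - 3)"
    unfolding sphere_cycle_def using keys_sum by (fastforce split: if_splits)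
  then show ?thesis using sphere_cycle_boundary by (simp add: cycles_def chain_module_def)
qed

text \<open>The identity ordering of \<open>edge_list t\<close> gives the chain of \<open>t\<close>,
  where \<open>sphere_cycle\<close> has coefficient 1. As \<open>sphere_cycle\<close> is an integer
  multiple of \<open>z\<close>, the coefficient of \<open>z\<close> there divides 1.\<close>

theorem fundamental_cycle_coeff:
  assumes n: "1 \<le> n" "i \<le> n - 1" and t: "t \<in> liu_trees n i" and z: "fundamental_cycle n (tree_edges t) z"
  shows "\<bar>Poly_Mapping.lookup z (proper_tree_chain n i t)\<bar> = 1"
proof -
  have T: "tree_edges t \<in> rooted_trees n i" using bij_betw_tree_edges t by (auto simp: bij_betw_def)
  have b: "t \<in> bicolored_trees n i" "liu_lyndon t" "distinct (leaves t)"
    using t by (auto simp: liu_trees_def bicolored_trees_def)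
  let ?es = "edge_list t"
  note es = distinct_edge_list[OF b(2,3)] set_edge_list[of t] tree_chain_forest(2)[OF n(1) t]
  have RT: "rooted_tree {1..n} (set ?es)" using T by (simp add: es rooted_trees_def)
  have "proper_tree_chain n i t = butlast (tl (map (\<lambda>k. forest_wpartition n (set (take k ?es))) [0..<n]))"
    unfolding proper_tree_chain_eq[OF n b(1)] tree_chain_forest(1)[OF n(1) t] ..
  also have "\<dots> = map (\<lambda>k. forest_wpartition n (set (take k ?es))) [1..<length ?es]"
  proof -
    have "butlast (tl (map f [0..<m + 1])) = map f [1..<m]" for m and f :: "nat \<Rightarrow> wpartition"
      by (cases "1 \<le> m") (simp_all add: map_tl[symmetric])
    then show ?thesis using es(3) by metis
  qed
  also have "\<dots> = perm_chain n ?es id"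
    unfolding perm_chain_def
  proof (rule map_cong[OF refl])
    fix k assume "k \<in> set [1..<length ?es]"
    then have "set (take k ?es) = (\<lambda>j. ?es ! id j) ` {..<k}" by (simp add: nth_image lessThan_atLeast0)
    then show "forest_wpartition n (set (take k ?es)) = forest_wpartition n ((\<lambda>j. ?es ! id j) ` {..<k})" by simp
  qed
  finally have pc: "proper_tree_chain n i t = perm_chain n ?es id" .
  have "sphere_cycle n ?es \<in> range (\<lambda>k. scale k z)"
    using sphere_cycle_in_cycles[OF n T es] z fundamental_cycle_eq[OF n T] by metis
  then obtain k where "sphere_cycle n ?es = scale k z" by blast
  then have "k * Poly_Mapping.lookup z (perm_chain n ?es id) = 1"
    using sphere_cycle_coeff[OF es(1) RT] by simp
  then show ?thesis unfolding pc by (metis abs_of_pos mult.commute zmult_eq_1_iff abs_minus abs_one)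
qed

section \<open>The two bases\<close>

lemma lookup_int_coeffs [simp]: "Poly_Mapping.lookup (int_coeffs z) k = of_int (Poly_Mapping.lookup z k)"
  by (simp add: int_coeffs_def map.rep_eq when_def)

lemma scale_simps:
  "scale c (f + g) = scale c f + scale c g" "scale (c * d) f = scale c (scale d f)" "scale 1 f = f"
  "scale c (f - g) = scale c f - scale c g" "scale (- 1) f = - f" "scale c 0 = 0" "scale 0 f = 0"
  "scale (c + d) f = scale c f + scale d f" "scale c (Poly_Mapping.single k d) = Poly_Mapping.single k (c * d)"
  by (rule poly_mapping_eqI; simp add: lookup_add lookup_minus lookup_uminus lookup_single when_def algebra_simps)+

lemma scale_sum: "scale c (sum f A) = (\<Sum>a \<in> A. scale c (f a))"
  by (induction A rule: infinite_finite_induct) (auto simp: scale_simps)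

lemma boundary_scale: "boundary (scale c f) = scale c (boundary f)"
proof -
  have "Poly_Mapping.keys (scale c f) \<subseteq> Poly_Mapping.keys f" by (auto simp: in_keys_iff)
  then show ?thesis
    using boundary_superset[of "Poly_Mapping.keys f" "scale c f"] boundary_superset[of "Poly_Mapping.keys f" f]
    by (simp add: scale_sum scale_simps mult.left_commute)
qed

lemma int_coeffs_sum: "int_coeffs (sum f A) = (\<Sum>a \<in> A. int_coeffs (f a))"
  by (rule poly_mapping_eqI) (simp add: lookup_sum)

lemma boundary_int_coeffs:
  fixes z :: "'a list \<Rightarrow>\<^sub>0 int"
  shows "boundary (int_coeffs z :: 'a list \<Rightarrow>\<^sub>0 'r::comm_ring_1) = int_coeffs (boundary z)"
proof -
  have "Poly_Mapping.keys (int_coeffs z :: 'a list \<Rightarrow>\<^sub>0 'r) \<subseteq> Poly_Mapping.keys z" by (auto simp: in_keys_iff)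
  moreover have "(int_coeffs (Poly_Mapping.single k c) :: 'a list \<Rightarrow>\<^sub>0 'r) = Poly_Mapping.single k (of_int c)" for k c
    by (rule poly_mapping_eqI) (simp add: lookup_single when_def)
  ultimately show ?thesis
    using boundary_superset[of "Poly_Mapping.keys z" "int_coeffs z :: 'a list \<Rightarrow>\<^sub>0 'r"] boundary_superset[of "Poly_Mapping.keys z" z]
    by (simp add: int_coeffs_sum)
qed

lemma coboundary_superset:
  assumes "finite A" "Poly_Mapping.keys f \<subseteq> A"
  shows "coboundary lt Q f = (\<Sum>xs \<in> A. \<Sum>j \<le> length xs. \<Sum>z \<in> gap lt Q xs j.
     Poly_Mapping.single (take j xs @ z # drop j xs) ((- 1) ^ j * Poly_Mapping.lookup f xs))"
  unfolding coboundary_def using assms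
  by (intro sum.mono_neutral_left) (auto simp: in_keys_iff)

lemma coboundary_add: "coboundary lt Q (f + g) = coboundary lt Q f + coboundary lt Q g"
proof -
  let ?A = "Poly_Mapping.keys f \<union> Poly_Mapping.keys g"
  have "Poly_Mapping.keys (f + g) \<subseteq> ?A" by (rule keys_add)
  then show ?thesis
    using coboundary_superset[of ?A f] coboundary_superset[of ?A g] coboundary_superset[of ?A "f + g"]
    by (simp add: lookup_add distrib_left single_add sum.distrib)
qed

lemma coboundary_scale: "coboundary lt Q (scale c f) = scale c (coboundary lt Q f)"
proof -
  have "Poly_Mapping.keys (scale c f) \<subseteq> Poly_Mapping.keys f" by (auto simp: in_keys_iff)
  then show ?thesis
    using coboundary_superset[of "Poly_Mapping.keys f" "scale c f"] coboundary_superset[of "Poly_Mapping.keys f" f]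
    by (simp add: scale_sum scale_simps mult.left_commute)
qed

lemma coboundary_single:
  "coboundary lt Q (Poly_Mapping.single xs c) = (\<Sum>j \<le> length xs. \<Sum>z \<in> gap lt Q xs j.
     Poly_Mapping.single (take j xs @ z # drop j xs) ((- 1) ^ j * c))"
  using coboundary_superset[of "{xs}" "Poly_Mapping.single xs c"] by simp

lemma lincomb_superset:
  assumes "finite A" "Poly_Mapping.keys a \<subseteq> A"
  shows "lincomb a z = (\<Sum>k \<in> A. scale (Poly_Mapping.lookup a k) (z k))"
  unfolding lincomb_def using assms
  by (intro sum.mono_neutral_left) (auto simp: in_keys_iff scale_simps)

lemma lincomb_add: "lincomb (a + b) z = lincomb a z + lincomb b z"
proof -
  let ?A = "Poly_Mapping.keys a \<union> Poly_Mapping.keys b"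
  have "Poly_Mapping.keys (a + b) \<subseteq> ?A" by (rule keys_add)
  then show ?thesis
    using lincomb_superset[of ?A a z] lincomb_superset[of ?A b z] lincomb_superset[of ?A "a + b" z]
    by (simp add: lookup_add scale_simps sum.distrib)
qed

lemma lincomb_scale: "lincomb (scale c a) z = scale c (lincomb a z)"
proof -
  have "Poly_Mapping.keys (scale c a) \<subseteq> Poly_Mapping.keys a" by (auto simp: in_keys_iff)
  then show ?thesis
    using lincomb_superset[of "Poly_Mapping.keys a" "scale c a" z] lincomb_superset[of "Poly_Mapping.keys a" a z]
    by (simp add: scale_sum scale_simps)
qed

lemma lincomb_diff: "lincomb (a - b) z = lincomb a z - lincomb b z"
  using lincomb_add[of a "scale (- 1) b" z] unfolding lincomb_scale by (simp add: scale_simps)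

lemma lincomb_single: "lincomb (Poly_Mapping.single k c) z = scale c (z k)"
  using lincomb_superset[of "{k}" "Poly_Mapping.single k c" z] by simp

section \<open>Pairing of cycles with cochains\<close>

definition pairing :: "('c \<Rightarrow>\<^sub>0 'r::comm_ring_1) \<Rightarrow> ('c \<Rightarrow>\<^sub>0 'r) \<Rightarrow> 'r" where
  "pairing z f = (\<Sum>x \<in> Poly_Mapping.keys f. Poly_Mapping.lookup f x * Poly_Mapping.lookup z x)"

lemma pairing_superset:
  assumes "finite A" "Poly_Mapping.keys f \<subseteq> A"
  shows "pairing z f = (\<Sum>x \<in> A. Poly_Mapping.lookup f x * Poly_Mapping.lookup z x)"
  unfolding pairing_def using assms
  by (intro sum.mono_neutral_left) (auto simp: in_keys_iff)

lemma pairing_add: "pairing z (f + g) = pairing z f + pairing z g"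
proof -
  let ?A = "Poly_Mapping.keys f \<union> Poly_Mapping.keys g"
  have "Poly_Mapping.keys (f + g) \<subseteq> ?A" by (rule keys_add)
  then show ?thesis
    using pairing_superset[of ?A f z] pairing_superset[of ?A g z] pairing_superset[of ?A "f + g" z]
    by (simp add: lookup_add distrib_right sum.distrib)
qed

lemma pairing_zero: "pairing z 0 = 0"
  by (simp add: pairing_def)

lemma pairing_sum: "pairing z (sum f A) = (\<Sum>a \<in> A. pairing z (f a))"
  by (induction A rule: infinite_finite_induct) (auto simp: pairing_add pairing_zero)

lemma pairing_single: "pairing z (Poly_Mapping.single x c) = c * Poly_Mapping.lookup z x"
  using pairing_superset[of "{x}" "Poly_Mapping.single x c" z] by simp

lemma pairing_scale: "pairing z (scale c f) = c * pairing z f"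
proof -
  have "Poly_Mapping.keys (scale c f) \<subseteq> Poly_Mapping.keys f" by (auto simp: in_keys_iff)
  then show ?thesis
    using pairing_superset[of "Poly_Mapping.keys f" "scale c f" z] by (simp add: pairing_def sum_distrib_left mult.assoc)
qed

lemma poly_mapping_sum_single:
  "f = (\<Sum>x \<in> Poly_Mapping.keys f. scale (Poly_Mapping.lookup f x) (Poly_Mapping.single x 1))"
  by (rule poly_mapping_eqI)
    (simp add: lookup_sum lookup_single when_def in_keys_iff if_distrib[of "(*) _"] cong: if_cong)

lemma delete_insert:
  assumes "k < length xs" "take k xs @ drop (Suc k) xs = ys"
  shows "xs = take k ys @ xs ! k # drop k ys" "length xs = Suc (length ys)"
  using assms id_take_nth_drop[of k xs] by auto

text \<open>Inserting an element into \<open>ys\<close> at position \<open>k\<close> to obtain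
  \<open>xs\<close> is the same as deleting position \<open>k\<close> of \<open>xs\<close> to obtain
  \<open>ys\<close>, with the same sign. So the pairing with the coboundary of a single chain
  \<open>ys\<close> is the coefficient of \<open>ys\<close> in \<open>boundary z\<close>.\<close>

lemma pairing_coboundary:
  fixes z f :: "'a list \<Rightarrow>\<^sub>0 'r::comm_ring_1"
  assumes fin: "finite P" and z: "z \<in> cycles lt P x y (r + 1)" and f: "f \<in> chain_module lt P x y r"
    and ne: "x \<noteq> y"
  shows "pairing z (coboundary lt (open_interval lt P x y) f) = 0"
proof -
  let ?Q = "open_interval lt P x y"
  have finQ: "finite ?Q" using fin by (simp add: open_interval_def)
  have keys: "\<And>xs. xs \<in> Poly_Mapping.keys z \<Longrightarrow> sorted_wrt lt xs \<and> set xs \<subseteq> ?Q \<and> int (length xs) = r + 2"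
    using z ne by (auto simp: cycles_def chain_module_def interval_chains_def order_chains_def)
  have main: "pairing z (coboundary lt ?Q (Poly_Mapping.single ys 1)) = 0" if ys: "int (length ys) = r + 1" for ys
  proof -
    let ?D = "\<lambda>k. {xs \<in> Poly_Mapping.keys z. k < length xs \<and> take k xs @ drop (Suc k) xs = ys}"
    have step: "(\<Sum>w \<in> gap lt ?Q ys k. Poly_Mapping.lookup z (take k ys @ w # drop k ys)) =
        (\<Sum>xs \<in> ?D k. Poly_Mapping.lookup z xs)" if k: "k \<le> length ys" for k
    proof -
      let ?g = "\<lambda>w. take k ys @ w # drop k ys"
      have nth: "?g w ! k = w" for w using k by (simp add: nth_append)
      have "inj_on ?g (gap lt ?Q ys k)" by (auto simp: inj_on_def)
      then have "(\<Sum>w \<in> gap lt ?Q ys k. Poly_Mapping.lookup z (?g w)) =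
          (\<Sum>xs \<in> ?g ` gap lt ?Q ys k. Poly_Mapping.lookup z xs)" by (simp add: sum.reindex)
      also have "\<dots> = (\<Sum>xs \<in> ?D k. Poly_Mapping.lookup z xs)"
      proof (rule sum.mono_neutral_right)
        show "finite (?g ` gap lt ?Q ys k)" using finQ by (simp add: gap_def)
        show "?D k \<subseteq> ?g ` gap lt ?Q ys k"
        proof
          fix xs assume "xs \<in> ?D k"
          then have xs: "xs \<in> Poly_Mapping.keys z" "k < length xs" "take k xs @ drop (Suc k) xs = ys" by auto
          note eq = delete_insert[OF xs(2,3)]
          have s: "sorted_wrt lt xs" "set xs \<subseteq> ?Q" using keys[OF xs(1)] by auto
          have "xs ! k \<in> ?Q" using s(2) xs(2) by (meson nth_mem subsetD)
          moreover have "lt (ys ! (k - 1)) (xs ! k)" if "0 < k"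
          proof -
            have "ys ! (k - 1) = xs ! (k - 1)" using xs(2) that by (simp add: xs(3)[symmetric] nth_append)
            then show ?thesis using sorted_wrt_nth_less[OF s(1), of "k - 1" k] that xs(2) by simp
          qed
          moreover have "lt (xs ! k) (ys ! k)" if "k < length ys"
          proof -
            have "ys ! k = xs ! Suc k" by (subst eq(1)) (use that in \<open>simp add: nth_append\<close>)
            then show ?thesis using sorted_wrt_nth_less[OF s(1), of k "Suc k"] that eq(2) by simp
          qed
          ultimately have "xs ! k \<in> gap lt ?Q ys k" by (simp add: gap_def)
          then show "xs \<in> ?g ` gap lt ?Q ys k" using eq(1) by blast
        qed
        show "\<forall>xs \<in> ?g ` gap lt ?Q ys k - ?D k. Poly_Mapping.lookup z xs = 0"
          using k by (auto simp: in_keys_iff)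
      qed
      finally show ?thesis .
    qed
    have "pairing z (coboundary lt ?Q (Poly_Mapping.single ys 1)) =
        (\<Sum>k \<le> length ys. (- 1) ^ k * (\<Sum>w \<in> gap lt ?Q ys k. Poly_Mapping.lookup z (take k ys @ w # drop k ys)))"
      unfolding coboundary_single pairing_sum pairing_single by (simp add: sum_distrib_left)
    also have "\<dots> = (\<Sum>k \<le> length ys. \<Sum>xs \<in> ?D k. (- 1) ^ k * Poly_Mapping.lookup z xs)"
      by (rule sum.cong[OF refl]) (simp add: step sum_distrib_left)
    also have "\<dots> = (\<Sum>k \<le> length ys. \<Sum>xs \<in> Poly_Mapping.keys z.
        if take k xs @ drop (Suc k) xs = ys then (- 1) ^ k * Poly_Mapping.lookup z xs else 0)"
    proof (rule sum.cong[OF refl])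
      fix k assume k: "k \<in> {..length ys}"
      have "?D k = {xs \<in> Poly_Mapping.keys z. take k xs @ drop (Suc k) xs = ys}"
        using keys ys k by fastforce
      then show "(\<Sum>xs \<in> ?D k. (- 1) ^ k * Poly_Mapping.lookup z xs) = (\<Sum>xs \<in> Poly_Mapping.keys z.
        if take k xs @ drop (Suc k) xs = ys then (- 1) ^ k * Poly_Mapping.lookup z xs else 0)"
        by (simp add: sum.inter_filter)
    qed
    also have "\<dots> = (\<Sum>xs \<in> Poly_Mapping.keys z. \<Sum>k < length xs.
        if take k xs @ drop (Suc k) xs = ys then (- 1) ^ k * Poly_Mapping.lookup z xs else 0)"
    proof (subst sum.swap, rule sum.cong[OF refl])
      fix xs assume "xs \<in> Poly_Mapping.keys z"
      then have "int (length xs) = int (Suc (length ys))" using keys ys by fastforce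
      then have "{..length ys} = {..<length xs}" by auto
      then show "(\<Sum>k \<le> length ys. if take k xs @ drop (Suc k) xs = ys then (- 1) ^ k * Poly_Mapping.lookup z xs else 0) =
        (\<Sum>k < length xs. if take k xs @ drop (Suc k) xs = ys then (- 1) ^ k * Poly_Mapping.lookup z xs else 0)"
        by simp
    qed
    also have "\<dots> = Poly_Mapping.lookup (boundary z) ys"
      unfolding boundary_def lookup_sum lookup_single when_def by simp
    also have "\<dots> = 0" using z by (simp add: cycles_def)
    finally show ?thesis .
  qed
  have "coboundary lt ?Q f = (\<Sum>xs \<in> Poly_Mapping.keys f.
      scale (Poly_Mapping.lookup f xs) (coboundary lt ?Q (Poly_Mapping.single xs 1)))"
  proof -
    have s: "coboundary lt ?Q (sum h A) = (\<Sum>a \<in> A. coboundary lt ?Q (h a))" for h :: "'a list \<Rightarrow> 'a list \<Rightarrow>\<^sub>0 'r" and A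
      by (induction A rule: infinite_finite_induct) (auto simp: coboundary_add, auto simp: coboundary_def)
    have "coboundary lt ?Q f = coboundary lt ?Q
        (\<Sum>xs \<in> Poly_Mapping.keys f. scale (Poly_Mapping.lookup f xs) (Poly_Mapping.single xs 1))"
      by (rule arg_cong[OF poly_mapping_sum_single])
    then show ?thesis by (simp only: s coboundary_scale)
  qed
  moreover have "int (length xs) = r + 1" if "xs \<in> Poly_Mapping.keys f" for xs
    using that f ne by (auto simp: chain_module_def interval_chains_def order_chains_def)
  ultimately show ?thesis using main by (simp add: pairing_sum pairing_scale)
qed

lemma chain_module_scale: "f \<in> chain_module lt P x y r \<Longrightarrow> scale c f \<in> chain_module lt P x y r"
proof -
  have "Poly_Mapping.keys (scale c f) \<subseteq> Poly_Mapping.keys f" by (auto simp: in_keys_iff)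
  then show "f \<in> chain_module lt P x y r \<Longrightarrow> scale c f \<in> chain_module lt P x y r"
    by (auto simp: chain_module_def)
qed

lemma chain_module_add:
  "f \<in> chain_module lt P x y r \<Longrightarrow> g \<in> chain_module lt P x y r \<Longrightarrow> f + g \<in> chain_module lt P x y r"
  unfolding chain_module_def using keys_add[of f g] by blast

lemma coboundaries_add:
  assumes "f \<in> coboundaries lt P x y r" "g \<in> coboundaries lt P x y r"
  shows "f + g \<in> coboundaries lt P x y r"
proof -
  obtain f' g' where "f' \<in> chain_module lt P x y (r - 1)" "f = coboundary lt (open_interval lt P x y) f'"
    "g' \<in> chain_module lt P x y (r - 1)" "g = coboundary lt (open_interval lt P x y) g'"
    using assms unfolding coboundaries_def by blast
  then show ?thesis unfolding coboundaries_def
    by (intro image_eqI[of _ _ "f' + g'"]) (simp_all add: coboundary_add chain_module_add)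
qed

lemma coboundaries_scale:
  assumes "f \<in> coboundaries lt P x y r"
  shows "scale c f \<in> coboundaries lt P x y r"
proof -
  obtain f' where "f' \<in> chain_module lt P x y (r - 1)" "f = coboundary lt (open_interval lt P x y) f'"
    using assms unfolding coboundaries_def by blast
  then show ?thesis unfolding coboundaries_def
    by (intro image_eqI[of _ _ "scale c f'"]) (simp_all add: coboundary_scale chain_module_scale)
qed

lemma cycles_add: "f \<in> cycles lt P x y r \<Longrightarrow> g \<in> cycles lt P x y r \<Longrightarrow> f + g \<in> cycles lt P x y r"
  by (simp add: cycles_def chain_module_add boundary_add)

lemma cycles_scale: "f \<in> cycles lt P x y r \<Longrightarrow> scale c f \<in> cycles lt P x y r"
  by (simp add: cycles_def chain_module_scale boundary_scale scale_simps)

lemma cycles_diff: "f \<in> cycles lt P x y r \<Longrightarrow> g \<in> cycles lt P x y r \<Longrightarrow> f - g \<in> cycles lt P x y r"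
  using cycles_add[of f lt P x y r "scale (- 1) g"] cycles_scale[of g lt P x y r "- 1"] by (simp add: scale_simps)

lemma sum_closed:
  assumes "0 \<in> M" "\<And>f g. f \<in> M \<Longrightarrow> g \<in> M \<Longrightarrow> f + g \<in> M"
  shows "(\<And>a. a \<in> A \<Longrightarrow> h a \<in> M) \<Longrightarrow> sum h A \<in> M"
proof (induction A rule: infinite_finite_induct)
  case (insert a A)
  then show ?case by (simp add: assms(2))
qed (simp_all add: assms(1))

lemma cycles_lincomb:
  assumes "\<And>k. k \<in> Poly_Mapping.keys a \<Longrightarrow> z k \<in> cycles lt P x y r"
  shows "lincomb a z \<in> cycles lt P x y r"
  unfolding lincomb_def
proof (rule sum_closed)
  show "0 \<in> cycles lt P x y r" by (simp add: cycles_def chain_module_def)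
qed (use assms in \<open>simp_all add: cycles_add cycles_scale\<close>)

lemma ex_poly_mapping:
  fixes f :: "'a \<Rightarrow> 'r::comm_ring_1"
  assumes "finite A"
  shows "\<exists>a. Poly_Mapping.keys a \<subseteq> A \<and> (\<forall>k \<in> A. Poly_Mapping.lookup a k = f k)"
proof -
  let ?a = "\<Sum>k \<in> A. Poly_Mapping.single k (f k)"
  have "Poly_Mapping.lookup ?a k = (if k \<in> A then f k else 0)" for k
    using assms by (simp add: lookup_sum lookup_single when_def)
  then show ?thesis by (intro exI[of _ ?a]) (auto simp: in_keys_iff split: if_splits)
qed


section \<open>Triangular systems over a commutative ring\<close>

lemma triangular_source:
  fixes M :: "'i \<Rightarrow> 'i \<Rightarrow> 'r::comm_ring_1"
  assumes fin: "finite I" and ne: "I \<noteq> {}"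
    and rel: "\<And>t s. t \<in> I \<Longrightarrow> s \<in> I \<Longrightarrow> M t s \<noteq> 0 \<Longrightarrow> (t, s) \<in> R"
    and antisym: "\<And>t s. t \<in> I \<Longrightarrow> s \<in> I \<Longrightarrow> (t, s) \<in> R\<^sup>* \<Longrightarrow> (s, t) \<in> R\<^sup>* \<Longrightarrow> t = s"
  obtains m where "m \<in> I" "\<And>t. t \<in> I - {m} \<Longrightarrow> M t m = 0"
proof -
  let ?R = "{(t, s) \<in> I \<times> I. t \<noteq> s \<and> M t s \<noteq> 0}"
  have sub: "?R \<subseteq> R" using rel by blast
  have "acyclic ?R" unfolding acyclic_def
  proof (intro allI notI)
    fix x assume "(x, x) \<in> ?R\<^sup>+"
    then obtain y where y: "(x, y) \<in> ?R" "(y, x) \<in> ?R\<^sup>*" by (meson tranclD)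
    then have "(x, y) \<in> R\<^sup>*" "(y, x) \<in> R\<^sup>*" using sub rtrancl_mono[OF sub] by blast+
    then show False using antisym y(1) by blast
  qed
  moreover have "finite ?R" by (rule finite_subset[of _ "I \<times> I"]) (use fin in auto)
  ultimately have "wf ?R" by (intro finite_acyclic_wf)
  moreover obtain x where "x \<in> I" using ne by blast
  ultimately obtain m where m: "m \<in> I" "\<And>t. (t, m) \<in> ?R \<Longrightarrow> t \<notin> I" by (rule wfE_min) blast
  show ?thesis by (rule that[OF m(1)]) (use m in blast)
qed

text \<open>In the column of the source \<open>m\<close> only the diagonal entry can be nonzero. The
  other rows therefore do not involve the unknown at \<open>m\<close>; they are solved by induction,
  and row \<open>m\<close> then determines this unknown. The transposed system begins with column
  \<open>m\<close> instead. Antisymmetry of the closure replaces a linear order.\<close>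

lemma triangular_solve:
  fixes M :: "'i \<Rightarrow> 'i \<Rightarrow> 'r::comm_ring_1"
  assumes "finite I"
    and rel: "\<And>t s. t \<in> I \<Longrightarrow> s \<in> I \<Longrightarrow> M t s \<noteq> 0 \<Longrightarrow> (t, s) \<in> R"
    and antisym: "\<And>t s. t \<in> I \<Longrightarrow> s \<in> I \<Longrightarrow> (t, s) \<in> R\<^sup>* \<Longrightarrow> (s, t) \<in> R\<^sup>* \<Longrightarrow> t = s"
    and diag: "\<And>t. t \<in> I \<Longrightarrow> M t t * M t t = 1"
  shows "(\<exists>a. \<forall>t \<in> I. (\<Sum>s \<in> I. a s * M t s) = b t) \<and>
    (\<forall>a. (\<forall>t \<in> I. (\<Sum>s \<in> I. a s * M t s) = 0) \<longrightarrow> (\<forall>s \<in> I. a s = 0)) \<and>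
    (\<forall>c. (\<forall>s \<in> I. (\<Sum>t \<in> I. c t * M t s) = 0) \<longrightarrow> (\<forall>t \<in> I. c t = 0))"
  using assms
proof (induction "card I" arbitrary: I b rule: less_induct)
  case less
  show ?case
  proof (cases "I = {}")
    case False
    obtain m where m: "m \<in> I" "\<And>t. t \<in> I - {m} \<Longrightarrow> M t m = 0"
      using triangular_source[OF less.prems(1) False less.prems(2,3)] by blast
    let ?J = "I - {m}"
    have J: "card ?J < card I" "finite ?J" using m(1) less.prems(1) card_Diff1_less[of I m] by blast+
    have split: "sum g I = g m + sum g ?J" for g :: "'i \<Rightarrow> 'r" using m(1) less.prems(1) by (simp add: sum.remove)
    have IH: "(\<exists>a. \<forall>t \<in> ?J. (\<Sum>s \<in> ?J. a s * M t s) = b t) \<and>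
      (\<forall>a. (\<forall>t \<in> ?J. (\<Sum>s \<in> ?J. a s * M t s) = 0) \<longrightarrow> (\<forall>s \<in> ?J. a s = 0)) \<and>
      (\<forall>c. (\<forall>s \<in> ?J. (\<Sum>t \<in> ?J. c t * M t s) = 0) \<longrightarrow> (\<forall>t \<in> ?J. c t = 0))" for b
      by (rule less.hyps[OF J]) (use less.prems in blast)+
    have mm: "M m m * M m m = 1" by (rule less.prems(4)[OF m(1)])
    show ?thesis
    proof (intro conjI allI impI)
      obtain a where a: "\<forall>t \<in> ?J. (\<Sum>s \<in> ?J. a s * M t s) = b t" using IH by blast
      \<comment> \<open>The diagonal entry is its own inverse, so this value solves row
        \<open>m\<close>.\<close>
      define a' where "a' = a(m := M m m * (b m - (\<Sum>s \<in> ?J. a s * M m s)))"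
      have rest: "(\<Sum>s \<in> ?J. a' s * M t s) = (\<Sum>s \<in> ?J. a s * M t s)" for t
        by (rule sum.cong) (auto simp: a'_def)
      have "(\<Sum>s \<in> I. a' s * M t s) = b t" if t: "t \<in> I" for t
      proof (cases "t = m")
        case True
        have "a' m * M m m = (M m m * M m m) * (b m - (\<Sum>s \<in> ?J. a s * M m s))" by (simp add: a'_def ac_simps)
        then show ?thesis using True mm split[of "\<lambda>s. a' s * M m s"] rest[of m] by simp
      next
        case False
        then show ?thesis using t a m(2)[of t] split[of "\<lambda>s. a' s * M t s"] rest[of t] by simp
      qed
      then show "\<exists>a. \<forall>t \<in> I. (\<Sum>s \<in> I. a s * M t s) = b t" by blast
    next
      fix a assume a: "\<forall>t \<in> I. (\<Sum>s \<in> I. a s * M t s) = 0"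
      have "(\<Sum>s \<in> ?J. a s * M t s) = 0" if "t \<in> ?J" for t
        using a m(2)[OF that] split[of "\<lambda>s. a s * M t s"] that by simp
      then have z: "\<forall>s \<in> ?J. a s = 0" using IH by blast
      then have "(\<Sum>s \<in> ?J. a s * M m s) = 0" by (intro sum.neutral) simp
      then have "a m * M m m = 0" using a m(1) split[of "\<lambda>s. a s * M m s"] by simp
      then have "a m * (M m m * M m m) = 0" by (simp add: mult.assoc[symmetric])
      then show "\<forall>s \<in> I. a s = 0" using z mm by (metis DiffI mult.right_neutral singletonD)
    next
      fix c assume c: "\<forall>s \<in> I. (\<Sum>t \<in> I. c t * M t s) = 0"
      have "(\<Sum>t \<in> ?J. c t * M t m) = 0" by (intro sum.neutral) (simp add: m(2))
      then have "c m * M m m = 0" using c m(1) split[of "\<lambda>t. c t * M t m"] by simp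
      then have "c m * (M m m * M m m) = 0" by (simp add: mult.assoc[symmetric])
      then have cm: "c m = 0" using mm by simp
      then have "\<forall>s \<in> ?J. (\<Sum>t \<in> ?J. c t * M t s) = 0"
        using c by (simp add: split)
      then have "\<forall>t \<in> ?J. c t = 0" using IH by blast
      then show "\<forall>t \<in> I. c t = 0" using cm by blast
    qed
  qed simp
qed

section \<open>Coboundaries of chains that miss one rank\<close>

lemma max_chain_card:
  assumes n: "1 \<le> n" "i \<le> n - 1" and W: "max_chain n i W" and k: "k < n"
  shows "card (W ! k) + k = n"
proof -
  obtain ms where ms: "full_merges n i ms" "W = merge_chain (wp_bot n) ms"
    using max_chain_full_merges[OF n W] by blast
  have "length W = n" using W by (simp add: max_chain_def)
  then have km: "k \<le> length ms" using k ms(2) by (simp add: merge_chain_length)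
  have "valid_merges (wp_bot n) (take k ms @ drop k ms)" using ms(1) by (simp add: full_merges_def)
  then have "valid_merges (wp_bot n) (take k ms)" unfolding valid_merges_append by blast
  then have "card (run (wp_bot n) (take k ms)) + length (take k ms) = n"
    using valid_merges_run[OF wp_bot_wpartitions(1)] wp_bot_wpartitions(2) by metis
  then show ?thesis using km ms(2) by (simp add: merge_chain_nth)
qed

lemma no_wp_between:
  assumes "X \<in> wpartitions n" "Y \<in> wpartitions n" "Z \<in> wpartitions n" "card X \<le> card Z + 1"
  shows "\<not> (wp_less X Y \<and> wp_less Y Z)"
  using wp_less_card[OF assms(1,2)] wp_less_card[OF assms(2,3)] assms(4) by linarith

text \<open>Adjoining bottom and top turns the two boundary cases of \<open>gap\<close> into the
  general one.\<close>

lemma gap_full_chain: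
  assumes n: "1 \<le> n" "i \<le> n - 1" and V: "V = wp_bot n # ys @ [wp_top n i]" "sorted_wrt wp_less V" "set ys \<subseteq> wpartitions n"
    and k: "k \<le> length ys"
  shows "gap wp_less (open_interval wp_less (wpartitions n) (wp_bot n) (wp_top n i)) ys k =
    {Y \<in> wpartitions n. wp_less (V ! k) Y \<and> wp_less Y (V ! Suc k)}"
proof -
  note B = wp_bot_wpartitions(1)[of n] and T = wp_top_wpartitions(1)[OF n]
  have Vk: "V ! k = (if k = 0 then wp_bot n else ys ! (k - 1))"
    "V ! Suc k = (if k < length ys then ys ! k else wp_top n i)"
    using k by (auto simp: V(1) nth_Cons' nth_append)
  have ys: "ys ! m \<in> wpartitions n \<and> wp_less (wp_bot n) (ys ! m) \<and> wp_less (ys ! m) (wp_top n i)" if "m < length ys" for m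
    using V that by (auto simp: sorted_wrt_append)
  have lo: "wp_less (wp_bot n) Y" if "Y \<in> wpartitions n" "wp_less (V ! k) Y" for Y
    using wp_less_trans[OF B _ that(1), of "ys ! (k - 1)"] ys[of "k - 1"] that k Vk(1) by (cases "k = 0") auto
  have hi: "wp_less Y (wp_top n i)" if "Y \<in> wpartitions n" "wp_less Y (V ! Suc k)" for Y
    using wp_less_trans[OF that(1) _ T, of "ys ! k"] ys[of k] that k Vk(2) by (cases "k < length ys") auto
  show ?thesis
    unfolding gap_def open_interval_def using lo hi Vk by (auto split: if_splits)
qed

text \<open>Neighbours in a maximal chain differ by one block, so nothing fits in between; thus
  every cochain of top degree is a cocycle.\<close>

lemma coboundary_top_zero:
  assumes n: "1 \<le> n" "i \<le> n - 1"
    and f: "f \<in> chain_module wp_less (wpartitions n) (wp_bot n) (wp_top n i) (int n - 3)"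
  shows "coboundary wp_less (open_interval wp_less (wpartitions n) (wp_bot n) (wp_top n i)) f = 0"
proof -
  let ?Q = "open_interval wp_less (wpartitions n) (wp_bot n) (wp_top n i)"
  have "gap wp_less ?Q xs k = {}" if xs: "xs \<in> Poly_Mapping.keys f" and k: "k \<le> length xs" for xs k
  proof -
    have "xs \<in> interval_chains wp_less (wpartitions n) (wp_bot n) (wp_top n i) (int n - 3)"
      using f xs by (auto simp: chain_module_def)
    then obtain W where W: "max_chain n i W" "xs = butlast (tl W)"
      unfolding interval_chains_max_chain[OF n] by blast
    from max_chain_cases[OF W(1)] show ?thesis
    proof
      assume a: "n = 1 \<and> W = [wp_bot n] \<and> wp_bot n = wp_top n i"
      have "?Q = {}"
        using no_wp_between[OF wp_bot_wpartitions(1)[of n] _ wp_bot_wpartitions(1)[of n]] a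
        unfolding open_interval_def by fastforce
      then show ?thesis by (simp add: gap_def)
    next
      assume a: "2 \<le> n \<and> W = wp_bot n # butlast (tl W) @ [wp_top n i]"
      then have eq: "W = wp_bot n # xs @ [wp_top n i]" using W(2) by simp
      have WW: "sorted_wrt wp_less W" "set W \<subseteq> wpartitions n" "length W = n" using W(1) by (auto simp: max_chain_def)
      have kn: "Suc k < n" using k WW(3) eq by simp
      have "card (W ! k) \<le> card (W ! Suc k) + 1"
        using max_chain_card[OF n W(1), of k] max_chain_card[OF n W(1), of "Suc k"] kn by simp
      moreover have "W ! k \<in> wpartitions n" "W ! Suc k \<in> wpartitions n" using WW kn by auto
      moreover have "set xs \<subseteq> wpartitions n" using WW(2) eq by auto
      ultimately show ?thesis
        using gap_full_chain[OF n eq WW(1) _ k] no_wp_between by blast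
    qed
  qed
  then show ?thesis by (simp add: coboundary_def)
qed


lemma finite_wpartitions: "finite (wpartitions n)"
proof -
  have "wpartitions n \<subseteq> Pow (Pow {1..n} \<times> {..n})"
  proof
    fix X assume X: "X \<in> wpartitions n"
    have "p \<in> Pow {1..n} \<times> {..n}" if p: "p \<in> X" for p
    proof -
      have "fst p \<subseteq> {1..n}" by (rule wpartitionsD(7)[OF X p])
      moreover have "snd p \<le> n"
        using wpartitionsD(3)[OF X p] card_mono[OF _ \<open>fst p \<subseteq> {1..n}\<close>] by simp
      ultimately show ?thesis by (cases p) auto
    qed
    then show "X \<in> Pow (Pow {1..n} \<times> {..n})" by blast
  qed
  then show ?thesis using finite_subset by blast
qed

text \<open>Once the entry at \<open>j\<close> is deleted, the only nonempty gap is at that rank, as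
  all other neighbours are covers. The coboundary of the shortened chain is one common sign times
  the sum over all ways to refill the rank, so the last term can be isolated inside
  \<open>M\<close>.\<close>

lemma span_chain_closed:
  fixes M :: "(wpartition list \<Rightarrow>\<^sub>0 'r::comm_ring_1) set"
  assumes n: "1 \<le> n" "i \<le> n - 1"
    and M: "\<And>f g. f \<in> M \<Longrightarrow> g \<in> M \<Longrightarrow> f + g \<in> M" "\<And>c f. f \<in> M \<Longrightarrow> scale c f \<in> M" "0 \<in> M"
    and co: "coboundaries wp_less (wpartitions n) (wp_bot n) (wp_top n i) (int n - 3) \<subseteq> M"
  shows "chain_closed n i (\<lambda>W. Poly_Mapping.single (butlast (tl W)) 1 \<in> M)"
proof
  let ?Q = "open_interval wp_less (wpartitions n) (wp_bot n) (wp_top n i)"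
  fix W j
  assume W: "max_chain n i W" and j: "0 < j" "Suc j < length W"
    and others: "\<And>Y. Y \<in> wpartitions n \<Longrightarrow> wp_less (W ! (j - 1)) Y \<Longrightarrow> wp_less Y (W ! Suc j) \<Longrightarrow> Y \<noteq> W ! j \<Longrightarrow>
        Poly_Mapping.single (butlast (tl (W[j := Y]))) 1 \<in> M"
  have WW: "sorted_wrt wp_less W" "set W \<subseteq> wpartitions n" "length W = n" using W by (auto simp: max_chain_def)
  define xs where "xs = butlast (tl W)"
  have n3: "3 \<le> n" using j WW(3) by simp
  have eq: "W = wp_bot n # xs @ [wp_top n i]" using max_chain_cases[OF W] n3 by (auto simp: xs_def)
  have len: "length xs = n - 2" using WW(3) arg_cong[OF eq, of length] by simp
  \<comment> \<open>\<open>W\<close> has the bottom in front, so entry \<open>j\<close> of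
    \<open>W\<close> is entry \<open>k\<close> of the proper part \<open>xs\<close>.\<close>
  obtain k where k: "j = Suc k" using j(1) by (cases j) auto
  have kx: "k < length xs" using j(2) WW(3) len k by simp
  define ys where "ys = take k xs @ drop (Suc k) xs"
  define V where "V = wp_bot n # ys @ [wp_top n i]"
  have lys: "length ys = n - 3" using kx len by (simp add: ys_def)
  have V: "V = take j W @ drop (Suc j) W"
    using kx by (simp add: V_def ys_def k eq)
  have sV: "sorted_wrt wp_less V"
    using WW(1) unfolding V by (metis (no_types, lifting) append_take_drop_id id_take_nth_drop j(2) Suc_lessD sorted_wrt_append list.set_intros(2) sorted_wrt.simps(2))
  have sub: "set ys \<subseteq> wpartitions n"
    using WW(2) set_take_subset[of k xs] set_drop_subset[of "Suc k" xs] unfolding eq ys_def by auto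
  have Vm: "V ! m = (if m < j then W ! m else W ! Suc m)" if "Suc m < n" for m
    using that WW(3) j by (auto simp: V nth_append min_def)
  have Wc: "card (W ! m) + m = n" if "m < n" for m by (rule max_chain_card[OF n W that])
  have Wp: "W ! m \<in> wpartitions n" if "m < n" for m using WW that by auto
  have gap_other: "gap wp_less ?Q ys m = {}" if m: "m \<le> length ys" "m \<noteq> k" for m
  proof -
    have mn: "Suc (Suc m) < n" using m(1) lys n3 by simp
    obtain m' where m': "V ! m = W ! m'" "V ! Suc m = W ! Suc m'" "Suc m' < n"
    proof (cases "m < k")
      case True
      then show ?thesis using that[of m] Vm[of m] Vm[of "Suc m"] mn k by simp
    next
      case False
      then show ?thesis using that[of "Suc m"] Vm[of m] Vm[of "Suc m"] mn k m(2) by simp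
    qed
    have "card (W ! m') \<le> card (W ! Suc m') + 1" using Wc[of m'] Wc[of "Suc m'"] m'(3) by simp
    then show ?thesis
      using gap_full_chain[OF n V_def sV sub m(1)] no_wp_between[OF Wp[of m'] _ Wp[of "Suc m'"]] m' by auto
  qed
  define G where "G = {Y \<in> wpartitions n. wp_less (W ! (j - 1)) Y \<and> wp_less Y (W ! Suc j)}"
  have gap_k: "gap wp_less ?Q ys k = G"
  proof -
    have "k \<le> length ys" using kx len lys n3 by simp
    moreover have "V ! k = W ! (j - 1)" "V ! Suc k = W ! Suc j"
      using Vm[of k] Vm[of "Suc k"] j WW(3) k by simp_all
    ultimately show ?thesis using gap_full_chain[OF n V_def sV sub] by (simp add: G_def)
  qed
  let ?s = "\<lambda>Y. Poly_Mapping.single (take k ys @ Y # drop k ys) 1 :: wpartition list \<Rightarrow>\<^sub>0 'r"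
  let ?d = "coboundary wp_less ?Q (Poly_Mapping.single ys 1) :: wpartition list \<Rightarrow>\<^sub>0 'r"
  have upd: "take k ys @ Y # drop k ys = butlast (tl (W[j := Y]))" for Y
  proof -
    have "W[j := Y] = wp_bot n # xs[k := Y] @ [wp_top n i]" using kx by (simp add: eq k list_update_append)
    then have "butlast (tl (W[j := Y])) = xs[k := Y]" by simp
    also have "\<dots> = take k xs @ Y # drop (Suc k) xs" using kx by (simp add: upd_conv_take_nth_drop)
    finally show ?thesis using kx by (simp add: ys_def)
  qed
  have d: "?d = scale ((- 1) ^ k) (\<Sum>Y \<in> G. ?s Y)"
  proof -
    have "?d = (\<Sum>m \<le> length ys. \<Sum>z \<in> gap wp_less ?Q ys m. Poly_Mapping.single (take m ys @ z # drop m ys) ((- 1) ^ m))"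
      unfolding coboundary_single by simp
    also have "\<dots> = (\<Sum>m \<in> {k}. \<Sum>z \<in> gap wp_less ?Q ys m. Poly_Mapping.single (take m ys @ z # drop m ys) ((- 1) ^ m))"
      by (rule sum.mono_neutral_right) (use gap_other kx len lys n3 in auto)
    also have "\<dots> = scale ((- 1) ^ k) (\<Sum>Y \<in> G. ?s Y)" by (simp add: gap_k scale_sum scale_simps)
    finally show ?thesis .
  qed
  have finG: "finite G" using finite_wpartitions[of n] by (simp add: G_def)
  have WjG: "W ! j \<in> G"
    using sorted_wrt_nth_less[OF WW(1), of "j - 1" j] sorted_wrt_nth_less[OF WW(1), of j "Suc j"] j WW(3) Wp[of j]
    by (simp add: G_def)
  have "ys \<in> interval_chains wp_less (wpartitions n) (wp_bot n) (wp_top n i) (int n - 3 - 1)"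
  proof -
    have "wp_bot n \<noteq> wp_top n i" using wp_bot_wpartitions(2)[of n] wp_top_wpartitions(2)[OF n] n3 by auto
    moreover have "sorted_wrt wp_less ys" "set ys \<subseteq> ?Q"
      using sV sub by (auto simp: V_def sorted_wrt_append open_interval_def)
    ultimately show ?thesis using lys n3 by (simp add: interval_chains_def order_chains_def)
  qed
  then have "Poly_Mapping.single ys 1 \<in> chain_module wp_less (wpartitions n) (wp_bot n) (wp_top n i) (int n - 3 - 1)"
    by (simp add: chain_module_def)
  then have "?d \<in> M" using co unfolding coboundaries_def by blast
  then have "scale ((- 1) ^ k) ?d \<in> M" by (rule M(2))
  then have sum: "(\<Sum>Y \<in> G. ?s Y) \<in> M"
    unfolding d scale_simps(2)[symmetric] by (simp add: scale_simps power_mult_distrib[symmetric])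
  have "(\<Sum>Y \<in> G - {W ! j}. ?s Y) \<in> M"
  proof -
    have "?s Y \<in> M" if "Y \<in> G - {W ! j}" for Y
      unfolding upd by (rule others) (use that in \<open>auto simp: G_def\<close>)
    then show ?thesis by (intro sum_closed[OF M(3) M(1)])
  qed
  then have "(\<Sum>Y \<in> G. ?s Y) + scale (- 1) (\<Sum>Y \<in> G - {W ! j}. ?s Y) \<in> M" using sum M(1,2) by blast
  moreover have "(\<Sum>Y \<in> G. ?s Y) = ?s (W ! j) + (\<Sum>Y \<in> G - {W ! j}. ?s Y)"
    using finG WjG by (simp add: sum.remove)
  ultimately have "?s (W ! j) \<in> M" by (simp add: scale_simps)
  then show "Poly_Mapping.single (butlast (tl W)) 1 \<in> M" unfolding upd by simp
qed (use n in simp_all)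


lemma residue_class_eq_iff:
  fixes B :: "'m::ab_group_add set"
  assumes "0 \<in> B" "\<And>a b. a \<in> B \<Longrightarrow> b \<in> B \<Longrightarrow> a + b \<in> B" "\<And>a. a \<in> B \<Longrightarrow> - a \<in> B"
  shows "residue_class B f = residue_class B g \<longleftrightarrow> f - g \<in> B"
proof
  assume "residue_class B f = residue_class B g"
  moreover have "f \<in> residue_class B f" using assms(1) by (simp add: residue_class_def)
  ultimately show "f - g \<in> B" by (simp add: residue_class_def)
next
  assume d: "f - g \<in> B"
  have "w - f \<in> B \<longleftrightarrow> w - g \<in> B" for w
    using assms(2)[of "w - f" "f - g"] assms(2)[of "w - g" "- (f - g)"] assms(3)[OF d] d by auto
  then show "residue_class B f = residue_class B g" by (simp add: residue_class_def)
qed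

section \<open>Both bases from the pairing matrix\<close>

locale weighted_partition_cycles =
  fixes n i :: nat and \<rho> :: "(nat \<times> nat) set \<Rightarrow> (wpartition list \<Rightarrow>\<^sub>0 int)" and R :: "'r::comm_ring_1 itself"
  assumes n: "1 \<le> n" "i \<le> n - 1"
    and \<rho>: "\<And>T. T \<in> rooted_trees n i \<Longrightarrow> fundamental_cycle n T (\<rho> T)"
begin

abbreviation "I \<equiv> liu_trees n i"
abbreviation "cycle T \<equiv> int_coeffs (\<rho> T) :: wpartition list \<Rightarrow>\<^sub>0 'r"
abbreviation "pc \<equiv> proper_tree_chain n i"
abbreviation "pclass t \<equiv> Poly_Mapping.single (pc t) 1 :: wpartition list \<Rightarrow>\<^sub>0 'r"
abbreviation "top_cycles \<equiv>
  cycles wp_less (wpartitions n) (wp_bot n) (wp_top n i) (int n - 3) :: (wpartition list \<Rightarrow>\<^sub>0 'r) set"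
abbreviation "top_cochains \<equiv>
  chain_module wp_less (wpartitions n) (wp_bot n) (wp_top n i) (int n - 3) :: (wpartition list \<Rightarrow>\<^sub>0 'r) set"
abbreviation "top_coboundaries \<equiv>
  coboundaries wp_less (wpartitions n) (wp_bot n) (wp_top n i) (int n - 3) :: (wpartition list \<Rightarrow>\<^sub>0 'r) set"

lemma liu_bicolored: "t \<in> I \<Longrightarrow> t \<in> bicolored_trees n i"
  by (simp add: liu_trees_def)

lemma tree_edges_rooted: "s \<in> I \<Longrightarrow> tree_edges s \<in> rooted_trees n i"
  using bij_betw_tree_edges by (auto simp: bij_betw_def)

lemma finite_rooted_trees: "finite (rooted_trees n i)"
  by (rule finite_subset[of _ "Pow ({1..n} \<times> {1..n})"]) (auto simp: rooted_trees_def rooted_tree_def)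

lemma finite_I: "finite I"
  using bij_betw_finite[OF bij_betw_tree_edges] finite_rooted_trees by blast

lemma cycle_in: "T \<in> rooted_trees n i \<Longrightarrow> cycle T \<in> top_cycles"
proof -
  assume T: "T \<in> rooted_trees n i"
  have "\<rho> T \<in> cycles wp_less (wpartitions n) (wp_bot n) (wp_top n i) (int n - 3)"
    by (rule fundamental_cycle_support(1)[OF n T \<rho>[OF T]])
  moreover have "Poly_Mapping.keys (cycle T) \<subseteq> Poly_Mapping.keys (\<rho> T)" by (auto simp: in_keys_iff)
  moreover have "(int_coeffs 0 :: wpartition list \<Rightarrow>\<^sub>0 'r) = 0" by (rule poly_mapping_eqI) simp
  ultimately show ?thesis by (auto simp: cycles_def chain_module_def boundary_int_coeffs)
qed

text \<open>A nonzero entry places the chain of \<open>t\<close> in the Boolean algebra of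
  \<open>tree_edges s\<close>, so \<open>t\<close> fits this tree; the root of the fit is the node
  without parent, which is \<open>valency s\<close>.\<close>

lemma matrix_rel:
  assumes "t \<in> I" "s \<in> I" "Poly_Mapping.lookup (cycle (tree_edges s)) (pc t) \<noteq> 0"
  shows "(t, s) \<in> liu_rel {1..n}"
proof -
  have T: "tree_edges s \<in> rooted_trees n i" by (rule tree_edges_rooted[OF assms(2)])
  have ls: "t \<in> liu_on {1..n}" "s \<in> liu_on {1..n}" using assms(1,2) by (auto simp: liu_trees_eq)
  then have L: "liu_lyndon s" "distinct (leaves s)" "set (leaves s) = {1..n}" "distinct (leaves t)" "set (leaves t) = {1..n}"
    by (auto simp: liu_on_def)
  have "pc t \<in> Poly_Mapping.keys (\<rho> (tree_edges s))" using assms(3) by (auto simp: in_keys_iff)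
  then have "set (pc t) \<subseteq> tree_poset n (tree_edges s)" by (rule fundamental_cycle_support(2)[OF n T \<rho>[OF T]])
  then obtain w where w: "fits t w (tree_edges s)" using tree_chain_fits[OF n liu_bicolored[OF assms(1)] T] by blast
  have "w = valency s"
  proof (rule ccontr)
    assume "w \<noteq> valency s"
    then have "\<exists>p. (p, valency s) \<in> tree_edges s"
      using fits_rooted[OF w L(4)] valency_in[of s] L(3,5) by blast
    then show False using fits_rooted[OF fits_tree_edges[OF L(1,2)] L(2)] by blast
  qed
  then show ?thesis using w ls by (simp add: liu_rel_def)
qed

lemma matrix_diag:
  assumes "t \<in> I"
  shows "Poly_Mapping.lookup (cycle (tree_edges t)) (pc t) * Poly_Mapping.lookup (cycle (tree_edges t)) (pc t) = 1"
proof -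
  have "\<bar>Poly_Mapping.lookup (\<rho> (tree_edges t)) (pc t)\<bar> = 1"
    by (rule fundamental_cycle_coeff[OF n assms \<rho>[OF tree_edges_rooted[OF assms]]])
  then have "Poly_Mapping.lookup (\<rho> (tree_edges t)) (pc t) = 1 \<or> Poly_Mapping.lookup (\<rho> (tree_edges t)) (pc t) = - 1"
    by linarith
  then show ?thesis by auto
qed

lemma liu_antisym:
  "t \<in> I \<Longrightarrow> s \<in> I \<Longrightarrow> (t, s) \<in> (liu_rel {1..n})\<^sup>* \<Longrightarrow> (s, t) \<in> (liu_rel {1..n})\<^sup>* \<Longrightarrow> t = s"
  by (rule liu_rel_antisym[of _ "{1..n}"]) (auto simp: liu_trees_eq)

lemmas matrix_solve = triangular_solve[where M = "\<lambda>t s. Poly_Mapping.lookup (cycle (tree_edges s)) (pc t)",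
  OF finite_I matrix_rel liu_antisym matrix_diag]

lemma matrix_solution:
  "\<exists>a. \<forall>t \<in> I. (\<Sum>s \<in> I. a s * Poly_Mapping.lookup (cycle (tree_edges s)) (pc t)) = b t"
  by (rule conjunct1[OF matrix_solve])

lemma matrix_kernel:
  assumes "\<forall>t \<in> I. (\<Sum>s \<in> I. a s * Poly_Mapping.lookup (cycle (tree_edges s)) (pc t)) = 0"
  shows "\<forall>s \<in> I. a s = 0"
proof -
  have "(\<forall>t \<in> I. (\<Sum>s \<in> I. a s * Poly_Mapping.lookup (cycle (tree_edges s)) (pc t)) = 0) \<longrightarrow> (\<forall>s \<in> I. a s = 0)"
    by (rule spec[OF conjunct1[OF conjunct2[OF matrix_solve]]])
  then show ?thesis using assms by (rule mp)
qed

lemma matrix_cokernel: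
  assumes "\<forall>s \<in> I. (\<Sum>t \<in> I. c t * Poly_Mapping.lookup (cycle (tree_edges s)) (pc t)) = 0"
  shows "\<forall>t \<in> I. c t = 0"
proof -
  have "(\<forall>s \<in> I. (\<Sum>t \<in> I. c t * Poly_Mapping.lookup (cycle (tree_edges s)) (pc t)) = 0) \<longrightarrow> (\<forall>t \<in> I. c t = 0)"
    by (rule spec[OF conjunct2[OF conjunct2[OF matrix_solve]]])
  then show ?thesis using assms by (rule mp)
qed

lemma zero_coboundary: "0 \<in> top_coboundaries"
  unfolding coboundaries_def by (rule image_eqI[of _ _ 0]) (simp_all add: coboundary_def chain_module_def)

text \<open>The set \<open>M\<close> of combinations of tree chains plus coboundaries contains the
  chains of Liu--Lyndon trees and meets the closure condition of \<open>chain_closed\<close>, so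
  rewriting brings all maximal chains into it.\<close>

lemma spanned:
  assumes "f \<in> top_cochains"
  shows "\<exists>a b. Poly_Mapping.keys a \<subseteq> I \<and> b \<in> top_coboundaries \<and> f = lincomb a pclass + b"
proof -
  define M where "M = {f. \<exists>a b. Poly_Mapping.keys a \<subseteq> I \<and> b \<in> top_coboundaries \<and> f = lincomb a pclass + b}"
  have add: "f + g \<in> M" if fg: "f \<in> M" "g \<in> M" for f g
  proof -
    obtain a b a' b' where ab: "Poly_Mapping.keys a \<subseteq> I" "b \<in> top_coboundaries" "f = lincomb a pclass + b"
      "Poly_Mapping.keys a' \<subseteq> I" "b' \<in> top_coboundaries" "g = lincomb a' pclass + b'"
      using fg unfolding M_def by blast
    have "Poly_Mapping.keys (a + a') \<subseteq> I" using keys_add[of a a'] ab by blast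
    moreover have "b + b' \<in> top_coboundaries" by (rule coboundaries_add[OF ab(2,5)])
    moreover have "f + g = lincomb (a + a') pclass + (b + b')" using ab by (simp add: lincomb_add)
    ultimately show ?thesis unfolding M_def by blast
  qed
  have sc: "scale c f \<in> M" if f: "f \<in> M" for c f
  proof -
    obtain a b where ab: "Poly_Mapping.keys a \<subseteq> I" "b \<in> top_coboundaries" "f = lincomb a pclass + b"
      using f unfolding M_def by blast
    have "Poly_Mapping.keys (scale c a) \<subseteq> Poly_Mapping.keys a" by (auto simp: in_keys_iff)
    then have "Poly_Mapping.keys (scale c a) \<subseteq> I" using ab(1) by blast
    moreover have "scale c b \<in> top_coboundaries" by (rule coboundaries_scale[OF ab(2)])
    moreover have "scale c f = lincomb (scale c a) pclass + scale c b" using ab by (simp add: lincomb_scale scale_simps)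
    ultimately show ?thesis unfolding M_def by blast
  qed
  have cob: "top_coboundaries \<subseteq> M"
  proof
    fix b assume "b \<in> top_coboundaries"
    moreover have "b = lincomb 0 pclass + b" by (simp add: lincomb_def)
    ultimately show "b \<in> M" unfolding M_def using keys_zero by (metis (mono_tags, lifting) empty_subsetI mem_Collect_eq)
  qed
  then have zero: "0 \<in> M" using zero_coboundary by blast
  interpret chain_closed n i "\<lambda>W. Poly_Mapping.single (butlast (tl W)) (1 :: 'r) \<in> M"
    by (rule span_chain_closed[OF n add sc zero cob])
  have liu: "reached (postorder t)" if t: "t \<in> I" for t
  proof -
    have "pclass t = lincomb (Poly_Mapping.single t 1) pclass + 0" by (simp add: lincomb_single scale_simps)
    moreover have "Poly_Mapping.keys (Poly_Mapping.single t (1 :: 'r)) \<subseteq> I" using t by simp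
    ultimately have "pclass t \<in> M" unfolding M_def using zero_coboundary by blast
    then show ?thesis
      unfolding reached_def proper_tree_chain_eq[OF n liu_bicolored[OF t]] tree_chain_def by simp
  qed
  have "Poly_Mapping.single xs 1 \<in> M" if "xs \<in> Poly_Mapping.keys f" for xs
  proof -
    have "xs \<in> interval_chains wp_less (wpartitions n) (wp_bot n) (wp_top n i) (int n - 3)"
      using that assms by (auto simp: chain_module_def)
    then obtain W where "max_chain n i W" "xs = butlast (tl W)"
      unfolding interval_chains_max_chain[OF n] by blast
    then show ?thesis using max_chain_reached[OF liu] by blast
  qed
  then have "(\<Sum>xs \<in> Poly_Mapping.keys f. scale (Poly_Mapping.lookup f xs) (Poly_Mapping.single xs 1)) \<in> M"
    by (intro sum_closed[OF zero add] sc)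
  then have "f \<in> M" by (simp only: poly_mapping_sum_single[of f, symmetric])
  then show ?thesis by (simp add: M_def)
qed

text \<open>For \<open>n = 1\<close> the interval is degenerate: there are no cochains one degree
  lower, and 0 is the only coboundary. Otherwise adjointness applies.\<close>

lemma pairing_top_coboundary:
  assumes z: "z \<in> top_cycles" and b: "b \<in> top_coboundaries"
  shows "pairing z b = 0"
proof (cases "wp_bot n = wp_top n i")
  case True
  then have "n = 1" using wp_bot_wpartitions(2)[of n] wp_top_wpartitions(2)[OF n] by simp
  then have "b = 0" using b True
    by (auto simp: coboundaries_def chain_module_def interval_chains_def coboundary_def)
  then show ?thesis by (simp add: pairing_zero)
next
  case False
  obtain f where "f \<in> chain_module wp_less (wpartitions n) (wp_bot n) (wp_top n i) (int n - 3 - 1)"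
    "b = coboundary wp_less (open_interval wp_less (wpartitions n) (wp_bot n) (wp_top n i)) f"
    using b unfolding coboundaries_def by blast
  then show ?thesis using pairing_coboundary[OF finite_wpartitions _ _ False, where r = "int n - 3 - 1" and z = z and f = f] z by simp
qed

lemma pairing_lincomb:
  assumes "Poly_Mapping.keys a \<subseteq> I"
  shows "pairing z (lincomb a pclass) = (\<Sum>t \<in> I. Poly_Mapping.lookup a t * Poly_Mapping.lookup z (pc t))"
  unfolding lincomb_superset[OF finite_I assms] by (simp add: pairing_sum pairing_scale pairing_single)

text \<open>A coefficient of \<open>d\<close> is its pairing with a single chain. Modulo
  coboundaries, which pair to 0, this chain is a combination of chains of Liu--Lyndon trees.\<close>

lemma cycle_zero:
  assumes d: "d \<in> top_cycles" and z: "\<And>t. t \<in> I \<Longrightarrow> Poly_Mapping.lookup d (pc t) = 0"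
  shows "d = 0"
proof (rule poly_mapping_eqI)
  fix xs
  show "Poly_Mapping.lookup d xs = Poly_Mapping.lookup 0 xs"
  proof (cases "xs \<in> Poly_Mapping.keys d")
    case True
    then have "Poly_Mapping.single xs 1 \<in> top_cochains" using d by (auto simp: cycles_def chain_module_def)
    then obtain a b where ab: "Poly_Mapping.keys a \<subseteq> I" "b \<in> top_coboundaries"
      "Poly_Mapping.single xs 1 = lincomb a pclass + b" using spanned by blast
    have "Poly_Mapping.lookup d xs = pairing d (Poly_Mapping.single xs 1)" by (simp add: pairing_single)
    also have "\<dots> = 0" unfolding ab(3) using pairing_top_coboundary[OF d ab(2)] z
      by (simp add: pairing_add pairing_lincomb[OF ab(1)])
    finally show ?thesis by simp
  qed (simp add: in_keys_iff)
qed

lemma lookup_lincomb_cycles: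
  assumes "Poly_Mapping.keys a \<subseteq> rooted_trees n i"
  shows "Poly_Mapping.lookup (lincomb a cycle) xs =
    (\<Sum>s \<in> I. Poly_Mapping.lookup a (tree_edges s) * Poly_Mapping.lookup (cycle (tree_edges s)) xs)"
  unfolding lincomb_superset[OF finite_rooted_trees assms] lookup_sum
    sum.reindex_bij_betw[OF bij_betw_tree_edges, symmetric] by simp

text \<open>Solving the matrix equation matches the coefficients of \<open>z\<close> at the chains
  of Liu--Lyndon trees, and by \<open>cycle_zero\<close> these determine a cycle. Uniqueness is the
  trivial kernel.\<close>

lemma homology_basis_cycles:
  "homology_basis wp_less (wpartitions n) (wp_bot n) (wp_top n i) (int n - 3) (rooted_trees n i) cycle"
  unfolding homology_basis_def class_basis_def homology_def boundaries_top[OF n subset_refl]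
proof (intro conjI ballI)
  fix T assume "T \<in> rooted_trees n i"
  then show "residue_class {0} (cycle T) \<in> residue_class {0} ` top_cycles" using cycle_in by blast
next
  fix h assume "h \<in> residue_class {0} ` top_cycles"
  then obtain z where z: "z \<in> top_cycles" "h = {z}" by (auto simp: residue_class_zero)
  show "\<exists>!a. Poly_Mapping.keys a \<subseteq> rooted_trees n i \<and> h = residue_class {0} (lincomb a cycle)"
    unfolding residue_class_zero z(2)
  proof (rule ex_ex1I)
    obtain a where a: "\<forall>t \<in> I. (\<Sum>s \<in> I. a s * Poly_Mapping.lookup (cycle (tree_edges s)) (pc t)) = Poly_Mapping.lookup z (pc t)"
      using matrix_solution[of "\<lambda>t. Poly_Mapping.lookup z (pc t)"] by blast
    \<comment> \<open>The solution is indexed by Liu--Lyndon trees; the bijection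
      \<open>tree_edges\<close> carries it over to rooted trees.\<close>
    obtain p where p: "Poly_Mapping.keys p \<subseteq> rooted_trees n i"
      "\<forall>T \<in> rooted_trees n i. Poly_Mapping.lookup p T = a (the_inv_into I tree_edges T)"
      using ex_poly_mapping[OF finite_rooted_trees, of "\<lambda>T. a (the_inv_into I tree_edges T)"] by blast
    have pa: "Poly_Mapping.lookup p (tree_edges s) = a s" if "s \<in> I" for s
      using p(2) tree_edges_rooted[OF that] the_inv_into_f_f[OF bij_betw_imp_inj_on[OF bij_betw_tree_edges] that] by simp
    have "lincomb p cycle \<in> top_cycles" by (rule cycles_lincomb) (use p(1) cycle_in in blast)
    then have "z - lincomb p cycle \<in> top_cycles" by (rule cycles_diff[OF z(1)])
    moreover have "Poly_Mapping.lookup (z - lincomb p cycle) (pc t) = 0" if "t \<in> I" for t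
      using a that by (simp add: lookup_minus lookup_lincomb_cycles[OF p(1)] pa)
    ultimately have "z - lincomb p cycle = 0" by (rule cycle_zero)
    then show "\<exists>a. Poly_Mapping.keys a \<subseteq> rooted_trees n i \<and> {z} = {lincomb a cycle}" using p(1) by auto
  next
    fix a a' :: "(nat \<times> nat) set \<Rightarrow>\<^sub>0 'r"
    assume a: "Poly_Mapping.keys a \<subseteq> rooted_trees n i \<and> {z} = {lincomb a cycle}"
      and a': "Poly_Mapping.keys a' \<subseteq> rooted_trees n i \<and> {z} = {lincomb a' cycle}"
    have "Poly_Mapping.keys (a - a') \<subseteq> Poly_Mapping.keys a \<union> Poly_Mapping.keys a'"
      by (auto simp: in_keys_iff lookup_minus)
    then have k: "Poly_Mapping.keys (a - a') \<subseteq> rooted_trees n i" using a a' by blast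
    have "lincomb (a - a') cycle = 0" using a a' by (simp add: lincomb_diff)
    then have "\<forall>t \<in> I. (\<Sum>s \<in> I. Poly_Mapping.lookup (a - a') (tree_edges s) *
        Poly_Mapping.lookup (cycle (tree_edges s)) (pc t)) = 0"
      unfolding lookup_lincomb_cycles[OF k, symmetric] by simp
    then have "\<forall>s \<in> I. Poly_Mapping.lookup (a - a') (tree_edges s) = 0" by (rule matrix_kernel)
    then have "\<forall>T \<in> rooted_trees n i. Poly_Mapping.lookup (a - a') T = 0"
      using bij_betw_imp_surj_on[OF bij_betw_tree_edges] by (metis imageE)
    then have "a - a' = 0" using k by (intro poly_mapping_eqI) (auto simp: in_keys_iff)
    then show "a = a'" by simp
  qed
qed

text \<open>Generation is \<open>spanned\<close>. A linear relation between the classes is a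
  combination that is a coboundary; it pairs to 0 with all the cycles, so its coefficients lie in
  the kernel of the transposed matrix.\<close>

lemma cohomology_basis_chains:
  "cohomology_basis wp_less (wpartitions n) (wp_bot n) (wp_top n i) (int n - 3) I pclass"
proof -
  have neg: "- b \<in> top_coboundaries" if "b \<in> top_coboundaries" for b
    using coboundaries_scale[OF that, of "- 1"] by (simp add: scale_simps)
  have eq_iff: "residue_class top_coboundaries f = residue_class top_coboundaries g \<longleftrightarrow> f - g \<in> top_coboundaries" for f g
    by (rule residue_class_eq_iff[OF zero_coboundary]) (simp_all add: coboundaries_add neg)
  show ?thesis
    unfolding cohomology_basis_def class_basis_def cohomology_def
  proof (intro conjI ballI)
    fix t assume t: "t \<in> I"
    have "pc t \<in> interval_chains wp_less (wpartitions n) (wp_bot n) (wp_top n i) (int n - 3)"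
      unfolding interval_chains_max_chain[OF n] proper_tree_chain_eq[OF n liu_bicolored[OF t]]
      using tree_chain_max_chain(2)[OF n liu_bicolored[OF t]] by blast
    then have "pclass t \<in> top_cochains" by (simp add: chain_module_def)
    then have "pclass t \<in> cocycles wp_less (wpartitions n) (wp_bot n) (wp_top n i) (int n - 3)"
      using coboundary_top_zero[OF n] by (simp add: cocycles_def)
    then show "residue_class top_coboundaries (pclass t) \<in>
        residue_class top_coboundaries ` cocycles wp_less (wpartitions n) (wp_bot n) (wp_top n i) (int n - 3)"
      by (rule imageI)
  next
    fix h assume "h \<in> residue_class top_coboundaries ` cocycles wp_less (wpartitions n) (wp_bot n) (wp_top n i) (int n - 3)"
    then obtain f where f: "f \<in> top_cochains" "h = residue_class top_coboundaries f" by (auto simp: cocycles_def)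
    show "\<exists>!a. Poly_Mapping.keys a \<subseteq> I \<and> h = residue_class top_coboundaries (lincomb a pclass)"
    proof (rule ex_ex1I)
      obtain a b where ab: "Poly_Mapping.keys a \<subseteq> I" "b \<in> top_coboundaries" "f = lincomb a pclass + b"
        using spanned[OF f(1)] by blast
      have "residue_class top_coboundaries f = residue_class top_coboundaries (lincomb a pclass)"
        unfolding eq_iff using ab(2,3) by simp
      then show "\<exists>a. Poly_Mapping.keys a \<subseteq> I \<and> h = residue_class top_coboundaries (lincomb a pclass)"
        using ab(1) f(2) by blast
    next
      fix a a' :: "btree \<Rightarrow>\<^sub>0 'r"
      assume a: "Poly_Mapping.keys a \<subseteq> I \<and> h = residue_class top_coboundaries (lincomb a pclass)"
        and a': "Poly_Mapping.keys a' \<subseteq> I \<and> h = residue_class top_coboundaries (lincomb a' pclass)"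
      have "Poly_Mapping.keys (a - a') \<subseteq> Poly_Mapping.keys a \<union> Poly_Mapping.keys a'"
        by (auto simp: in_keys_iff lookup_minus)
      then have k: "Poly_Mapping.keys (a - a') \<subseteq> I" using a a' by blast
      have "residue_class top_coboundaries (lincomb a pclass) = residue_class top_coboundaries (lincomb a' pclass)"
        using a a' by simp
      then have b: "lincomb (a - a') pclass \<in> top_coboundaries" unfolding eq_iff lincomb_diff .
      have "\<forall>s \<in> I. (\<Sum>t \<in> I. Poly_Mapping.lookup (a - a') t * Poly_Mapping.lookup (cycle (tree_edges s)) (pc t)) = 0"
        using pairing_top_coboundary[OF cycle_in[OF tree_edges_rooted] b]
        by (simp add: pairing_lincomb[OF k])
      then have "\<forall>t \<in> I. Poly_Mapping.lookup (a - a') t = 0"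
        by (rule matrix_cokernel)
      then have "a - a' = 0" using k by (intro poly_mapping_eqI) (auto simp: in_keys_iff)
      then show "a = a'" by simp
    qed
  qed
qed

end

theorem theorem5p12:
  fixes n i :: nat
    and \<rho> :: "(nat \<times> nat) set \<Rightarrow> (wpartition list \<Rightarrow>\<^sub>0 int)"
  assumes "1 \<le> n" and "i \<le> n - 1"
    and "\<And>T. T \<in> rooted_trees n i \<Longrightarrow> fundamental_cycle n T (\<rho> T)"
  shows
    "homology_basis wp_less (wpartitions n) (wp_bot n) (wp_top n i) (int n - 3)
       (rooted_trees n i) (\<lambda>T. int_coeffs (\<rho> T) :: wpartition list \<Rightarrow>\<^sub>0 int) \<and>
     homology_basis wp_less (wpartitions n) (wp_bot n) (wp_top n i) (int n - 3)
       (rooted_trees n i) (\<lambda>T. int_coeffs (\<rho> T) :: wpartition list \<Rightarrow>\<^sub>0 'k::field) \<and>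
     cohomology_basis wp_less (wpartitions n) (wp_bot n) (wp_top n i) (int n - 3)
       (liu_trees n i)
       (\<lambda>t. Poly_Mapping.single (proper_tree_chain n i t) 1 :: wpartition list \<Rightarrow>\<^sub>0 int) \<and>
     cohomology_basis wp_less (wpartitions n) (wp_bot n) (wp_top n i) (int n - 3)
       (liu_trees n i)
       (\<lambda>t. Poly_Mapping.single (proper_tree_chain n i t) 1 :: wpartition list \<Rightarrow>\<^sub>0 'k::field)"
proof -
  \<comment> \<open>The argument is the same for both coefficient rings, selected by the dummy type
    parameter.\<close>
  interpret Z: weighted_partition_cycles n i \<rho> "TYPE(int)" by unfold_locales (use assms in auto)
  interpret K: weighted_partition_cycles n i \<rho> "TYPE('k)" by unfold_locales (use assms in auto)
  show ?thesis
    using Z.homology_basis_cycles K.homology_basis_cycles Z.cohomology_basis_chains K.cohomology_basis_chains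
    by blast
qed

end
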